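(* Let $(S,\eta,\operatorname{g})$ be a Sasakian manifold and $(\mathcal C(S),\mathcal C(\operatorname{g}))$ its Kähler cone. Suppose a Lie group $G$ acts on $S$ by isometries and by strong contactomorphisms (i.e. preserving $\eta$), with contact momentum map $\Phi:S\to\mathfrak g^*$, and let $G$ act on $\mathcal C(S)$ by the lifted action $g\cdot(x,r)=(g\cdot x,r)$, which commutes with the one-parameter group $\rho_t:(x,r)\mapsto(x,tr)$ generated by $R=r\partial_r$. Let $\mu\in\mathfrak g^*$ with kernel group $K_\mu$, and assume that $K_\mu$ acts properly on $\Phi^{-1}(\mathbb R^+\mu)$, that $\Phi$ is transverse to $\mathbb R^+\mu$, and that $\ker\mu+\mathfrak g_\mu=\mathfrak g$. Then the Kähler cone $\mathcal C(S_{\mathbb R^+\mu})$ of the reduced contact space $S_{\mathbb R^+\mu}$ at $\mu$ is the ray reduced space $\mathcal C(S)_{\mathbb R^+\mu}$ at $\mu$ for the lifted action on $\mathcal C(S)$; that is, the two are naturally identified (by $[x,r]\mapsto([x],r)$), compatibly with their symplectic forms and metrics.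
   Context: $\mathbb R^+=(0,\infty)$, $\mathbb R^+\mu=\{r\mu:r>0\}$. $G_\mu$ is the isotropy group of $\mu$ under the coadjoint action, $\mathfrak g_\mu$ its Lie algebra, and the kernel group $K_\mu$ is the unique connected normal Lie subgroup of $G_\mu$ with Lie algebra $\ker(\mu|_{\mathfrak g_\mu})$. A Sasakian structure on an exact contact manifold $(S,\eta)$ with Reeb field $\mathfrak R$ is a Riemannian metric $\operatorname{g}$ for which there is a $(1,1)$-tensor field $\varphi$ with $\varphi^2=-\mathrm{Id}+\eta\otimes\mathfrak R$, $\eta(X)=\operatorname{g}(X,\mathfrak R)$, $d\eta(X,Y)=\operatorname{g}(X,\varphi Y)$. The cone of $S$ is $\mathcal C(S)=S\times\mathbb R^+$ with symplectic form $dr^2\wedge\eta+r^2d\eta=d(r^2\eta)$ and Kähler metric $\mathcal C(\operatorname{g})=r^2\operatorname{g}+dr^2$ (symplectic form normalized up to the usual universal constant/sign conventions). The contact momentum map is $\langle\Phi(x),\xi\rangle=\eta(\xi_S)(x)$. The lifted action has momentum map $\Phi_s(x,r)=r^2\Phi(x)$ (up to the overall sign convention for momentum maps). The contact reduced space is $S_{\mathbb R^+\mu}=\Phi^{-1}(\mathbb R^+\mu)/K_\mu$, with contact form $\eta_{\mathbb R^+\mu}$ and metric $\operatorname{g}_{\mathbb R^+\mu}$ obtained by projecting the restrictions of $\eta$ and $\operatorname{g}$ to $\Phi^{-1}(\mathbb R^+\mu)$; the ray reduced space of the cone is $\mathcal C(S)_{\mathbb R^+\mu}=\Phi_s^{-1}(\mathbb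 R^+\mu)/K_\mu$, with symplectic form and metric obtained by projecting the restrictions of those of $\mathcal C(S)$ to $\Phi_s^{-1}(\mathbb R^+\mu)$. *)

theory Defs
  imports "HOL-Analysis.Analysis" "HOL-Algebra.Group_Action"
begin

section \<open>Smooth maps between normed spaces\<close>

text \<open>Only used for finite-dimensional spaces and open \<open>U\<close>, where it is the usual class
  \<open>C\<^sup>k\<close>.\<close>

primrec Ck_on :: "nat \<Rightarrow> 'a::real_normed_vector set \<Rightarrow> ('a \<Rightarrow> 'b::real_normed_vector) \<Rightarrow> bool" where
  "Ck_on 0 U f \<longleftrightarrow> continuous_on U f"
| "Ck_on (Suc k) U f \<longleftrightarrow>
     f differentiable_on U \<and> (\<forall>v. Ck_on k U (\<lambda>x. frechet_derivative f (at x) v))"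

definition smooth_on :: "'a::real_normed_vector set \<Rightarrow> ('a \<Rightarrow> 'b::real_normed_vector) \<Rightarrow> bool" where
  "smooth_on U f \<longleftrightarrow> (\<forall>k. Ck_on k U f)"

definition diffeo_on :: "'a::real_normed_vector set \<Rightarrow> 'b::real_normed_vector set \<Rightarrow> ('a \<Rightarrow> 'b) \<Rightarrow> bool" where
  "diffeo_on U V h \<longleftrightarrow>
     open U \<and> open V \<and> bij_betw h U V \<and> smooth_on U h \<and> smooth_on V (inv_into U h)"

text \<open>The convention \<open>d\<alpha>(X,Y) = (X \<alpha>(Y) - Y \<alpha>(X) - \<alpha>([X,Y])) / 2\<close> of contact metric
  geometry: with it, \<open>d\<eta>(X,Y) = g(X, \<phi> Y)\<close> makes \<open>d(r\<^sup>2\<eta>)\<close> the fundamental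
  form of the cone metric \<open>r\<^sup>2 g + dr\<^sup>2\<close>.\<close>

definition ext_d :: "('a::real_normed_vector \<Rightarrow> 'a \<Rightarrow> real) \<Rightarrow> 'a \<Rightarrow> 'a \<Rightarrow> 'a \<Rightarrow> real" where
  "ext_d \<alpha> y v w =
     (frechet_derivative (\<lambda>y'. \<alpha> y' w) (at y) v - frechet_derivative (\<lambda>y'. \<alpha> y' v) (at y) w) / 2"


section \<open>Manifolds\<close>

text \<open>The atlas is a family of charts \<open>mchart p : mdom p \<rightarrow> 'e\<close> indexed by the points of the
  manifold, with \<open>p \<in> mdom p\<close>. A tangent vector at \<open>p\<close> is identified with its coordinate
  vector in the preferred chart \<open>mchart p\<close>, so every tangent space is a copy of \<open>'e\<close>.\<close>

record ('a, 'e) manifold =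
  mtop :: "'a topology"
  mdom :: "'a \<Rightarrow> 'a set"
  mchart :: "'a \<Rightarrow> 'a \<Rightarrow> 'e"

definition mcarrier :: "('a, 'e) manifold \<Rightarrow> 'a set" where
  "mcarrier M = topspace (mtop M)"

definition mpar :: "('a, 'e) manifold \<Rightarrow> 'a \<Rightarrow> 'e \<Rightarrow> 'a" where
  "mpar M p = inv_into (mdom M p) (mchart M p)"

definition smooth_manifold :: "('a, 'e::real_normed_vector) manifold \<Rightarrow> bool" where
  "smooth_manifold M \<longleftrightarrow>
     Hausdorff_space (mtop M) \<and> second_countable (mtop M) \<and>
     (\<forall>p\<in>mcarrier M.
        openin (mtop M) (mdom M p) \<and> p \<in> mdom M p \<and>
        open (mchart M p ` mdom M p) \<and>
        homeomorphic_map (subtopology (mtop M) (mdom M p))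
          (top_of_set (mchart M p ` mdom M p)) (mchart M p)) \<and>
     (\<forall>p\<in>mcarrier M. \<forall>q\<in>mcarrier M.
        smooth_on (mchart M p ` (mdom M p \<inter> mdom M q)) (mchart M q \<circ> mpar M p))"

definition vec_manifold :: "('e::real_normed_vector, 'e) manifold" where
  "vec_manifold = \<lparr>mtop = euclidean, mdom = (\<lambda>_. UNIV), mchart = (\<lambda>_. id)\<rparr>"

definition half_line :: "(real, real) manifold" where
  "half_line = \<lparr>mtop = top_of_set {0<..}, mdom = (\<lambda>_. {0<..}), mchart = (\<lambda>_. id)\<rparr>"

definition prod_manifold :: "('a, 'e) manifold \<Rightarrow> ('b, 'f) manifold \<Rightarrow> ('a \<times> 'b, 'e \<times> 'f) manifold" where
  "prod_manifold M N =
     \<lparr>mtop = prod_topology (mtop M) (mtop N),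
      mdom = (\<lambda>(p, q). mdom M p \<times> mdom N q),
      mchart = (\<lambda>(p, q). map_prod (mchart M p) (mchart N q))\<rparr>"

definition smooth_map_on ::
  "('a, 'e::real_normed_vector) manifold \<Rightarrow> 'a set \<Rightarrow> ('b, 'f::real_normed_vector) manifold \<Rightarrow> ('a \<Rightarrow> 'b) \<Rightarrow> bool" where
  "smooth_map_on M W N F \<longleftrightarrow>
     openin (mtop M) W \<and> continuous_map (subtopology (mtop M) W) (mtop N) F \<and>
     (\<forall>p\<in>W. \<forall>q\<in>mcarrier N.
        smooth_on (mchart M p ` {x \<in> W \<inter> mdom M p. F x \<in> mdom N q}) (mchart N q \<circ> F \<circ> mpar M p))"

definition mfderiv ::
  "('a, 'e::real_normed_vector) manifold \<Rightarrow> ('b, 'f::real_normed_vector) manifold \<Rightarrow> ('a \<Rightarrow> 'b) \<Rightarrow> 'a \<Rightarrow> 'e \<Rightarrow> 'f" where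
  "mfderiv M N F p = frechet_derivative (mchart N (F p) \<circ> F \<circ> mpar M p) (at (mchart M p p))"

text \<open>The tangent space at \<open>z\<close> of a subset \<open>Z\<close>: velocities of smooth curves of \<open>M\<close> that stay
  in \<open>Z\<close>. For an embedded submanifold this is its tangent space.\<close>

definition tangent_set :: "('a, 'e::real_normed_vector) manifold \<Rightarrow> 'a set \<Rightarrow> 'a \<Rightarrow> 'e set" where
  "tangent_set M Z z =
     {mfderiv vec_manifold M \<gamma> 0 (1::real) | \<gamma> \<epsilon>.
        \<epsilon> > 0 \<and> smooth_map_on vec_manifold {-\<epsilon><..<\<epsilon>} M \<gamma> \<and> \<gamma> ` {-\<epsilon><..<\<epsilon>} \<subseteq> Z \<and> \<gamma> 0 = z}"


section \<open>Tensor fields on manifolds\<close>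

definition pullback1 ::
  "('a, 'e::real_normed_vector) manifold \<Rightarrow> ('b, 'f::real_normed_vector) manifold \<Rightarrow> ('a \<Rightarrow> 'b) \<Rightarrow>
   ('b \<Rightarrow> 'f \<Rightarrow> real) \<Rightarrow> 'a \<Rightarrow> 'e \<Rightarrow> real" where
  "pullback1 M N F \<alpha> p v = \<alpha> (F p) (mfderiv M N F p v)"

definition pullback2 ::
  "('a, 'e::real_normed_vector) manifold \<Rightarrow> ('b, 'f::real_normed_vector) manifold \<Rightarrow> ('a \<Rightarrow> 'b) \<Rightarrow>
   ('b \<Rightarrow> 'f \<Rightarrow> 'f \<Rightarrow> real) \<Rightarrow> 'a \<Rightarrow> 'e \<Rightarrow> 'e \<Rightarrow> real" where
  "pullback2 M N F \<alpha> p v w = \<alpha> (F p) (mfderiv M N F p v) (mfderiv M N F p w)"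

definition one_form :: "('a, 'e::real_normed_vector) manifold \<Rightarrow> ('a \<Rightarrow> 'e \<Rightarrow> real) \<Rightarrow> bool" where
  "one_form M \<alpha> \<longleftrightarrow>
     (\<forall>p\<in>mcarrier M. linear (\<alpha> p)) \<and>
     (\<forall>p\<in>mcarrier M. \<forall>v. smooth_on (mchart M p ` mdom M p)
        (\<lambda>y. pullback1 vec_manifold M (mpar M p) \<alpha> y v))"

definition riemannian_metric ::
  "('a, 'e::real_normed_vector) manifold \<Rightarrow> ('a \<Rightarrow> 'e \<Rightarrow> 'e \<Rightarrow> real) \<Rightarrow> bool" where
  "riemannian_metric M g \<longleftrightarrow>
     (\<forall>p\<in>mcarrier M. bilinear (g p) \<and> (\<forall>v w. g p v w = g p w v) \<and> (\<forall>v. v \<noteq> 0 \<longrightarrow> g p v v > 0)) \<and>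
     (\<forall>p\<in>mcarrier M. \<forall>v w. smooth_on (mchart M p ` mdom M p)
        (\<lambda>y. pullback2 vec_manifold M (mpar M p) g y v w))"

definition tensor_11 :: "('a, 'e::real_normed_vector) manifold \<Rightarrow> ('a \<Rightarrow> 'e \<Rightarrow> 'e) \<Rightarrow> bool" where
  "tensor_11 M \<phi> \<longleftrightarrow>
     (\<forall>p\<in>mcarrier M. linear (\<phi> p)) \<and>
     (\<forall>p\<in>mcarrier M. \<forall>v. smooth_on (mchart M p ` mdom M p)
        (\<lambda>y. mfderiv M vec_manifold (mchart M p) (mpar M p y)
               (\<phi> (mpar M p y) (mfderiv vec_manifold M (mpar M p) y v))))"

definition ext_deriv ::
  "('a, 'e::real_normed_vector) manifold \<Rightarrow> ('a \<Rightarrow> 'e \<Rightarrow> real) \<Rightarrow> 'a \<Rightarrow> 'e \<Rightarrow> 'e \<Rightarrow> real" where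
  "ext_deriv M \<alpha> p = ext_d (pullback1 vec_manifold M (mpar M p) \<alpha>) (mchart M p p)"

text \<open>Nondegeneracy of \<open>d\<eta>\<close> on the hyperplane field \<open>ker \<eta>\<close>.\<close>

definition contact_form :: "('a, 'e::real_normed_vector) manifold \<Rightarrow> ('a \<Rightarrow> 'e \<Rightarrow> real) \<Rightarrow> bool" where
  "contact_form M \<eta> \<longleftrightarrow>
     one_form M \<eta> \<and>
     (\<forall>p\<in>mcarrier M. (\<exists>v. \<eta> p v \<noteq> 0) \<and>
        (\<forall>v. \<eta> p v = 0 \<and> (\<forall>w. \<eta> p w = 0 \<longrightarrow> ext_deriv M \<eta> p v w = 0) \<longrightarrow> v = 0))"

definition reeb :: "('a, 'e::real_normed_vector) manifold \<Rightarrow> ('a \<Rightarrow> 'e \<Rightarrow> real) \<Rightarrow> 'a \<Rightarrow> 'e" where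
  "reeb M \<eta> p = (THE R. \<eta> p R = 1 \<and> (\<forall>v. ext_deriv M \<eta> p R v = 0))"

definition sasakian ::
  "('a, 'e::real_normed_vector) manifold \<Rightarrow> ('a \<Rightarrow> 'e \<Rightarrow> real) \<Rightarrow> ('a \<Rightarrow> 'e \<Rightarrow> 'e \<Rightarrow> real) \<Rightarrow> bool" where
  "sasakian M \<eta> g \<longleftrightarrow>
     smooth_manifold M \<and> contact_form M \<eta> \<and> riemannian_metric M g \<and>
     (\<exists>\<phi>. tensor_11 M \<phi> \<and>
        (\<forall>p\<in>mcarrier M. \<forall>v w.
           \<phi> p (\<phi> p v) = - v + \<eta> p v *\<^sub>R reeb M \<eta> p \<and>
           \<eta> p v = g p v (reeb M \<eta> p) \<and>
           ext_deriv M \<eta> p v w = g p v (\<phi> p w)))"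


section \<open>The Riemannian cone\<close>

definition riem_cone :: "('a, 'e) manifold \<Rightarrow> ('a \<times> real, 'e \<times> real) manifold" where
  "riem_cone M = prod_manifold M half_line"

text \<open>The one-form \<open>r\<^sup>2\<eta>\<close>; the symplectic form of the cone is
  \<open>d(r\<^sup>2\<eta>) = dr\<^sup>2 \<and> \<eta> + r\<^sup>2 d\<eta>\<close>. This and the cone metric are stated pointwise, so that
  they apply on a manifold as well as in a chart of an orbifold.\<close>

definition liouville :: "('a \<Rightarrow> 'e \<Rightarrow> real) \<Rightarrow> 'a \<times> real \<Rightarrow> 'e \<times> real \<Rightarrow> real" where
  "liouville \<eta> = (\<lambda>(x, r) (v, a). r\<^sup>2 * \<eta> x v)"

definition cone_metric ::
  "('a \<Rightarrow> 'e \<Rightarrow> 'e \<Rightarrow> real) \<Rightarrow> 'a \<times> real \<Rightarrow> 'e \<times> real \<Rightarrow> 'e \<times> real \<Rightarrow> real" where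
  "cone_metric g = (\<lambda>(x, r) (v, a) (w, b). r\<^sup>2 * g x v w + a * b)"

definition lifted_action :: "('g \<Rightarrow> 'a \<Rightarrow> 'a) \<Rightarrow> 'g \<Rightarrow> 'a \<times> real \<Rightarrow> 'a \<times> real" where
  "lifted_action act h = (\<lambda>(x, r). (act h x, r))"

definition cone_momentum :: "('a \<Rightarrow> 'd::real_vector) \<Rightarrow> 'a \<times> real \<Rightarrow> 'd" where
  "cone_momentum \<Phi> = (\<lambda>(x, r). r\<^sup>2 *\<^sub>R \<Phi> x)"


section \<open>Lie groups, actions and momentum maps\<close>

text \<open>The Lie algebra of a Lie group is its tangent space at the identity, hence a copy of the model
  space \<open>'l\<close>, and its dual is \<open>'l \<Rightarrow>\<^sub>L real\<close>. Model spaces of Lie groups are kept in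
  the class of real normed spaces because no Euclidean-space type has dimension 0; finite
  dimensionality is then the Heine-Borel property.\<close>

definition lie_group :: "('g, 'l::real_normed_vector) manifold \<Rightarrow> 'g monoid \<Rightarrow> bool" where
  "lie_group L G \<longleftrightarrow>
     smooth_manifold L \<and> group G \<and> mcarrier L = carrier G \<and>
     smooth_map_on (prod_manifold L L) (carrier G \<times> carrier G) L (\<lambda>(a, b). a \<otimes>\<^bsub>G\<^esub> b) \<and>
     smooth_map_on L (carrier G) L (\<lambda>a. inv\<^bsub>G\<^esub> a)"

definition smooth_action ::
  "('g, 'l::real_normed_vector) manifold \<Rightarrow> 'g monoid \<Rightarrow> ('a, 'e::real_normed_vector) manifold \<Rightarrow>
   ('g \<Rightarrow> 'a \<Rightarrow> 'a) \<Rightarrow> bool" where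
  "smooth_action L G M act \<longleftrightarrow>
     group_action G (mcarrier M) act \<and>
     smooth_map_on (prod_manifold L M) (carrier G \<times> mcarrier M) M (\<lambda>(h, x). act h x)"

definition inf_generator ::
  "('g, 'l::real_normed_vector) manifold \<Rightarrow> 'g monoid \<Rightarrow> ('a, 'e::real_normed_vector) manifold \<Rightarrow>
   ('g \<Rightarrow> 'a \<Rightarrow> 'a) \<Rightarrow> 'l \<Rightarrow> 'a \<Rightarrow> 'e" where
  "inf_generator L G M act \<xi> x = mfderiv L M (\<lambda>h. act h x) \<one>\<^bsub>G\<^esub> \<xi>"

definition contact_momentum_map ::
  "('g, 'l::real_normed_vector) manifold \<Rightarrow> 'g monoid \<Rightarrow> ('a, 'e::real_normed_vector) manifold \<Rightarrow>
   ('a \<Rightarrow> 'e \<Rightarrow> real) \<Rightarrow> ('g \<Rightarrow> 'a \<Rightarrow> 'a) \<Rightarrow> ('a \<Rightarrow> 'l \<Rightarrow>\<^sub>L real) \<Rightarrow> bool" where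
  "contact_momentum_map L G M \<eta> act \<Phi> \<longleftrightarrow>
     (\<forall>x\<in>mcarrier M. \<forall>\<xi>. blinfun_apply (\<Phi> x) \<xi> = \<eta> x (inf_generator L G M act \<xi> x))"

definition Ad :: "('g, 'l::real_normed_vector) manifold \<Rightarrow> 'g monoid \<Rightarrow> 'g \<Rightarrow> 'l \<Rightarrow> 'l" where
  "Ad L G h = mfderiv L L (\<lambda>a. h \<otimes>\<^bsub>G\<^esub> a \<otimes>\<^bsub>G\<^esub> inv\<^bsub>G\<^esub> h) \<one>\<^bsub>G\<^esub>"

definition isotropy_group ::
  "('g, 'l::real_normed_vector) manifold \<Rightarrow> 'g monoid \<Rightarrow> ('l \<Rightarrow>\<^sub>L real) \<Rightarrow> 'g set" where
  "isotropy_group L G \<mu> =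
     {h \<in> carrier G. \<forall>\<xi>. blinfun_apply \<mu> (Ad L G (inv\<^bsub>G\<^esub> h) \<xi>) = blinfun_apply \<mu> \<xi>}"

definition isotropy_algebra ::
  "('g, 'l::real_normed_vector) manifold \<Rightarrow> 'g monoid \<Rightarrow> ('l \<Rightarrow>\<^sub>L real) \<Rightarrow> 'l set" where
  "isotropy_algebra L G \<mu> = tangent_set L (isotropy_group L G \<mu>) \<one>\<^bsub>G\<^esub>"

text \<open>\<open>K\<close> carries its own manifold structure: a Lie subgroup is an injectively immersed one, a
  priori neither closed nor with the subspace topology.\<close>

definition kernel_group ::
  "('g, 'l::real_normed_vector) manifold \<Rightarrow> 'g monoid \<Rightarrow> ('l \<Rightarrow>\<^sub>L real) \<Rightarrow>
   ('g, 'k::real_normed_vector) manifold \<Rightarrow> bool" where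
  "kernel_group L G \<mu> K \<longleftrightarrow>
     lie_group K (G\<lparr>carrier := mcarrier K\<rparr>) \<and>
     connected_space (mtop K) \<and>
     normal (mcarrier K) (G\<lparr>carrier := isotropy_group L G \<mu>\<rparr>) \<and>
     smooth_map_on K (mcarrier K) L (\<lambda>a. a) \<and>
     (\<forall>a\<in>mcarrier K. inj (mfderiv K L (\<lambda>a. a) a)) \<and>
     range (mfderiv K L (\<lambda>a. a) \<one>\<^bsub>G\<^esub>) = {\<xi> \<in> isotropy_algebra L G \<mu>. blinfun_apply \<mu> \<xi> = 0}"

definition proper_action_on :: "'g topology \<Rightarrow> 'a topology \<Rightarrow> ('g \<Rightarrow> 'a \<Rightarrow> 'a) \<Rightarrow> bool" where
  "proper_action_on T X act \<longleftrightarrow>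
     proper_map (prod_topology T X) (prod_topology X X) (\<lambda>(h, x). (act h x, x))"

definition ray :: "'d::real_vector \<Rightarrow> 'd set" where
  "ray \<mu> = {r *\<^sub>R \<mu> | r. r > 0}"

definition ray_level :: "('a, 'e) manifold \<Rightarrow> ('a \<Rightarrow> 'd::real_vector) \<Rightarrow> 'd \<Rightarrow> 'a set" where
  "ray_level M \<Phi> \<mu> = {x \<in> mcarrier M. \<Phi> x \<in> ray \<mu>}"

text \<open>The tangent space of \<open>ray \<mu>\<close> at each of its points is the span of \<open>\<mu>\<close>, also for
  \<open>\<mu> = 0\<close>.\<close>

definition transverse_to_ray ::
  "('a, 'e::real_normed_vector) manifold \<Rightarrow> ('a \<Rightarrow> 'd::real_normed_vector) \<Rightarrow> 'd \<Rightarrow> bool" where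
  "transverse_to_ray M \<Phi> \<mu> \<longleftrightarrow>
     (\<forall>x\<in>ray_level M \<Phi> \<mu>.
        {mfderiv M vec_manifold \<Phi> x v + c | v c. c \<in> span {\<mu>}} = UNIV)"


section \<open>Orbifolds\<close>

text \<open>Under the hypotheses considered here the kernel group acts properly and locally freely on the
  level set, so the reduced spaces are in general orbifolds; they are manifolds when all groups
  \<open>ogrp i\<close> are trivial. The chart \<open>i\<close> is \<open>omap i : odom i \<rightarrow> odom i / ogrp i \<subseteq> X\<close>.\<close>

record ('i, 'x, 'q) orbifold =
  otop :: "'x topology"
  oidx :: "'i set"
  odom :: "'i \<Rightarrow> 'q set"
  ogrp :: "'i \<Rightarrow> ('q \<Rightarrow> 'q) set"
  omap :: "'i \<Rightarrow> 'q \<Rightarrow> 'x"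

text \<open>A diffeomorphism \<open>h\<close> from an open part \<open>N\<close> of chart \<open>i\<close> of \<open>X\<close> onto an open part of chart
  \<open>j\<close> of \<open>Y\<close> that lifts the map \<open>\<Theta> : X \<rightarrow> Y\<close>. For \<open>\<Theta> = id\<close> these are the transition
  maps.\<close>

definition local_lift ::
  "('i, 'x, 'q::real_normed_vector) orbifold \<Rightarrow> ('j, 'y, 'p::real_normed_vector) orbifold \<Rightarrow> ('x \<Rightarrow> 'y) \<Rightarrow>
   'i \<Rightarrow> 'j \<Rightarrow> 'q set \<Rightarrow> ('q \<Rightarrow> 'p) \<Rightarrow> bool" where
  "local_lift X Y \<Theta> i j N h \<longleftrightarrow>
     i \<in> oidx X \<and> j \<in> oidx Y \<and> N \<subseteq> odom X i \<and> h ` N \<subseteq> odom Y j \<and>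
     diffeo_on N (h ` N) h \<and> (\<forall>y\<in>N. omap Y j (h y) = \<Theta> (omap X i y))"

definition lifts_everywhere ::
  "('i, 'x, 'q::real_normed_vector) orbifold \<Rightarrow> ('j, 'y, 'p::real_normed_vector) orbifold \<Rightarrow> ('x \<Rightarrow> 'y) \<Rightarrow> bool" where
  "lifts_everywhere X Y \<Theta> \<longleftrightarrow>
     (\<forall>i\<in>oidx X. \<forall>j\<in>oidx Y. \<forall>u\<in>odom X i. \<forall>w\<in>odom Y j.
        \<Theta> (omap X i u) = omap Y j w \<longrightarrow>
        (\<exists>N h. local_lift X Y \<Theta> i j N h \<and> u \<in> N \<and> h u = w))"

definition orbifold_structure :: "('i, 'x, 'q::real_normed_vector) orbifold \<Rightarrow> bool" where
  "orbifold_structure X \<longleftrightarrow>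
     Hausdorff_space (otop X) \<and> second_countable (otop X) \<and>
     (\<forall>i\<in>oidx X.
        open (odom X i) \<and> connected (odom X i) \<and>
        finite (ogrp X i) \<and> subgroup (ogrp X i) (BijGroup (odom X i)) \<and>
        (\<forall>\<gamma>\<in>ogrp X i. smooth_on (odom X i) \<gamma>) \<and>
        continuous_map (top_of_set (odom X i)) (otop X) (omap X i) \<and>
        open_map (top_of_set (odom X i)) (otop X) (omap X i) \<and>
        (\<forall>u\<in>odom X i. \<forall>u'\<in>odom X i.
           omap X i u = omap X i u' \<longleftrightarrow> (\<exists>\<gamma>\<in>ogrp X i. \<gamma> u = u'))) \<and>
     (\<Union>i\<in>oidx X. omap X i ` odom X i) = topspace (otop X) \<and>
     lifts_everywhere X X id"

definition orbifold_diffeo ::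
  "('i, 'x, 'q::real_normed_vector) orbifold \<Rightarrow> ('j, 'y, 'p::real_normed_vector) orbifold \<Rightarrow> ('x \<Rightarrow> 'y) \<Rightarrow> bool" where
  "orbifold_diffeo X Y \<Theta> \<longleftrightarrow> homeomorphic_map (otop X) (otop Y) \<Theta> \<and> lifts_everywhere X Y \<Theta>"

text \<open>A covariant tensor field on an orbifold is a family of tensor fields on the domains of its
  charts. The next two predicates express \<open>\<Theta>\<^sup>*\<beta> = \<alpha>\<close>; with \<open>\<Theta> = id\<close> they express
  compatibility with the transition maps, which includes invariance under the groups
  \<open>ogrp i\<close>.\<close>

definition matches1 ::
  "('i, 'x, 'q::real_normed_vector) orbifold \<Rightarrow> ('j, 'y, 'p::real_normed_vector) orbifold \<Rightarrow> ('x \<Rightarrow> 'y) \<Rightarrow>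
   ('i \<Rightarrow> 'q \<Rightarrow> 'q \<Rightarrow> real) \<Rightarrow> ('j \<Rightarrow> 'p \<Rightarrow> 'p \<Rightarrow> real) \<Rightarrow> bool" where
  "matches1 X Y \<Theta> \<alpha> \<beta> \<longleftrightarrow>
     (\<forall>i j N h. local_lift X Y \<Theta> i j N h \<longrightarrow>
        (\<forall>y\<in>N. \<forall>v. \<beta> j (h y) (frechet_derivative h (at y) v) = \<alpha> i y v))"

definition matches2 ::
  "('i, 'x, 'q::real_normed_vector) orbifold \<Rightarrow> ('j, 'y, 'p::real_normed_vector) orbifold \<Rightarrow> ('x \<Rightarrow> 'y) \<Rightarrow>
   ('i \<Rightarrow> 'q \<Rightarrow> 'q \<Rightarrow> 'q \<Rightarrow> real) \<Rightarrow> ('j \<Rightarrow> 'p \<Rightarrow> 'p \<Rightarrow> 'p \<Rightarrow> real) \<Rightarrow> bool" where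
  "matches2 X Y \<Theta> \<alpha> \<beta> \<longleftrightarrow>
     (\<forall>i j N h. local_lift X Y \<Theta> i j N h \<longrightarrow>
        (\<forall>y\<in>N. \<forall>v w.
           \<beta> j (h y) (frechet_derivative h (at y) v) (frechet_derivative h (at y) w) = \<alpha> i y v w))"

definition orbi_one_form ::
  "('i, 'x, 'q::real_normed_vector) orbifold \<Rightarrow> ('i \<Rightarrow> 'q \<Rightarrow> 'q \<Rightarrow> real) \<Rightarrow> bool" where
  "orbi_one_form X \<alpha> \<longleftrightarrow>
     (\<forall>i\<in>oidx X. (\<forall>u\<in>odom X i. linear (\<alpha> i u)) \<and> (\<forall>v. smooth_on (odom X i) (\<lambda>u. \<alpha> i u v))) \<and>
     matches1 X X id \<alpha> \<alpha>"

definition orbi_two_form ::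
  "('i, 'x, 'q::real_normed_vector) orbifold \<Rightarrow> ('i \<Rightarrow> 'q \<Rightarrow> 'q \<Rightarrow> 'q \<Rightarrow> real) \<Rightarrow> bool" where
  "orbi_two_form X \<omega> \<longleftrightarrow>
     (\<forall>i\<in>oidx X.
        (\<forall>u\<in>odom X i. bilinear (\<omega> i u) \<and> (\<forall>v w. \<omega> i u v w = - \<omega> i u w v)) \<and>
        (\<forall>v w. smooth_on (odom X i) (\<lambda>u. \<omega> i u v w))) \<and>
     matches2 X X id \<omega> \<omega>"

definition orbi_metric ::
  "('i, 'x, 'q::real_normed_vector) orbifold \<Rightarrow> ('i \<Rightarrow> 'q \<Rightarrow> 'q \<Rightarrow> 'q \<Rightarrow> real) \<Rightarrow> bool" where
  "orbi_metric X g \<longleftrightarrow>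
     (\<forall>i\<in>oidx X.
        (\<forall>u\<in>odom X i. bilinear (g i u) \<and> (\<forall>v w. g i u v w = g i u w v) \<and>
           (\<forall>v. v \<noteq> 0 \<longrightarrow> g i u v v > 0)) \<and>
        (\<forall>v w. smooth_on (odom X i) (\<lambda>u. g i u v w))) \<and>
     matches2 X X id g g"

definition cone_orbifold ::
  "('i, 'x, 'q) orbifold \<Rightarrow> ('i, 'x \<times> real, 'q \<times> real) orbifold" where
  "cone_orbifold X =
     \<lparr>otop = prod_topology (otop X) (top_of_set {0<..}),
      oidx = oidx X,
      odom = (\<lambda>i. odom X i \<times> {0<..}),
      ogrp = (\<lambda>i. (\<lambda>\<gamma>. restrict (map_prod \<gamma> id) (odom X i \<times> {0<..})) ` ogrp X i),
      omap = (\<lambda>i. map_prod (omap X i) id)\<rparr>"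

text \<open>The orbifold structure on the space \<open>T\<close> for which the bijection \<open>\<Theta> : T \<rightarrow> X\<close> becomes a
  diffeomorphism.\<close>

definition transport_orbifold ::
  "'y topology \<Rightarrow> ('y \<Rightarrow> 'x) \<Rightarrow> ('i, 'x, 'q) orbifold \<Rightarrow> ('i, 'y, 'q) orbifold" where
  "transport_orbifold T \<Theta> X =
     \<lparr>otop = T, oidx = oidx X, odom = odom X, ogrp = ogrp X,
      omap = (\<lambda>i u. inv_into (topspace T) \<Theta> (omap X i u))\<rparr>"


section \<open>Reduced spaces\<close>

definition orbit_space :: "'a topology \<Rightarrow> 'g monoid \<Rightarrow> ('g \<Rightarrow> 'a \<Rightarrow> 'a) \<Rightarrow> 'a set topology" where
  "orbit_space T K act =
     topology (\<lambda>U. U \<subseteq> orbits K (topspace T) act \<and> openin T {x \<in> topspace T. orbit K act x \<in> U})"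

text \<open>A local lift \<open>f\<close>, near \<open>z \<in> Z\<close>, of the projection \<open>\<pi> : Z \<rightarrow> Z/K\<close> to chart \<open>i\<close> of
  \<open>X = Z/K\<close>. A map on \<open>Z\<close> is smooth if it extends locally to a smooth map on the ambient
  manifold.\<close>

definition local_projection ::
  "('a, 'e::real_normed_vector) manifold \<Rightarrow> 'a set \<Rightarrow> 'g monoid \<Rightarrow> ('g \<Rightarrow> 'a \<Rightarrow> 'a) \<Rightarrow>
   ('i, 'a set, 'q::real_normed_vector) orbifold \<Rightarrow> 'i \<Rightarrow> 'a \<Rightarrow> 'a set \<Rightarrow> ('a \<Rightarrow> 'q) \<Rightarrow> bool" where
  "local_projection M Z K act X i z W f \<longleftrightarrow>
     i \<in> oidx X \<and> z \<in> W \<inter> Z \<and> smooth_map_on M W vec_manifold f \<and>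
     (\<forall>x\<in>W \<inter> Z. f x \<in> odom X i \<and> omap X i (f x) = orbit K act x)"

definition quotient_orbifold ::
  "('a, 'e::real_normed_vector) manifold \<Rightarrow> 'a set \<Rightarrow> 'g monoid \<Rightarrow> ('g \<Rightarrow> 'a \<Rightarrow> 'a) \<Rightarrow>
   ('i, 'a set, 'q::real_normed_vector) orbifold \<Rightarrow> bool" where
  "quotient_orbifold M Z K act X \<longleftrightarrow>
     orbifold_structure X \<and>
     otop X = orbit_space (subtopology (mtop M) Z) K act \<and>
     (\<forall>z\<in>Z. \<forall>i\<in>oidx X. \<forall>u\<in>odom X i. omap X i u = orbit K act z \<longrightarrow>
        (\<exists>W f. local_projection M Z K act X i z W f \<and> f z = u \<and>
               mfderiv M vec_manifold f z ` tangent_set M Z z = UNIV))"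

text \<open>\<open>\<pi>\<^sup>*\<beta> = \<iota>\<^sup>*\<alpha>\<close> on \<open>Z\<close>, for one-forms and two-forms.\<close>

definition projects1 ::
  "('a, 'e::real_normed_vector) manifold \<Rightarrow> 'a set \<Rightarrow> 'g monoid \<Rightarrow> ('g \<Rightarrow> 'a \<Rightarrow> 'a) \<Rightarrow>
   ('i, 'a set, 'q::real_normed_vector) orbifold \<Rightarrow> ('a \<Rightarrow> 'e \<Rightarrow> real) \<Rightarrow> ('i \<Rightarrow> 'q \<Rightarrow> 'q \<Rightarrow> real) \<Rightarrow> bool" where
  "projects1 M Z K act X \<alpha> \<beta> \<longleftrightarrow>
     (\<forall>i z W f. local_projection M Z K act X i z W f \<longrightarrow>
        (\<forall>v\<in>tangent_set M Z z. \<beta> i (f z) (mfderiv M vec_manifold f z v) = \<alpha> z v))"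

definition projects2 ::
  "('a, 'e::real_normed_vector) manifold \<Rightarrow> 'a set \<Rightarrow> 'g monoid \<Rightarrow> ('g \<Rightarrow> 'a \<Rightarrow> 'a) \<Rightarrow>
   ('i, 'a set, 'q::real_normed_vector) orbifold \<Rightarrow> ('a \<Rightarrow> 'e \<Rightarrow> 'e \<Rightarrow> real) \<Rightarrow>
   ('i \<Rightarrow> 'q \<Rightarrow> 'q \<Rightarrow> 'q \<Rightarrow> real) \<Rightarrow> bool" where
  "projects2 M Z K act X \<alpha> \<beta> \<longleftrightarrow>
     (\<forall>i z W f. local_projection M Z K act X i z W f \<longrightarrow>
        (\<forall>v\<in>tangent_set M Z z. \<forall>w\<in>tangent_set M Z z.
           \<beta> i (f z) (mfderiv M vec_manifold f z v) (mfderiv M vec_manifold f z w) = \<alpha> z v w))"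

text \<open>A metric is projected by requiring \<open>\<pi>\<close> to be a Riemannian submersion: \<open>d\<pi>\<close> is isometric on
  the \<open>g\<close>-orthogonal complement of its kernel in the tangent space of \<open>Z\<close>.\<close>

definition horizontal ::
  "('a, 'e::real_normed_vector) manifold \<Rightarrow> 'a set \<Rightarrow> ('a \<Rightarrow> 'e \<Rightarrow> 'e \<Rightarrow> real) \<Rightarrow>
   ('a \<Rightarrow> 'q::real_normed_vector) \<Rightarrow> 'a \<Rightarrow> 'e set" where
  "horizontal M Z g f z =
     {v \<in> tangent_set M Z z. \<forall>k\<in>tangent_set M Z z. mfderiv M vec_manifold f z k = 0 \<longrightarrow> g z v k = 0}"

definition projects_metric ::
  "('a, 'e::real_normed_vector) manifold \<Rightarrow> 'a set \<Rightarrow> 'g monoid \<Rightarrow> ('g \<Rightarrow> 'a \<Rightarrow> 'a) \<Rightarrow>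
   ('i, 'a set, 'q::real_normed_vector) orbifold \<Rightarrow> ('a \<Rightarrow> 'e \<Rightarrow> 'e \<Rightarrow> real) \<Rightarrow>
   ('i \<Rightarrow> 'q \<Rightarrow> 'q \<Rightarrow> 'q \<Rightarrow> real) \<Rightarrow> bool" where
  "projects_metric M Z K act X g gX \<longleftrightarrow>
     (\<forall>i z W f. local_projection M Z K act X i z W f \<longrightarrow>
        (\<forall>v\<in>horizontal M Z g f z. \<forall>w\<in>horizontal M Z g f z.
           gX i (f z) (mfderiv M vec_manifold f z v) (mfderiv M vec_manifold f z w) = g z v w))"

definition contact_reduction ::
  "('a, 'e::real_normed_vector) manifold \<Rightarrow> ('a \<Rightarrow> 'e \<Rightarrow> real) \<Rightarrow> ('a \<Rightarrow> 'e \<Rightarrow> 'e \<Rightarrow> real) \<Rightarrow>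
   'g monoid \<Rightarrow> ('g \<Rightarrow> 'a \<Rightarrow> 'a) \<Rightarrow> ('a \<Rightarrow> 'd::real_vector) \<Rightarrow> 'd \<Rightarrow>
   ('i, 'a set, 'q::real_normed_vector) orbifold \<Rightarrow> ('i \<Rightarrow> 'q \<Rightarrow> 'q \<Rightarrow> real) \<Rightarrow>
   ('i \<Rightarrow> 'q \<Rightarrow> 'q \<Rightarrow> 'q \<Rightarrow> real) \<Rightarrow> bool" where
  "contact_reduction M \<eta> g K act \<Phi> \<mu> X \<eta>X gX \<longleftrightarrow>
     quotient_orbifold M (ray_level M \<Phi> \<mu>) K act X \<and>
     orbi_one_form X \<eta>X \<and> projects1 M (ray_level M \<Phi> \<mu>) K act X \<eta> \<eta>X \<and>
     orbi_metric X gX \<and> projects_metric M (ray_level M \<Phi> \<mu>) K act X g gX"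

definition ray_reduction ::
  "('a, 'e::real_normed_vector) manifold \<Rightarrow> ('a \<Rightarrow> 'e \<Rightarrow> 'e \<Rightarrow> real) \<Rightarrow> ('a \<Rightarrow> 'e \<Rightarrow> 'e \<Rightarrow> real) \<Rightarrow>
   'g monoid \<Rightarrow> ('g \<Rightarrow> 'a \<Rightarrow> 'a) \<Rightarrow> ('a \<Rightarrow> 'd::real_vector) \<Rightarrow> 'd \<Rightarrow>
   ('i, 'a set, 'q::real_normed_vector) orbifold \<Rightarrow> ('i \<Rightarrow> 'q \<Rightarrow> 'q \<Rightarrow> 'q \<Rightarrow> real) \<Rightarrow>
   ('i \<Rightarrow> 'q \<Rightarrow> 'q \<Rightarrow> 'q \<Rightarrow> real) \<Rightarrow> bool" where
  "ray_reduction M \<omega> g K act \<Phi> \<mu> X \<omega>X gX \<longleftrightarrow>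
     quotient_orbifold M (ray_level M \<Phi> \<mu>) K act X \<and>
     orbi_two_form X \<omega>X \<and> projects2 M (ray_level M \<Phi> \<mu>) K act X \<omega> \<omega>X \<and>
     orbi_metric X gX \<and> projects_metric M (ray_level M \<Phi> \<mu>) K act X g gX"

end

theory Submission
  imports Defs
begin

text \<open>On the cone the level set is \<open>Z \<times> (0, \<infinity>)\<close> with \<open>Z\<close> the level set in \<open>S\<close>, and the orbits are
  those of \<open>Z\<close> times a point. So \<open>[x, r] \<mapsto> ([x], r)\<close> is a bijection, and it is a homeomorphism because
  \<open>(0, \<infinity>)\<close> is locally compact. By transversality and the inverse function theorem \<open>Z\<close> is a
  submanifold. A local lift \<open>f\<close> of the projection of the cone has the form \<open>f (x, r) = (f\<^sub>r x, r)\<close>, where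
  \<open>f\<^sub>r\<close> is a lift of the projection of \<open>Z\<close> that is locally independent of \<open>r\<close>, as the chart groups are
  finite. So the metric and the form \<open>d(r\<^sup>2\<eta>)\<close> project to the corresponding tensors on the cone of the
  quotient; for the form one uses that \<open>d\<close> commutes with pullback to \<open>Z\<close>. Finally, any two
  orbifold structures on the quotient for which the projection is a submersion are diffeomorphic, by
  composing a local section of one projection with the other, and projected tensors correspond.\<close>


section \<open>Calculus of smooth maps\<close>

text \<open>The dimension of \<open>Z\<close> is not that of a given model type, so slice
  coordinates are replaced by maps into \<open>Z\<close> from an open set of the full model space of
  \<open>S\<close> whose derivative at 0 fixes the tangent vectors of \<open>Z\<close>. Such maps
  need not be injective, but they show that the velocities of curves in \<open>Z\<close> form a
  linear space, and they allow forms to be pulled back and local sections to be built. Finiteness of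
  the chart groups enters a second time: two transition maps in opposite directions compose to a map
  that agrees at each point with some group element, which may vary without any known regularity;
  finiteness still forces the derivatives to be injective. Transition maps thus arise from the
  projections alone, so compatibility of the charts of the cone is obtained by comparing the cone
  structure with itself. The same argument yields that charts of different reductions have equal
  dimension. Smoothness of the momentum map is derived, from the smooth action and the smooth
  contact form.\<close>

text \<open>\<open>frechet_derivative\<close> is a choice among the derivatives at a point. Both
  functions have the same ones, so the choices agree even where neither is differentiable.\<close>

lemma frechet_derivative_cong_open:
  assumes "open U" "x \<in> U" "\<And>y. y \<in> U \<Longrightarrow> f y = g y"
  shows "frechet_derivative f (at x) = frechet_derivative g (at x)"
proof -
  have "(f has_derivative f') (at x) \<longleftrightarrow> (g has_derivative f') (at x)" for f'
    using has_derivative_transform_within_open[of f f' x UNIV U g]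
      has_derivative_transform_within_open[of g f' x UNIV U f] assms by auto
  then show ?thesis unfolding frechet_derivative_def by simp
qed

section \<open>Closure properties of C^k maps\<close>

lemma Ck_on_cong_imp:
  assumes "open U" "\<And>y. y \<in> U \<Longrightarrow> f y = g y" "Ck_on k U f"
  shows "Ck_on k U g"
  using assms(2,3)
proof (induction k arbitrary: f g)
  case 0
  then show ?case by (simp cong: continuous_on_cong)
next
  case (Suc k)
  have "g differentiable_on U"
    using Suc.prems by (metis Ck_on.simps(2) differentiable_on_def differentiable_transform_within zero_less_one)
  moreover have "Ck_on k U (\<lambda>x. frechet_derivative g (at x) v)" for v
    by (rule Suc.IH[of "\<lambda>x. frechet_derivative f (at x) v"])
      (use Suc.prems frechet_derivative_cong_open[OF assms(1), of _ f g] in auto)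
  ultimately show ?case by simp
qed

lemma Ck_on_cong:
  assumes "open U" "\<And>y. y \<in> U \<Longrightarrow> f y = g y"
  shows "Ck_on k U f \<longleftrightarrow> Ck_on k U g"
  using Ck_on_cong_imp[OF assms(1)] assms(2) by metis

lemma Ck_on_subset: "Ck_on k U f \<Longrightarrow> V \<subseteq> U \<Longrightarrow> Ck_on k V f"
  by (induction k arbitrary: f) (auto intro: continuous_on_subset differentiable_on_subset)

lemma Ck_on_Suc_imp: "Ck_on (Suc k) U f \<Longrightarrow> Ck_on k U f"
  by (induction k arbitrary: f) (auto simp: differentiable_imp_continuous_on)

text \<open>Trades the chosen derivative for an explicit one, the form in which the rules of
  calculus deliver it.\<close>

lemma Ck_on_SucI:
  assumes "open U" "\<And>x. x \<in> U \<Longrightarrow> (f has_derivative f' x) (at x)" "\<And>v. Ck_on k U (\<lambda>x. f' x v)"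
  shows "Ck_on (Suc k) U f"
proof -
  have "f differentiable_on U"
    using assms(2) differentiable_at_withinI differentiableI unfolding differentiable_on_def by blast
  moreover have "Ck_on k U (\<lambda>x. frechet_derivative f (at x) v)" for v
    using assms(3)[of v] by (rule Ck_on_cong_imp[OF assms(1), rotated])
       (use assms(2) frechet_derivative_at in metis)
  ultimately show ?thesis by simp
qed

lemma Ck_on_SucD:
  assumes "open U" "Ck_on (Suc k) U f"
  shows "x \<in> U \<Longrightarrow> (f has_derivative frechet_derivative f (at x)) (at x)"
    and "Ck_on k U (\<lambda>x. frechet_derivative f (at x) v)"
  using assms by (auto simp: differentiable_on_eq_differentiable_at frechet_derivative_works)

lemma Ck_on_const: "Ck_on k U (\<lambda>x. c)"
  by (induction k arbitrary: c) (auto simp: frechet_derivative_const)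

lemma Ck_on_bounded_linear:
  assumes "open U" "bounded_linear A" "Ck_on k U f"
  shows "Ck_on k U (\<lambda>x. A (f x))"
  using assms(3)
proof (induction k arbitrary: f)
  case 0
  then show ?case
    using continuous_on_compose2[OF linear_continuous_on[OF assms(2), of UNIV], of U f] by simp
next
  case (Suc k)
  show ?case
    by (rule Ck_on_SucI[OF assms(1) bounded_linear.has_derivative[OF assms(2)]])
      (use Suc Ck_on_SucD[OF assms(1)] in blast)+
qed

lemma Ck_on_add:
  assumes "open U" "Ck_on k U f" "Ck_on k U g"
  shows "Ck_on k U (\<lambda>x. f x + g x)"
  using assms(2,3)
proof (induction k arbitrary: f g)
  case 0
  then show ?case by (simp add: continuous_on_add)
next
  case (Suc k)
  show ?case
    by (rule Ck_on_SucI[OF assms(1) has_derivative_add])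
      (use Suc Ck_on_SucD[OF assms(1)] in blast)+
qed

lemma Ck_on_sum:
  assumes "open U" "\<And>i. i \<in> I \<Longrightarrow> Ck_on k U (f i)"
  shows "Ck_on k U (\<lambda>x. \<Sum>i\<in>I. f i x)"
  using assms(2)
  by (induction I rule: infinite_finite_induct) (auto intro: Ck_on_const Ck_on_add assms(1))

lemma Ck_on_bounded_bilinear:
  assumes "open U" "bounded_bilinear m" "Ck_on k U f" "Ck_on k U g"
  shows "Ck_on k U (\<lambda>x. m (f x) (g x))"
  using assms(3,4)
proof (induction k arbitrary: f g)
  case 0
  then show ?case using bounded_bilinear.continuous_on[OF assms(2)] by auto
next
  case (Suc k)
  note D = Ck_on_SucD[OF assms(1)]
  show ?case
  proof (rule Ck_on_SucI[OF assms(1)])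
    show "((\<lambda>x. m (f x) (g x)) has_derivative
        (\<lambda>v. m (f x) (frechet_derivative g (at x) v) + m (frechet_derivative f (at x) v) (g x))) (at x)"
      if "x \<in> U" for x
      using bounded_bilinear.FDERIV[OF assms(2) D(1)[OF Suc.prems(1) that] D(1)[OF Suc.prems(2) that]] .
  qed (intro Ck_on_add Suc.IH assms(1) D Suc.prems Ck_on_Suc_imp[OF Suc.prems(1)] Ck_on_Suc_imp[OF Suc.prems(2)])
qed

lemma Ck_on_Pair:
  assumes "open U" "Ck_on k U f" "Ck_on k U g"
  shows "Ck_on k U (\<lambda>x. (f x, g x))"
  using assms(2,3)
proof (induction k arbitrary: f g)
  case 0
  then show ?case by (simp add: continuous_on_Pair)
next
  case (Suc k)
  note D = Ck_on_SucD[OF assms(1)]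
  show ?case
  proof (rule Ck_on_SucI[OF assms(1)])
    show "((\<lambda>x. (f x, g x)) has_derivative
        (\<lambda>v. (frechet_derivative f (at x) v, frechet_derivative g (at x) v))) (at x)"
      if "x \<in> U" for x
      using has_derivative_Pair[OF D(1)[OF Suc.prems(1) that] D(1)[OF Suc.prems(2) that]] .
  qed (intro Suc.IH D Suc.prems)
qed

lemma Ck_on_compose_affine:
  assumes "open U" "bounded_linear A" "open V" "Ck_on k U f" "\<And>x. x \<in> V \<Longrightarrow> c + A x \<in> U"
  shows "Ck_on k V (\<lambda>x. f (c + A x))"
  using assms(4)
proof (induction k arbitrary: f)
  case 0
  have "continuous_on V (\<lambda>x. c + A x)"
    by (intro continuous_intros linear_continuous_on[OF assms(2)])
  then show ?case using continuous_on_compose2[of U f V] 0 assms(5) by auto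
next
  case (Suc k)
  show ?case
  proof (rule Ck_on_SucI[OF assms(3)])
    fix x assume x: "x \<in> V"
    have "((\<lambda>x. c + A x) has_derivative A) (at x)"
      using bounded_linear_imp_has_derivative[OF assms(2)] by (auto intro!: derivative_eq_intros)
    from has_derivative_compose[OF this Ck_on_SucD(1)[OF assms(1) Suc.prems assms(5)[OF x]]]
    show "((\<lambda>x. f (c + A x)) has_derivative (\<lambda>v. frechet_derivative f (at (c + A x)) (A v))) (at x)" .
  qed (use Suc Ck_on_SucD[OF assms(1)] in blast)
qed

lemma linear_euclidean_sum:
  fixes v :: "'a::euclidean_space"
  assumes "linear f"
  shows "f v = (\<Sum>b\<in>Basis. (v \<bullet> b) *\<^sub>R f b)"
  by (subst euclidean_representation[symmetric, of v])
    (simp add: linear_sum[OF assms] linear_cmul[OF assms])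

text \<open>\<open>Ck_on\<close> controls derivatives in fixed directions, while the chain rule
  produces the direction \<open>frechet_derivative g (at x) v\<close>, which moves with
  \<open>x\<close>. Expanding it in the basis of the middle space leaves finitely many products, to
  which the induction hypothesis and the product rule apply.\<close>

lemma Ck_on_compose:
  fixes g :: "'a::real_normed_vector \<Rightarrow> 'b::euclidean_space"
  assumes "open U" "open V" "Ck_on k U f" "Ck_on k V g" "\<And>x. x \<in> V \<Longrightarrow> g x \<in> U"
  shows "Ck_on k V (\<lambda>x. f (g x))"
  using assms(3,4)
proof (induction k arbitrary: f)
  case 0
  then show ?case using continuous_on_compose2[of U f V] assms(5) by auto
next
  case (Suc k)
  show ?case
  proof (rule Ck_on_SucI[OF assms(2)])
    fix x assume x: "x \<in> V"
    note fd = Ck_on_SucD(1)[OF assms(1) Suc.prems(1) assms(5)[OF x]]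
    have "((\<lambda>x. f (g x)) has_derivative (\<lambda>v. frechet_derivative f (at (g x)) (frechet_derivative g (at x) v))) (at x)"
      using has_derivative_compose[OF Ck_on_SucD(1)[OF assms(2) Suc.prems(2) x] fd] .
    then show "((\<lambda>x. f (g x)) has_derivative (\<lambda>v. \<Sum>b\<in>Basis. (frechet_derivative g (at x) v \<bullet> b) *\<^sub>R
         frechet_derivative f (at (g x)) b)) (at x)"
      by (subst (asm) linear_euclidean_sum[OF has_derivative_linear[OF fd]])
  next
    show "Ck_on k V (\<lambda>x. \<Sum>b\<in>Basis. (frechet_derivative g (at x) v \<bullet> b) *\<^sub>R
         frechet_derivative f (at (g x)) b)" for v
      by (intro Ck_on_sum Ck_on_bounded_bilinear[OF _ bounded_bilinear_scaleR]
          Ck_on_bounded_linear[OF _ bounded_linear_inner_left] assms(1,2)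
          Suc.IH Ck_on_SucD(2)[OF assms(1) Suc.prems(1)] Ck_on_SucD(2)[OF assms(2) Suc.prems(2)] Ck_on_Suc_imp[OF Suc.prems(2)])
  qed
qed

lemma Ck_on_local:
  assumes "\<And>x. x \<in> U \<Longrightarrow> \<exists>V. open V \<and> x \<in> V \<and> Ck_on k V f"
  shows "Ck_on k U f"
  using assms
proof (induction k arbitrary: f)
  case 0
  have "isCont f x" if "x \<in> U" for x
    using 0[OF that] by (auto simp: continuous_on_eq_continuous_at)
  then show ?case by (simp add: continuous_at_imp_continuous_on)
next
  case (Suc k)
  have "f differentiable (at x)" if "x \<in> U" for x
    using Suc.prems[OF that] by (auto simp: differentiable_on_eq_differentiable_at)
  then have "f differentiable_on U"
    by (simp add: differentiable_at_imp_differentiable_on)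
  moreover have "Ck_on k U (\<lambda>x. frechet_derivative f (at x) v)" for v
    by (rule Suc.IH) (use Suc.prems in auto)
  ultimately show ?case by simp
qed

section \<open>Closure properties of smooth maps\<close>

lemma smooth_on_cong:
  "open U \<Longrightarrow> (\<And>y. y \<in> U \<Longrightarrow> f y = g y) \<Longrightarrow> smooth_on U f \<longleftrightarrow> smooth_on U g"
  unfolding smooth_on_def using Ck_on_cong by metis

lemma smooth_on_subset: "smooth_on U f \<Longrightarrow> V \<subseteq> U \<Longrightarrow> smooth_on V f"
  unfolding smooth_on_def using Ck_on_subset by blast

lemma smooth_on_imp_continuous_on: "smooth_on U f \<Longrightarrow> continuous_on U f"
  unfolding smooth_on_def by (metis Ck_on.simps(1))

lemma smooth_on_has_derivative:
  "smooth_on U f \<Longrightarrow> open U \<Longrightarrow> x \<in> U \<Longrightarrow> (f has_derivative frechet_derivative f (at x)) (at x)"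
  unfolding smooth_on_def using Ck_on_SucD(1) by blast

lemma smooth_on_frechet_derivative:
  "smooth_on U f \<Longrightarrow> open U \<Longrightarrow> smooth_on U (\<lambda>x. frechet_derivative f (at x) v)"
  unfolding smooth_on_def using Ck_on_SucD(2) by blast

lemma smooth_on_const: "smooth_on U (\<lambda>x. c)"
  by (simp add: smooth_on_def Ck_on_const)

lemma smooth_on_add:
  "open U \<Longrightarrow> smooth_on U f \<Longrightarrow> smooth_on U g \<Longrightarrow> smooth_on U (\<lambda>x. f x + g x)"
  by (simp add: smooth_on_def Ck_on_add)

lemma smooth_on_sum:
  "open U \<Longrightarrow> (\<And>i. i \<in> I \<Longrightarrow> smooth_on U (f i)) \<Longrightarrow> smooth_on U (\<lambda>x. \<Sum>i\<in>I. f i x)"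
  by (simp add: smooth_on_def Ck_on_sum)

lemma smooth_on_bounded_linear:
  "open U \<Longrightarrow> bounded_linear A \<Longrightarrow> smooth_on U f \<Longrightarrow> smooth_on U (\<lambda>x. A (f x))"
  by (simp add: smooth_on_def Ck_on_bounded_linear)


lemma smooth_on_bounded_bilinear:
  "open U \<Longrightarrow> bounded_bilinear m \<Longrightarrow> smooth_on U f \<Longrightarrow> smooth_on U g \<Longrightarrow> smooth_on U (\<lambda>x. m (f x) (g x))"
  by (simp add: smooth_on_def Ck_on_bounded_bilinear)

lemmas smooth_on_scaleR = smooth_on_bounded_bilinear[OF _ bounded_bilinear_scaleR]

lemma smooth_on_Pair:
  "open U \<Longrightarrow> smooth_on U f \<Longrightarrow> smooth_on U g \<Longrightarrow> smooth_on U (\<lambda>x. (f x, g x))"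
  by (simp add: smooth_on_def Ck_on_Pair)

lemma smooth_on_compose_affine:
  "open U \<Longrightarrow> bounded_linear A \<Longrightarrow> open V \<Longrightarrow> smooth_on U f \<Longrightarrow> (\<And>x. x \<in> V \<Longrightarrow> c + A x \<in> U)
   \<Longrightarrow> smooth_on V (\<lambda>x. f (c + A x))"
  unfolding smooth_on_def using Ck_on_compose_affine by blast

lemma smooth_on_compose:
  fixes g :: "'a::real_normed_vector \<Rightarrow> 'b::euclidean_space"
  shows "open U \<Longrightarrow> open V \<Longrightarrow> smooth_on U f \<Longrightarrow> smooth_on V g \<Longrightarrow> (\<And>x. x \<in> V \<Longrightarrow> g x \<in> U)
   \<Longrightarrow> smooth_on V (\<lambda>x. f (g x))"
  unfolding smooth_on_def using Ck_on_compose by blast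

lemma smooth_on_local:
  assumes "\<And>x. x \<in> U \<Longrightarrow> \<exists>V. open V \<and> x \<in> V \<and> smooth_on V f"
  shows "smooth_on U f"
  unfolding smooth_on_def
  by (intro allI Ck_on_local) (use assms smooth_on_def in metis)

lemma smooth_on_ident: "open U \<Longrightarrow> smooth_on U (\<lambda>x. x)"
  unfolding smooth_on_def
proof
  assume "open U"
  then show "Ck_on k U (\<lambda>x. x)" for k
    by (cases k) (auto intro: Ck_on_SucI Ck_on_const)
qed

section \<open>Families of inverse linear maps\<close>

text \<open>The term of the product rule that differentiates \<open>c\<close> carries the factor
  \<open>k x = 0\<close>, so continuity of \<open>c\<close> is enough.\<close>

lemma has_derivative_scaleR_zero:
  fixes c :: "'a::real_normed_vector \<Rightarrow> real"
  assumes "isCont c x" "(k has_derivative k') (at x)" "k x = 0"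
  shows "((\<lambda>y. c y *\<^sub>R k y) has_derivative (\<lambda>v. c x *\<^sub>R k' v)) (at x)"
proof -
  obtain B where B: "\<And>v. norm (k' v) \<le> norm v * B" "B > 0"
    using bounded_linear.pos_bounded[OF has_derivative_bounded_linear[OF assms(2)]] by metis
  have e: "c y *\<^sub>R k y - c x *\<^sub>R k x - c x *\<^sub>R k' (y - x)
      = c y *\<^sub>R (k y - k x - k' (y - x)) + (c y - c x) *\<^sub>R k' (y - x)" for y
    using assms(3) by (simp add: algebra_simps)
  have l1: "((\<lambda>y. norm (c y) * (norm (k y - k x - k' (y - x)) / norm (y - x))) \<longlongrightarrow> norm (c x) * 0) (at x)"
    using assms(1,2) unfolding has_derivative_iff_norm isCont_def by (intro tendsto_mult tendsto_norm) auto
  have l2: "((\<lambda>y. norm (c y - c x) * B) \<longlongrightarrow> 0 * B) (at x)"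
    using assms(1) unfolding isCont_def by (intro tendsto_mult tendsto_norm_zero) (auto intro: LIM_zero)
  have l3: "((\<lambda>y. norm (c y) * (norm (k y - k x - k' (y - x)) / norm (y - x)) + norm (c y - c x) * B) \<longlongrightarrow> 0) (at x)"
    using tendsto_add[OF l1 l2] by simp
  have "((\<lambda>y. norm (c y *\<^sub>R k y - c x *\<^sub>R k x - c x *\<^sub>R k' (y - x)) / norm (y - x)) \<longlongrightarrow> 0) (at x)"
  proof (rule Lim_null_comparison[OF _ l3], rule eventuallyI)
    fix y
    show "norm (norm (c y *\<^sub>R k y - c x *\<^sub>R k x - c x *\<^sub>R k' (y - x)) / norm (y - x))
      \<le> norm (c y) * (norm (k y - k x - k' (y - x)) / norm (y - x)) + norm (c y - c x) * B"
    proof (cases "y = x")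
      case False
      have "norm (c y *\<^sub>R k y - c x *\<^sub>R k x - c x *\<^sub>R k' (y - x))
        \<le> norm (c y) * norm (k y - k x - k' (y - x)) + norm (c y - c x) * norm (k' (y - x))"
        unfolding e by (rule order_trans[OF norm_triangle_ineq]) simp
      also have "\<dots> \<le> norm (c y) * norm (k y - k x - k' (y - x)) + norm (c y - c x) * (norm (y - x) * B)"
        by (intro add_left_mono mult_left_mono B) auto
      finally show ?thesis using False by (simp add: field_simps)
    qed (use B in simp)
  qed
  then show ?thesis
    unfolding has_derivative_iff_norm
    using bounded_linear_compose[OF bounded_linear_scaleR_right has_derivative_bounded_linear[OF assms(2)]] by blast
qed

text \<open>The second part turns continuity of the inverse into differentiability, since the factors
  \<open>A y b - A x b\<close> vanish at \<open>y = x\<close>.\<close>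

lemma continuous_inverse_family:
  fixes A :: "'a::real_normed_vector \<Rightarrow> 'b::euclidean_space \<Rightarrow> 'b"
  assumes "\<And>b. isCont (\<lambda>y. A y b) x" "\<And>y. linear (A y)" "\<And>y. bij (A y)"
  shows "isCont (\<lambda>y. inv_into UNIV (A y) w) x"
    and "inv_into UNIV (A y) w = inv_into UNIV (A x) w - (\<Sum>b\<in>Basis. (inv_into UNIV (A y) w \<bullet> b) *\<^sub>R inv_into UNIV (A x) (A y b - A x b))"
proof -
  define u where "u = (\<lambda>y. inv_into UNIV (A y) w)"
  define B where "B = inv_into UNIV (A x)"
  have lB: "linear B"
    unfolding B_def using assms(2,3) bij_is_inj by (intro inj_linear_imp_inv_linear) auto
  have Au: "A y (u y) = w" for y
    unfolding u_def using assms(3) by (simp add: bij_is_surj surj_f_inv_f)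
  have BA: "B (A x v) = v" for v
    unfolding B_def using assms(3) by (simp add: bij_is_inj)
  have "u y - B w = u y - B (A y (u y))" for y by (simp add: Au)
  have id: "u y = B w - (\<Sum>b\<in>Basis. (u y \<bullet> b) *\<^sub>R B (A y b - A x b))" for y
  proof -
    have "(\<Sum>b\<in>Basis. (u y \<bullet> b) *\<^sub>R B (A y b - A x b))
      = (\<Sum>b\<in>Basis. (u y \<bullet> b) *\<^sub>R B (A y b)) - (\<Sum>b\<in>Basis. (u y \<bullet> b) *\<^sub>R B (A x b))"
      by (simp add: linear_diff[OF lB] sum_subtractf scaleR_diff_right)
    also have "\<dots> = B (A y (u y)) - B (A x (u y))"
      using linear_euclidean_sum[OF linear_compose[OF assms(2)[of y] lB], of "u y"]
        linear_euclidean_sum[OF linear_compose[OF assms(2)[of x] lB], of "u y"] by simp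
    finally show ?thesis by (simp add: Au BA)
  qed
  then show "inv_into UNIV (A y) w = inv_into UNIV (A x) w - (\<Sum>b\<in>Basis. (inv_into UNIV (A y) w \<bullet> b) *\<^sub>R inv_into UNIV (A x) (A y b - A x b))"
    unfolding u_def B_def .
  define d where "d = (\<lambda>y. \<Sum>b\<in>(Basis::'b set). norm (B (A y b - A x b)))"
  have ux: "u x = B w" by (simp add: u_def B_def)
  have du: "norm (u y - u x) \<le> norm (u y) * d y" for y
  proof -
    have "norm (u y - u x) = norm (\<Sum>b\<in>Basis. (u y \<bullet> b) *\<^sub>R B (A y b - A x b))"
      using id[of y] ux by (metis add_diff_cancel_left' diff_add_cancel minus_diff_eq norm_minus_commute)
    also have "\<dots> \<le> (\<Sum>b\<in>Basis. norm (u y) * norm (B (A y b - A x b)))"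
      by (rule order_trans[OF norm_sum]) (auto intro!: sum_mono mult_right_mono Basis_le_norm)
    finally show ?thesis by (simp add: d_def sum_distrib_left)
  qed
  have d0: "(d \<longlongrightarrow> 0) (at x)"
  proof -
    have "((\<lambda>y. A y b - A x b) \<longlongrightarrow> 0) (at x)" for b
      using assms(1)[of b] unfolding isCont_def by (rule LIM_zero)
    then have "((\<lambda>y. norm (B (A y b - A x b))) \<longlongrightarrow> norm (B 0)) (at x)" for b
      by (intro tendsto_norm bounded_linear.tendsto[OF linear_conv_bounded_linear[THEN iffD1, OF lB]])
    then have "((\<lambda>y. norm (B (A y b - A x b))) \<longlongrightarrow> 0) (at x)" for b
      by (simp add: linear_0[OF lB])
    then show ?thesis unfolding d_def by (auto intro!: tendsto_null_sum)
  qed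
  have "\<forall>\<^sub>F y in at x. norm (u y - u x) \<le> 2 * norm (u x) * d y"
    using order_tendstoD(2)[OF d0, of "1/2"]
  proof (rule eventually_mono)
    \<comment> \<open>An a priori bound: once \<open>d y\<close> is below 1/2, the estimate
      \<open>du\<close> absorbs half of \<open>norm (u y)\<close>. So \<open>u\<close> stays bounded
      near \<open>x\<close>, and \<open>du\<close> then bounds the difference by a multiple of
      \<open>d y\<close>.\<close>
    fix y assume y: "d y < 1/2"
    have "d y \<ge> 0" unfolding d_def by (simp add: sum_nonneg)
    have "norm (u y) \<le> norm (u x) + norm (u y) * d y"
      using du[of y] norm_triangle_sub[of "u y" "u x"] by linarith
    also have "\<dots> \<le> norm (u x) + norm (u y) * (1/2)"
      using y by (intro add_left_mono mult_left_mono) auto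
    finally have "norm (u y) \<le> 2 * norm (u x)" by simp
    then have "norm (u y) * d y \<le> 2 * norm (u x) * d y" using \<open>d y \<ge> 0\<close> by (rule mult_right_mono)
    then show "norm (u y - u x) \<le> 2 * norm (u x) * d y" using du[of y] by linarith
  qed simp
  then have "((\<lambda>y. u y - u x) \<longlongrightarrow> 0) (at x)"
    by (rule Lim_null_comparison) (use tendsto_mult[OF tendsto_const[of "2 * norm (u x)"] d0] in simp)
  then show "isCont (\<lambda>y. inv_into UNIV (A y) w) x"
    unfolding isCont_def u_def by (rule LIM_zero_cancel)
qed

text \<open>By the identity in \<open>continuous_inverse_family\<close> the inverse is a constant
  minus products with factors vanishing at \<open>x\<close>, so
  \<open>has_derivative_scaleR_zero\<close> yields the formula D(A^-1) = - A^-1 (DA) A^-1 from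
  continuity of the inverse alone. The right-hand side is C^k whenever the inverse is, which gains
  one order in the induction.\<close>

lemma Ck_on_inverse_family:
  fixes A :: "'a::real_normed_vector \<Rightarrow> 'b::euclidean_space \<Rightarrow> 'b"
  assumes "open U" "\<And>b. Ck_on k U (\<lambda>y. A y b)" "\<And>y. linear (A y)" "\<And>y. bij (A y)"
  shows "Ck_on k U (\<lambda>y. inv_into UNIV (A y) w)"
  using assms(2)
proof (induction k arbitrary: w)
  case 0
  then have "isCont (\<lambda>y. A y b) x" if "x \<in> U" for x b
    using assms(1) that by (simp add: continuous_on_eq_continuous_at)
  then show ?case
    using continuous_inverse_family(1)[where A=A, OF _ assms(3,4)] by (simp add: continuous_at_imp_continuous_on)
next
  case (Suc k)
  note D = Ck_on_SucD[OF assms(1) Suc.prems]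
  have lB: "linear (inv_into UNIV (A x))" for x
    using assms(3,4) bij_is_inj by (intro inj_linear_imp_inv_linear) auto
  have IH: "Ck_on k U (\<lambda>y. inv_into UNIV (A y) w)" for w
    using Suc Ck_on_Suc_imp by blast
  show ?case
  proof (rule Ck_on_SucI[OF assms(1)])
    fix x assume x: "x \<in> U"
    have c: "isCont (\<lambda>y. inv_into UNIV (A y) w) x" for w
      by (rule continuous_inverse_family(1)[where A=A, OF _ assms(3,4)])
        (use D(1)[OF x] has_derivative_continuous in blast)
    have "((\<lambda>y. inv_into UNIV (A x) w - (\<Sum>b\<in>Basis. (inv_into UNIV (A y) w \<bullet> b) *\<^sub>R inv_into UNIV (A x) (A y b - A x b))) has_derivative
      (\<lambda>v. 0 - (\<Sum>b\<in>Basis. (inv_into UNIV (A x) w \<bullet> b) *\<^sub>R inv_into UNIV (A x) (frechet_derivative (\<lambda>y. A y b) (at x) v - 0)))) (at x)"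
      by (intro has_derivative_diff has_derivative_const has_derivative_sum has_derivative_scaleR_zero
          bounded_linear.has_derivative[OF linear_conv_bounded_linear[THEN iffD1, OF lB]] D(1)[OF x]
          continuous_intros c) (simp add: linear_0[OF lB])
    moreover have "(\<lambda>y. inv_into UNIV (A x) w - (\<Sum>b\<in>Basis. (inv_into UNIV (A y) w \<bullet> b) *\<^sub>R inv_into UNIV (A x) (A y b - A x b)))
      = (\<lambda>y. inv_into UNIV (A y) w)"
      using continuous_inverse_family(2)[where A=A and x=x, OF _ assms(3,4), symmetric] D(1)[OF x] has_derivative_continuous
      by blast
    ultimately show "((\<lambda>y. inv_into UNIV (A y) w) has_derivative
      (\<lambda>v. - (\<Sum>b\<in>Basis. (inv_into UNIV (A x) w \<bullet> b) *\<^sub>R inv_into UNIV (A x) (frechet_derivative (\<lambda>y. A y b) (at x) v)))) (at x)"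
      by simp
  next
    fix v
    have "(\<lambda>x. - (\<Sum>b\<in>Basis. (inv_into UNIV (A x) w \<bullet> b) *\<^sub>R inv_into UNIV (A x) (frechet_derivative (\<lambda>y. A y b) (at x) v)))
      = (\<lambda>x. - (\<Sum>b\<in>Basis. (inv_into UNIV (A x) w \<bullet> b) *\<^sub>R
          (\<Sum>c\<in>Basis. (frechet_derivative (\<lambda>y. A y b) (at x) v \<bullet> c) *\<^sub>R inv_into UNIV (A x) c)))"
      by (subst linear_euclidean_sum[OF lB, of _ "frechet_derivative _ _ _"]) simp
    then show "Ck_on k U (\<lambda>x. - (\<Sum>b\<in>Basis. (inv_into UNIV (A x) w \<bullet> b) *\<^sub>R inv_into UNIV (A x) (frechet_derivative (\<lambda>y. A y b) (at x) v)))"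
      by (simp only:) (intro Ck_on_bounded_linear[OF assms(1) bounded_linear_minus[OF bounded_linear_ident]] Ck_on_sum
          Ck_on_bounded_bilinear[OF _ bounded_bilinear_scaleR]
          Ck_on_bounded_linear[OF _ bounded_linear_inner_left] assms(1) IH D(2))
  qed
qed


section \<open>The smooth inverse function theorem and the exterior derivative\<close>

text \<open>Bootstrapping: if the inverse \<open>g\<close> is C^k, then so is the family of
  derivatives of \<open>f\<close> along \<open>g\<close>, hence also the family of their inverses,
  which is the derivative of \<open>g\<close>. The applications normalise the derivative at
  \<open>x0\<close> to the identity beforehand.\<close>

theorem smooth_inverse_function:
  fixes f :: "'a::euclidean_space \<Rightarrow> 'a"
  assumes U: "open U" and f: "smooth_on U f" and x0: "x0 \<in> U"
    and id: "\<And>v. frechet_derivative f (at x0) v = v"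
  obtains U' V g where "open U'" "U' \<subseteq> U" "x0 \<in> U'" "open V" "homeomorphism U' V f g"
    "smooth_on V g" "\<And>v. frechet_derivative g (at (f x0)) v = v"
proof -
  define f' where "f' = (\<lambda>x. Blinfun (frechet_derivative f (at x)))"
  have f': "blinfun_apply (f' x) = frechet_derivative f (at x)" if "x \<in> U" for x
    unfolding f'_def
    by (rule bounded_linear_Blinfun_apply)
      (use smooth_on_has_derivative[OF f U that] has_derivative_bounded_linear in blast)
  have derf: "(f has_derivative blinfun_apply (f' x)) (at x)" if "x \<in> U" for x
    using smooth_on_has_derivative[OF f U that] f'[OF that] by simp
  have contf: "continuous_on U f'"
  proof (rule continuous_on_blinfun_componentwise)
    show "continuous_on U (\<lambda>x. blinfun_apply (f' x) i)" for i
      using smooth_on_imp_continuous_on[OF smooth_on_frechet_derivative[OF f U, of i]] f'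
      by (simp cong: continuous_on_cong)
  qed
  have "id_blinfun o\<^sub>L f' x0 = id_blinfun"
    by (rule blinfun_eqI) (simp add: f'[OF x0] id)
  from inverse_function_theorem[OF U derf contf x0 this]
  obtain U' V g g' where *: "open U'" "U' \<subseteq> U" "x0 \<in> U'" "open V" "homeomorphism U' V f g"
    and dg: "\<And>y. y \<in> V \<Longrightarrow> (g has_derivative g' y) (at y)"
    and g': "\<And>y. y \<in> V \<Longrightarrow> g' y = inv_into UNIV (blinfun_apply (f' (g y)))"
    and bij: "\<And>y. y \<in> V \<Longrightarrow> bij (blinfun_apply (f' (g y)))"
    by metis
  have gV: "g y \<in> U" if "y \<in> V" for y
    using *(2,5) that unfolding homeomorphism_def by blast
  \<comment> \<open>Outside \<open>V\<close> the identity is a dummy value, since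
    \<open>Ck_on_inverse_family\<close> asks for a bijective linear map at every
    \<open>y\<close>.\<close>
  define A where "A = (\<lambda>y. if y \<in> V then frechet_derivative f (at (g y)) else (\<lambda>v. v))"
  have A: "linear (A y)" "bij (A y)" for y
    using bij[of y] f'[OF gV] has_derivative_linear[OF derf[OF gV]]
    by (auto simp: A_def id_def[symmetric] linear_id)
  have "Ck_on k V g" for k
  proof (induction k)
    case 0
    show ?case using *(5) by (simp add: homeomorphism_def)
  next
    case (Suc k)
    have "Ck_on k V (\<lambda>y. A y b)" for b
      using Ck_on_compose[OF U *(4) _ Suc gV, of "\<lambda>x. frechet_derivative f (at x) b"]
        smooth_on_frechet_derivative[OF f U, of b]
      by (auto simp: smooth_on_def A_def intro: Ck_on_cong_imp[OF *(4), rotated])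
    from Ck_on_inverse_family[where A = A, OF *(4) this A]
    have "Ck_on k V (\<lambda>y. g' y w)" for w
      by (rule Ck_on_cong_imp[OF *(4), rotated]) (auto simp: A_def g' f' gV)
    then show ?case using Ck_on_SucI[OF *(4) dg] by blast
  qed
  moreover have "frechet_derivative g (at (f x0)) v = v" for v
  proof -
    have y: "f x0 \<in> V" "g (f x0) = x0" using * unfolding homeomorphism_def by auto
    have "frechet_derivative g (at (f x0)) = inv_into UNIV (frechet_derivative f (at x0))"
      using frechet_derivative_at[OF dg[OF y(1)]] g'[OF y(1)] y f'[OF x0] by simp
    also have "frechet_derivative f (at x0) = (\<lambda>v. v)" using id by blast
    finally show ?thesis by (metis bij_id eq_id_iff inv_id)
  qed
  ultimately show thesis using that * unfolding smooth_on_def by blast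
qed

section \<open>Symmetry of second derivatives\<close>

text \<open>Two applications of the mean value theorem: along \<open>v\<close> to the increment of
  \<open>f\<close> in direction \<open>h *\<^sub>R w\<close>, then along \<open>w\<close> to the
  derivative of \<open>f\<close> in direction \<open>v\<close>.\<close>

lemma second_difference_mvt:
  fixes f :: "'a::real_normed_vector \<Rightarrow> real"
  assumes U: "open U" and f: "Ck_on (Suc (Suc 0)) U f" and h: "h > 0"
    and in_U: "\<And>s t. 0 \<le> s \<Longrightarrow> s \<le> h \<Longrightarrow> 0 \<le> t \<Longrightarrow> t \<le> h \<Longrightarrow> x + s *\<^sub>R v + t *\<^sub>R w \<in> U"
  shows "\<exists>s t. 0 < s \<and> s < h \<and> 0 < t \<and> t < h \<and>
    f (x + h *\<^sub>R v + h *\<^sub>R w) - f (x + h *\<^sub>R v) - f (x + h *\<^sub>R w) + f x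
      = h * (h * frechet_derivative (\<lambda>y. frechet_derivative f (at y) v) (at (x + s *\<^sub>R v + t *\<^sub>R w)) w)"
proof -
  note D1 = Ck_on_SucD(1)[OF U f]
  note D2 = Ck_on_SucD(1)[OF U Ck_on_SucD(2)[OF U f]]
  have hd: "((\<lambda>s. k (a + s *\<^sub>R u)) has_real_derivative frechet_derivative k (at (a + s *\<^sub>R u)) u) (at s)"
    if "(k has_derivative frechet_derivative k (at (a + s *\<^sub>R u))) (at (a + s *\<^sub>R u))" for k :: "'a \<Rightarrow> real" and a u s
  proof -
    have "((\<lambda>s. a + s *\<^sub>R u) has_derivative (\<lambda>r. r *\<^sub>R u)) (at s)"
      by (auto intro!: derivative_eq_intros)
    from has_derivative_compose[OF this that] show ?thesis
      unfolding has_field_derivative_def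
      by (simp add: linear_cmul[OF has_derivative_linear[OF that]] mult.commute[of _ "frechet_derivative k _ u"])
  qed
  have "\<exists>s>0. s < h \<and> (f (x + h *\<^sub>R w + h *\<^sub>R v) - f (x + h *\<^sub>R v)) - (f (x + h *\<^sub>R w + 0 *\<^sub>R v) - f (x + 0 *\<^sub>R v))
      = (h - 0) * (frechet_derivative f (at (x + h *\<^sub>R w + s *\<^sub>R v)) v - frechet_derivative f (at (x + s *\<^sub>R v)) v)"
    by (rule MVT2[OF h], rule DERIV_diff; rule hd; rule D1)
      (use in_U[of _ h] in_U[of _ 0] h in \<open>simp_all add: add_ac\<close>)
  then obtain s where s: "0 < s" "s < h" and
    e1: "f (x + h *\<^sub>R v + h *\<^sub>R w) - f (x + h *\<^sub>R v) - f (x + h *\<^sub>R w) + f x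
      = h * (frechet_derivative f (at (x + s *\<^sub>R v + h *\<^sub>R w)) v - frechet_derivative f (at (x + s *\<^sub>R v + 0 *\<^sub>R w)) v)"
    by (auto simp: add_ac)
  have "\<exists>t>0. t < h \<and> frechet_derivative f (at (x + s *\<^sub>R v + h *\<^sub>R w)) v - frechet_derivative f (at (x + s *\<^sub>R v + 0 *\<^sub>R w)) v
      = (h - 0) * frechet_derivative (\<lambda>y. frechet_derivative f (at y) v) (at (x + s *\<^sub>R v + t *\<^sub>R w)) w"
    by (rule MVT2[OF h], rule hd, rule D2) (use in_U s in simp)
  then obtain t where t: "0 < t" "t < h" and
    e2: "frechet_derivative f (at (x + s *\<^sub>R v + h *\<^sub>R w)) v - frechet_derivative f (at (x + s *\<^sub>R v + 0 *\<^sub>R w)) v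
      = h * frechet_derivative (\<lambda>y. frechet_derivative f (at y) v) (at (x + s *\<^sub>R v + t *\<^sub>R w)) w"
    by auto
  show ?thesis using s t e1 unfolding e2 by blast
qed

text \<open>The second difference is symmetric in \<open>v\<close> and \<open>w\<close>, so its two
  mean value expressions agree. After cancelling \<open>h\<close> twice, both second derivatives are
  taken at points near \<open>x\<close>, where continuity makes them close to their values at
  \<open>x\<close>.\<close>

lemma second_derivative_commute:
  fixes f :: "'a::real_normed_vector \<Rightarrow> real"
  assumes U: "open U" and f: "Ck_on (Suc (Suc 0)) U f" and x: "x \<in> U"
  shows "frechet_derivative (\<lambda>y. frechet_derivative f (at y) v) (at x) w
       = frechet_derivative (\<lambda>y. frechet_derivative f (at y) w) (at x) v"
proof -
  define H where "H = (\<lambda>v w y. frechet_derivative (\<lambda>y. frechet_derivative f (at y) v) (at y) w)"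
  have cont: "isCont (H v w) x" for v w
    using Ck_on_SucD(2)[OF U Ck_on_SucD(2)[OF U f]] U x by (simp add: H_def continuous_on_eq_continuous_at)
  have "\<bar>H v w x - H w v x\<bar> \<le> e" if "e > 0" for e
  proof -
    have e: "e / 2 > 0" using that by simp
    obtain d1 where d1: "d1 > 0" "\<And>y. dist y x < d1 \<Longrightarrow> \<bar>H v w y - H v w x\<bar> < e / 2"
      using cont[of v w] e unfolding continuous_at_eps_delta dist_real_def by blast
    obtain d2 where d2: "d2 > 0" "\<And>y. dist y x < d2 \<Longrightarrow> \<bar>H w v y - H w v x\<bar> < e / 2"
      using cont[of w v] e unfolding continuous_at_eps_delta dist_real_def by blast
    obtain d3 where d3: "d3 > 0" "ball x d3 \<subseteq> U"
      using U x open_contains_ball by blast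
    define d where "d = min d1 (min d2 d3)"
    \<comment> \<open>Keeps the parallelogram spanned by \<open>h *\<^sub>R v\<close> and
      \<open>h *\<^sub>R w\<close> within distance \<open>d\<close> of \<open>x\<close>; the summand
      1 covers the case that both vectors vanish.\<close>
    define h where "h = d / (norm v + norm w + 1)"
    have d: "d > 0" using d1 d2 d3 by (simp add: d_def)
    have np: "norm v + norm w + 1 > 0" by (simp add: add_nonneg_pos)
    have h: "h > 0" using d np by (simp add: h_def)
    have near: "dist (x + s *\<^sub>R a + t *\<^sub>R b) x < d"
      if "{a, b} = {v, w}" "0 \<le> s" "s \<le> h" "0 \<le> t" "t \<le> h" for s t a b
    proof -
      have "dist (x + s *\<^sub>R a + t *\<^sub>R b) x = norm (s *\<^sub>R a + t *\<^sub>R b)" by (simp add: dist_norm add.assoc)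
      also have "\<dots> \<le> s * norm a + t * norm b"
        using that by (intro order_trans[OF norm_triangle_ineq]) simp
      also have "\<dots> \<le> h * norm a + h * norm b" using that by (intro add_mono mult_right_mono) auto
      also have "\<dots> = h * (norm v + norm w)" using that(1) by (auto simp: doubleton_eq_iff algebra_simps)
      also have "\<dots> < h * (norm v + norm w + 1)" using h by simp
      also have "\<dots> = d" using np by (simp add: h_def)
      finally show ?thesis .
    qed
    have inU: "x + s *\<^sub>R a + t *\<^sub>R b \<in> U"
      if "{a, b} = {v, w}" "0 \<le> s" "s \<le> h" "0 \<le> t" "t \<le> h" for s t a b
      using near[OF that] d3(2) by (auto simp: d_def dist_commute subset_eq)
    obtain s t where st: "0 < s" "s < h" "0 < t" "t < h"
      "f (x + h *\<^sub>R v + h *\<^sub>R w) - f (x + h *\<^sub>R v) - f (x + h *\<^sub>R w) + f x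
        = h * (h * H v w (x + s *\<^sub>R v + t *\<^sub>R w))"
      using second_difference_mvt[OF U f h inU[of v w]] unfolding H_def by auto
    obtain s' t' where st': "0 < s'" "s' < h" "0 < t'" "t' < h"
      "f (x + h *\<^sub>R w + h *\<^sub>R v) - f (x + h *\<^sub>R w) - f (x + h *\<^sub>R v) + f x
        = h * (h * H w v (x + s' *\<^sub>R w + t' *\<^sub>R v))"
      using second_difference_mvt[OF U f h inU[of w v]] unfolding H_def by (auto simp: insert_commute)
    have "h * (h * H v w (x + s *\<^sub>R v + t *\<^sub>R w)) = h * (h * H w v (x + s' *\<^sub>R w + t' *\<^sub>R v))"
      using st(5) st'(5) by (simp add: algebra_simps)
    then have "H v w (x + s *\<^sub>R v + t *\<^sub>R w) = H w v (x + s' *\<^sub>R w + t' *\<^sub>R v)" using h by simp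
    moreover have "\<bar>H v w (x + s *\<^sub>R v + t *\<^sub>R w) - H v w x\<bar> < e / 2"
      by (rule d1(2)) (use near[of v w s t] st in \<open>simp add: d_def\<close>)
    moreover have "\<bar>H w v (x + s' *\<^sub>R w + t' *\<^sub>R v) - H w v x\<bar> < e / 2"
      by (rule d2(2)) (use near[of w v s' t'] st' in \<open>simp add: d_def insert_commute\<close>)
    ultimately show ?thesis by linarith
  qed
  then have "H v w x - H w v x = 0" by (rule dense_eq0_I)
  then show ?thesis by (simp add: H_def)
qed

section \<open>Exterior derivative in a vector space\<close>

lemma ext_d_cong_open:
  assumes "open U" "x \<in> U" "\<And>y v. y \<in> U \<Longrightarrow> \<alpha> y v = \<beta> y v"
  shows "ext_d \<alpha> x = ext_d \<beta> x"
  unfolding ext_d_def fun_eq_iff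
  using frechet_derivative_cong_open[OF assms(1,2), of "\<lambda>y. \<alpha> y _" "\<lambda>y. \<beta> y _"] assms(3) by simp

text \<open>The terms with second derivatives of \<open>\<tau>\<close> cancel by symmetry.\<close>

lemma ext_d_pullback:
  fixes \<tau> :: "'a::euclidean_space \<Rightarrow> 'b::euclidean_space"
  assumes U: "open U" and V: "open V" and \<tau>: "smooth_on U \<tau>" "\<And>x. x \<in> U \<Longrightarrow> \<tau> x \<in> V"
    and lin: "\<And>y. y \<in> V \<Longrightarrow> linear (\<beta> y)"
    and \<beta>: "\<And>v. smooth_on V (\<lambda>y. \<beta> y v)" and x: "x \<in> U"
  shows "ext_d (\<lambda>y v. \<beta> (\<tau> y) (frechet_derivative \<tau> (at y) v)) x v w
       = ext_d \<beta> (\<tau> x) (frechet_derivative \<tau> (at x) v) (frechet_derivative \<tau> (at x) w)"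
proof -
  define T where "T = (\<lambda>y v. frechet_derivative \<tau> (at y) v)"
  define S where "S = (\<lambda>v w. frechet_derivative (\<lambda>y. T y v) (at x) w)"
  note dT = smooth_on_has_derivative[OF smooth_on_frechet_derivative[OF \<tau>(1) U] U x]
  note d\<tau> = smooth_on_has_derivative[OF \<tau>(1) U x]
  note d\<beta> = smooth_on_has_derivative[OF \<beta> V \<tau>(2)[OF x]]
  have sym: "S v w = S w v" for v w
  \<comment> \<open>\<open>second_derivative_commute\<close> is about real functions, so it is
    applied to each coordinate \<open>k\<close> of \<open>\<tau>\<close>.\<close>
  proof (rule euclidean_eqI)
    fix b :: 'b assume "b \<in> Basis"
    define k where "k = (\<lambda>y. \<tau> y \<bullet> b)"
    have sk: "smooth_on U k"
      unfolding k_def by (rule smooth_on_bounded_linear[OF U bounded_linear_inner_left \<tau>(1)])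
    have k1: "frechet_derivative k (at y) v = T y v \<bullet> b" if "y \<in> U" for y v
      using frechet_derivative_at[OF bounded_linear.has_derivative[OF bounded_linear_inner_left[of b]
         smooth_on_has_derivative[OF \<tau>(1) U that]]]
      by (simp add: k_def T_def fun_eq_iff)
    have k2: "frechet_derivative (\<lambda>y. frechet_derivative k (at y) v) (at x) w = S v w \<bullet> b" for v w
    proof -
      have "frechet_derivative (\<lambda>y. frechet_derivative k (at y) v) (at x) = frechet_derivative (\<lambda>y. T y v \<bullet> b) (at x)"
        by (rule frechet_derivative_cong_open[OF U x k1])
      also have "\<dots> = (\<lambda>w. S v w \<bullet> b)"
        using frechet_derivative_at[OF bounded_linear.has_derivative[OF bounded_linear_inner_left[of b] dT]]
        unfolding S_def T_def by metis
      finally show ?thesis by simp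
    qed
    show "S v w \<bullet> b = S w v \<bullet> b"
      using second_derivative_commute[OF U _ x, of k v w] sk k2 unfolding smooth_on_def by metis
  qed
  \<comment> \<open>The vector \<open>T y w\<close> to which the form is applied moves with
    \<open>y\<close>. Expanding it in the basis separates the second derivative of
    \<open>\<tau>\<close> from the derivative of the form.\<close>
  have key: "frechet_derivative (\<lambda>y. \<beta> (\<tau> y) (T y w)) (at x) v
      = \<beta> (\<tau> x) (S w v) + frechet_derivative (\<lambda>y. \<beta> y (T x w)) (at (\<tau> x)) (T x v)" for v w
  proof -
    have "frechet_derivative (\<lambda>y. \<beta> (\<tau> y) (T y w)) (at x)
      = frechet_derivative (\<lambda>y. \<Sum>b\<in>Basis. (T y w \<bullet> b) * \<beta> (\<tau> y) b) (at x)"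
      by (rule frechet_derivative_cong_open[OF U x])
        (use linear_euclidean_sum[OF lin[OF \<tau>(2)]] in simp)
    also have "\<dots> = (\<lambda>v. \<Sum>b\<in>Basis. (T x w \<bullet> b) * frechet_derivative (\<lambda>y. \<beta> y b) (at (\<tau> x)) (T x v) + (S w v \<bullet> b) * \<beta> (\<tau> x) b)"
      unfolding T_def S_def
      by (rule frechet_derivative_at[symmetric])
        (intro has_derivative_sum has_derivative_mult has_derivative_compose[OF d\<tau> d\<beta>]
          bounded_linear.has_derivative[OF bounded_linear_inner_left dT])
    finally have 1: "frechet_derivative (\<lambda>y. \<beta> (\<tau> y) (T y w)) (at x) v =
      (\<Sum>b\<in>Basis. (T x w \<bullet> b) * frechet_derivative (\<lambda>y. \<beta> y b) (at (\<tau> x)) (T x v)) + (\<Sum>b\<in>Basis. (S w v \<bullet> b) * \<beta> (\<tau> x) b)"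
      by (simp add: sum.distrib)
    have "frechet_derivative (\<lambda>y. \<beta> y (T x w)) (at (\<tau> x))
      = frechet_derivative (\<lambda>y. \<Sum>b\<in>Basis. (T x w \<bullet> b) * \<beta> y b) (at (\<tau> x))"
      by (rule frechet_derivative_cong_open[OF V \<tau>(2)[OF x]])
        (use linear_euclidean_sum[OF lin] in simp)
    also have "\<dots> = (\<lambda>v. \<Sum>b\<in>Basis. (T x w \<bullet> b) * frechet_derivative (\<lambda>y. \<beta> y b) (at (\<tau> x)) v)"
      by (rule frechet_derivative_at[symmetric])
        (intro has_derivative_sum has_derivative_mult_right d\<beta>)
    finally show ?thesis
      using 1 linear_euclidean_sum[OF lin[OF \<tau>(2)[OF x]], of "S w v"] by simp
  qed
  show ?thesis
    unfolding ext_d_def using key[of v w] key[of w v] sym[of v w] by (simp add: T_def)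
qed

lemma bilinear_ext_d:
  fixes \<beta> :: "'a::real_normed_vector \<Rightarrow> 'a \<Rightarrow> real"
  assumes V: "open V" and x: "x \<in> V" and lin: "\<And>y. y \<in> V \<Longrightarrow> linear (\<beta> y)"
    and \<beta>: "\<And>v. smooth_on V (\<lambda>y. \<beta> y v)"
  shows "bilinear (ext_d \<beta> x)"
proof -
  note d\<beta> = smooth_on_has_derivative[OF \<beta> V x]
  have 1: "frechet_derivative (\<lambda>y. \<beta> y (u + v)) (at x) w
     = frechet_derivative (\<lambda>y. \<beta> y u) (at x) w + frechet_derivative (\<lambda>y. \<beta> y v) (at x) w" for u v w
  proof -
    have "frechet_derivative (\<lambda>y. \<beta> y (u + v)) (at x) = frechet_derivative (\<lambda>y. \<beta> y u + \<beta> y v) (at x)"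
      by (rule frechet_derivative_cong_open[OF V x]) (simp add: linear_add[OF lin])
    then show ?thesis using frechet_derivative_at[OF has_derivative_add[OF d\<beta> d\<beta>]] by metis
  qed
  have 2: "frechet_derivative (\<lambda>y. \<beta> y (c *\<^sub>R u)) (at x) w
     = c * frechet_derivative (\<lambda>y. \<beta> y u) (at x) w" for u c w
  proof -
    have "frechet_derivative (\<lambda>y. \<beta> y (c *\<^sub>R u)) (at x) = frechet_derivative (\<lambda>y. c * \<beta> y u) (at x)"
      by (rule frechet_derivative_cong_open[OF V x]) (simp add: linear_cmul[OF lin])
    then show ?thesis using frechet_derivative_at[OF has_derivative_mult_right[OF d\<beta>]] by metis
  qed
  note l = has_derivative_linear[OF d\<beta>]
  show ?thesis
    unfolding bilinear_def ext_d_def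
    by (intro allI conjI linearI)
      (simp_all add: 1 2 linear_add[OF l] linear_cmul[OF l] algebra_simps add_divide_distrib diff_divide_distrib)
qed

lemma ext_d_antisym: "ext_d \<alpha> x v w = - ext_d \<alpha> x w v"
  by (simp add: ext_d_def field_simps)

lemma smooth_on_ext_d:
  assumes V: "open V" and \<beta>: "\<And>v. smooth_on V (\<lambda>y. \<beta> y v)"
  shows "smooth_on V (\<lambda>y. ext_d \<beta> y v w)"
proof -
  have "smooth_on V (\<lambda>y. (1/2) * (frechet_derivative (\<lambda>y. \<beta> y w) (at y) v + - frechet_derivative (\<lambda>y. \<beta> y v) (at y) w))"
    by (intro smooth_on_bounded_linear[OF V bounded_linear_mult_right] smooth_on_add[OF V]
        smooth_on_bounded_linear[OF V bounded_linear_minus[OF bounded_linear_ident]]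
        smooth_on_frechet_derivative[OF _ V] \<beta>)
  then show ?thesis by (simp add: ext_d_def)
qed

text \<open>With \<open>\<lambda> = r\<^sup>2\<beta>\<close> this is \<open>d\<lambda> = dr\<^sup>2 \<and> \<beta> + r\<^sup>2 d\<beta>\<close>.\<close>

lemma ext_d_liouville:
  assumes V: "open V" and x: "x \<in> V" and \<beta>: "\<And>v. smooth_on V (\<lambda>y. \<beta> y v)"
  shows "ext_d (liouville \<beta>) (x, r) (v, a) (w, b)
    = r * (a * \<beta> x w - b * \<beta> x v) + r\<^sup>2 * ext_d \<beta> x v w"
proof -
  have "frechet_derivative (\<lambda>y'. liouville \<beta> y' (w, b)) (at (x, r)) (v, a)
     = 2 * r * a * \<beta> x w + r\<^sup>2 * frechet_derivative (\<lambda>y. \<beta> y w) (at x) v" for v w a b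
  proof -
    have f: "(fst has_derivative fst) (at (x, r))" and s: "(snd has_derivative snd) (at (x, r))"
      by (auto intro!: derivative_eq_intros)
    have g: "((\<lambda>p. \<beta> (fst p) w) has_derivative (\<lambda>p. frechet_derivative (\<lambda>y. \<beta> y w) (at x) (fst p))) (at (x, r))"
      using has_derivative_compose[OF f, of "\<lambda>y. \<beta> y w"] smooth_on_has_derivative[OF \<beta> V x] by simp
    have "((\<lambda>p. (snd p)\<^sup>2 * \<beta> (fst p) w) has_derivative
        (\<lambda>p. r\<^sup>2 * frechet_derivative (\<lambda>y. \<beta> y w) (at x) (fst p) + (2 * r * snd p) * \<beta> x w)) (at (x, r))"
      using g s by (auto intro!: derivative_eq_intros simp: fun_eq_iff)
    moreover have "(\<lambda>y'. liouville \<beta> y' (w, b)) = (\<lambda>p. (snd p)\<^sup>2 * \<beta> (fst p) w)"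
      by (auto simp: liouville_def)
    ultimately show ?thesis using frechet_derivative_at by (metis (no_types, lifting) add.commute fst_conv snd_conv)
  qed
  then show ?thesis
    unfolding ext_d_def by (simp add: field_simps)
qed


section \<open>Finite-dimensional normed spaces\<close>

text \<open>After division by \<open>a\<close> the vector is \<open>b\<close> minus a point of the
  span. The bound controls the coefficient of \<open>b\<close> by the norm of the whole vector,
  which yields closedness of finite spans and boundedness of coordinates.\<close>

lemma infdist_span_le:
  fixes b :: "'a::real_normed_vector"
  assumes "y \<in> span B"
  shows "\<bar>a\<bar> * infdist b (span B) \<le> norm (a *\<^sub>R b + y)"
proof (cases "a = 0")
  case False
  have "- ((1 / a) *\<^sub>R y) \<in> span B" using assms by (intro span_neg span_scale)
  then have "infdist b (span B) \<le> dist b (- ((1 / a) *\<^sub>R y))" by (rule infdist_le)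
  then have "\<bar>a\<bar> * infdist b (span B) \<le> \<bar>a\<bar> * norm (b + (1 / a) *\<^sub>R y)"
    by (intro mult_left_mono) (auto simp: dist_norm)
  also have "\<dots> = norm (a *\<^sub>R (b + (1 / a) *\<^sub>R y))" by simp
  also have "a *\<^sub>R (b + (1 / a) *\<^sub>R y) = a *\<^sub>R b + y" using False by (simp add: scaleR_add_right)
  finally show ?thesis .
qed simp

text \<open>By \<open>infdist_span_le\<close> the coefficients of \<open>b\<close> along a
  convergent sequence form a Cauchy sequence. Subtracting the \<open>b\<close>-parts leaves a
  convergent sequence in the smaller span, which is closed by induction.\<close>

lemma closed_span_finite:
  fixes B :: "'a::real_normed_vector set"
  assumes "finite B"
  shows "closed (span B)"
  using assms
proof (induction B rule: finite_induct)
  case empty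
  then show ?case by simp
next
  case (insert b B)
  show ?case
  proof (cases "b \<in> span B")
    case True
    then show ?thesis using insert.IH by (simp add: span_redundant)
  next
    case False
    define d where "d = infdist b (span B)"
    have d: "d > 0"
      unfolding d_def using infdist_pos_not_in_closed[OF insert.IH _ False] span_zero by blast
    show ?thesis
      unfolding closed_sequential_limits
    proof (intro allI impI, elim conjE)
      fix x l assume x: "\<forall>n. x n \<in> span (insert b B)" and lim: "x \<longlonglongrightarrow> l"
      obtain a where a: "\<And>n. x n - a n *\<^sub>R b \<in> span B"
        using x unfolding span_breakdown_eq by metis
      have "Cauchy a"
      proof (rule metric_CauchyI)
        fix e :: real assume "e > 0"
        then have "e * d > 0" using d by simp
        then obtain N where N: "\<And>m n. m \<ge> N \<Longrightarrow> n \<ge> N \<Longrightarrow> dist (x m) (x n) < e * d"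
          using LIMSEQ_imp_Cauchy[OF lim] unfolding Cauchy_def by metis
        have "dist (a m) (a n) < e" if mn: "m \<ge> N" "n \<ge> N" for m n
        proof -
          have "\<bar>a m - a n\<bar> * d \<le> norm ((a m - a n) *\<^sub>R b + ((x m - a m *\<^sub>R b) - (x n - a n *\<^sub>R b)))"
            unfolding d_def by (rule infdist_span_le) (intro span_diff a)
          also have "(a m - a n) *\<^sub>R b + ((x m - a m *\<^sub>R b) - (x n - a n *\<^sub>R b)) = x m - x n"
            by (simp add: algebra_simps)
          also have "norm (x m - x n) < e * d" using N[OF mn] by (simp add: dist_norm)
          finally show ?thesis using d by (simp add: dist_real_def)
        qed
        then show "\<exists>N. \<forall>m\<ge>N. \<forall>n\<ge>N. dist (a m) (a n) < e" by blast
      qed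
      then obtain k where "a \<longlonglongrightarrow> k" using Cauchy_convergent convergent_def by blast
      then have "(\<lambda>n. x n - a n *\<^sub>R b) \<longlonglongrightarrow> l - k *\<^sub>R b" by (intro tendsto_intros lim)
      with insert.IH a have "l - k *\<^sub>R b \<in> span B" by (rule closed_sequentially)
      then show "l \<in> span (insert b B)" by (auto simp: span_breakdown_eq)
    qed
  qed
qed

text \<open>The argument of F. Riesz: the centres of finitely many balls of radius 1/2 covering the
  unit ball span the space. For \<open>v\<close> at distance \<open>d > 0\<close> from the span,
  take \<open>y\<close> in it with \<open>dist v y < 2 * d\<close> and a centre \<open>f\<close>
  within 1/2 of the normalised \<open>v - y\<close>; then \<open>y + r *\<^sub>R f\<close> is in the
  span and closer to \<open>v\<close> than \<open>d\<close>.\<close>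

lemma heine_borel_finite_span:
  obtains F :: "'a::{real_normed_vector, heine_borel} set" where "finite F" "span F = UNIV"
proof -
  have compact: "compact (cball (0::'a) 1)" by (simp add: compact_eq_bounded_closed)
  have "x \<in> ball x (1/2)" for x :: 'a by simp
  then have "cball 0 1 \<subseteq> (\<Union>x::'a. ball x (1/2))" by blast
  then obtain F :: "'a set" where F: "finite F" "cball 0 1 \<subseteq> (\<Union>x\<in>F. ball x (1/2))"
    using compactE_image[OF compact, of UNIV "\<lambda>x. ball x (1/2)"] by auto
  have "v \<in> span F" for v
  proof (rule ccontr)
    assume v: "v \<notin> span F"
    define d where "d = infdist v (span F)"
    have d: "d > 0"
      unfolding d_def using infdist_pos_not_in_closed[OF closed_span_finite[OF F(1)] _ v] span_zero by blast
    obtain y where y: "y \<in> span F" "dist v y < 2 * d"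
    proof (rule ccontr)
      assume "\<not> thesis"
      then have "\<forall>y\<in>span F. 2 * d \<le> dist v y" using that by force
      then have "2 * d \<le> infdist v (span F)"
        unfolding infdist_def using span_zero by (auto intro!: cINF_greatest)
      then show False using d by (simp add: d_def)
    qed
    define r where "r = norm (v - y)"
    have r: "r > 0" using v y by (auto simp: r_def)
    have "(1 / r) *\<^sub>R (v - y) \<in> cball 0 1" using r by (simp add: r_def)
    then have "(1 / r) *\<^sub>R (v - y) \<in> (\<Union>x\<in>F. ball x (1/2))" using F(2) by blast
    then obtain f where f: "f \<in> F" "dist f ((1 / r) *\<^sub>R (v - y)) < 1/2" by (auto simp: dist_commute)
    have le: "d \<le> dist v (y + r *\<^sub>R f)"
      unfolding d_def using y(1) span_base[OF f(1)] by (intro infdist_le span_add span_scale)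
    have "dist v (y + r *\<^sub>R f) = norm (r *\<^sub>R ((1 / r) *\<^sub>R (v - y) - f))"
      using r by (simp add: dist_norm algebra_simps)
    also have "\<dots> < r * (1/2)"
      using f(2) r by (simp add: dist_norm norm_minus_commute)
    also have "\<dots> < d" using y(2) by (simp add: r_def dist_norm)
    finally show False using le by simp
  qed
  then show thesis using that F(1) by blast
qed

text \<open>Supplies coordinates on the Lie algebra, whose model space has no inner product. The
  coefficient of \<open>b\<close> is bounded with constant \<open>1 / d\<close>, where
  \<open>d\<close> is the positive distance of \<open>b\<close> from the closed span of the other
  basis vectors.\<close>

lemma heine_borel_coordinates:
  obtains B :: "'a::{real_normed_vector, heine_borel} set" and c
  where "finite B" "\<And>b. b \<in> B \<Longrightarrow> bounded_linear (c b)" "\<And>v. v = (\<Sum>b\<in>B. c b v *\<^sub>R b)"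
proof -
  obtain F :: "'a set" where F: "finite F" "span F = UNIV" by (rule heine_borel_finite_span)
  obtain B where B: "B \<subseteq> F" "independent B" "F \<subseteq> span B"
    using maximal_independent_subset by blast
  have fin: "finite B" using B(1) F(1) finite_subset by blast
  have sp: "span B = UNIV"
    using F(2) B(3) by (metis span_mono span_span top.extremum_unique)
  define c where "c = (\<lambda>b v. representation B v b)"
  have sum: "v = (\<Sum>b\<in>B. c b v *\<^sub>R b)" for v
    unfolding c_def using sum_representation_eq[OF B(2) _ fin subset_refl, of v] sp by simp
  have "bounded_linear (c b)" if b: "b \<in> B" for b
  proof -
    define d where "d = infdist b (span (B - {b}))"
    have "b \<notin> span (B - {b})" using B(2) b by (simp add: dependent_def)
    then have d: "d > 0"
      unfolding d_def using infdist_pos_not_in_closed[OF closed_span_finite[of "B - {b}"]] fin span_zero by blast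
    have "\<bar>c b v\<bar> * d \<le> norm v" for v
    proof -
      have "v = c b v *\<^sub>R b + (\<Sum>b'\<in>B - {b}. c b' v *\<^sub>R b')"
        using sum[of v] by (simp add: sum.remove[OF fin b])
      moreover have "(\<Sum>b'\<in>B - {b}. c b' v *\<^sub>R b') \<in> span (B - {b})"
        by (intro span_sum span_scale span_base)
      ultimately show ?thesis unfolding d_def using infdist_span_le by metis
    qed
    then have "norm (c b v) \<le> norm v * (1 / d)" for v
      using d by (simp add: field_simps)
    then show ?thesis
      by (intro bounded_linear_intro[where K = "1 / d"])
        (simp_all add: c_def sp representation_add[OF B(2)] representation_scale[OF B(2)])
  qed
  then show thesis using that[OF fin] sum by blast
qed


section \<open>Smooth maps from and to vector spaces\<close>

lemma smooth_manifoldD: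
  assumes "smooth_manifold M" "p \<in> mcarrier M"
  shows "openin (mtop M) (mdom M p)" "p \<in> mdom M p" "open (mchart M p ` mdom M p)"
    "homeomorphic_map (subtopology (mtop M) (mdom M p)) (top_of_set (mchart M p ` mdom M p)) (mchart M p)"
    "q \<in> mcarrier M \<Longrightarrow> smooth_on (mchart M p ` (mdom M p \<inter> mdom M q)) (mchart M q \<circ> mpar M p)"
  using assms unfolding smooth_manifold_def by auto

lemma mchart_mpar:
  assumes "y \<in> mchart M p ` mdom M p"
  shows "mchart M p (mpar M p y) = y" "mpar M p y \<in> mdom M p"
  using assms by (auto simp: mpar_def f_inv_into_f inv_into_into)

context
  fixes M :: "('a, 'e::real_normed_vector) manifold" and p :: 'a
  assumes M: "smooth_manifold M" and p: "p \<in> mcarrier M"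
begin

lemma mdom_subset: "mdom M p \<subseteq> mcarrier M"
  using openin_subset[OF smooth_manifoldD(1)[OF M p]] by (simp add: mcarrier_def)

lemma mpar_mchart: "x \<in> mdom M p \<Longrightarrow> mpar M p (mchart M p x) = x"
  using homeomorphic_imp_injective_map[OF smooth_manifoldD(4)[OF M p]] mdom_subset
  unfolding mpar_def mcarrier_def by (simp add: inf_absorb2 inv_into_f_f)

lemma continuous_map_mpar: "continuous_map (top_of_set (mchart M p ` mdom M p)) (mtop M) (mpar M p)"
proof -
  obtain g where g: "homeomorphic_maps (subtopology (mtop M) (mdom M p))
      (top_of_set (mchart M p ` mdom M p)) (mchart M p) g"
    using smooth_manifoldD(4)[OF M p] homeomorphic_map_maps by blast
  then have "continuous_map (top_of_set (mchart M p ` mdom M p)) (mtop M) g"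
    unfolding homeomorphic_maps_def continuous_map_in_subtopology by blast
  moreover have "g y = mpar M p y" if "y \<in> mchart M p ` mdom M p" for y
    using that g mpar_mchart mdom_subset unfolding homeomorphic_maps_def mcarrier_def by force
  ultimately show ?thesis by (auto intro: continuous_map_eq)
qed

lemma chart_image_eq: "mchart M p ` (W \<inter> mdom M p) = {y \<in> mchart M p ` mdom M p. mpar M p y \<in> W}"
  using mpar_mchart by auto

lemma open_chart_image:
  assumes "openin (mtop M) W"
  shows "open (mchart M p ` (W \<inter> mdom M p))"
  using openin_continuous_map_preimage[OF continuous_map_mpar assms] smooth_manifoldD(3)[OF M p]
  by (simp add: chart_image_eq openin_open_eq)

end

lemma vec_manifold_simps [simp]:
  "mtop vec_manifold = euclidean" "mdom vec_manifold x = UNIV" "mchart vec_manifold x = (\<lambda>y. y)"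
  "mcarrier vec_manifold = UNIV" "mpar vec_manifold x = (\<lambda>y. y)"
  by (auto simp: vec_manifold_def mcarrier_def mpar_def id_def[symmetric])

lemma mfderiv_into: "mfderiv vec_manifold M \<sigma> x = frechet_derivative (\<lambda>y. mchart M (\<sigma> x) (\<sigma> y)) (at x)"
  by (simp add: mfderiv_def o_def)

lemma mfderiv_out: "mfderiv M vec_manifold f p = frechet_derivative (\<lambda>y. f (mpar M p y)) (at (mchart M p p))"
  by (simp add: mfderiv_def o_def)

lemma smooth_map_into_iff:
  "smooth_map_on vec_manifold U M \<sigma> \<longleftrightarrow> open U \<and> continuous_map (top_of_set U) (mtop M) \<sigma> \<and>
     (\<forall>q\<in>mcarrier M. smooth_on {x \<in> U. \<sigma> x \<in> mdom M q} (\<lambda>x. mchart M q (\<sigma> x)))"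
proof -
  \<comment> \<open>For empty \<open>U\<close> the condition over the points of \<open>U\<close> in
    \<open>smooth_map_on\<close> is vacuous, so smoothness on the empty set has to be supplied
    separately.\<close>
  have "smooth_on {x \<in> U. \<sigma> x \<in> mdom M q} (\<lambda>x. mchart M q (\<sigma> x))" if "U = {}" for q
    using that smooth_on_subset[OF smooth_on_const[of UNIV], of "{}"]
      smooth_on_cong[of "{}" "\<lambda>x. mchart M q (\<sigma> x)" "\<lambda>x. 0"] by auto
  then show ?thesis
    unfolding smooth_map_on_def by (auto simp: o_def)
qed

lemma smooth_map_out_iff:
  "smooth_map_on M W vec_manifold f \<longleftrightarrow> openin (mtop M) W \<and> continuous_map (subtopology (mtop M) W) euclidean f \<and>
     (\<forall>p\<in>W. smooth_on (mchart M p ` (W \<inter> mdom M p)) (\<lambda>y. f (mpar M p y)))"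
  unfolding smooth_map_on_def by (auto simp: o_def Collect_conj_eq)

lemma smooth_map_into_subset:
  assumes "smooth_map_on vec_manifold U M \<sigma>" "open V" "V \<subseteq> U"
  shows "smooth_map_on vec_manifold V M \<sigma>"
  using assms continuous_map_from_subtopology_mono[OF _ assms(3), of euclidean "mtop M" \<sigma>]
  unfolding smooth_map_into_iff by (auto elim!: smooth_on_subset)

lemma open_preimage_into:
  assumes "smooth_map_on vec_manifold U M \<sigma>" "openin (mtop M) W"
  shows "open {x \<in> U. \<sigma> x \<in> W}"
  using assms openin_continuous_map_preimage[of "top_of_set U" "mtop M" \<sigma> W]
  unfolding smooth_map_into_iff by (auto simp: openin_open_eq)

lemma smooth_into_carrier:
  assumes "smooth_map_on vec_manifold U M \<sigma>" "x \<in> U"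
  shows "\<sigma> x \<in> mcarrier M"
  using assms continuous_map_image_subset_topspace[of "top_of_set U" "mtop M" \<sigma>]
  unfolding smooth_map_into_iff mcarrier_def by auto

context
  fixes M :: "('a, 'e::euclidean_space) manifold"
  assumes M: "smooth_manifold M"
begin

context
  fixes U :: "'u::real_normed_vector set" and \<sigma>
  assumes \<sigma>: "smooth_map_on vec_manifold U M \<sigma>"
begin

lemma smooth_into_chart:
  assumes "q \<in> mcarrier M"
  shows "open {x \<in> U. \<sigma> x \<in> mdom M q}" "smooth_on {x \<in> U. \<sigma> x \<in> mdom M q} (\<lambda>x. mchart M q (\<sigma> x))"
  using open_preimage_into[OF \<sigma> smooth_manifoldD(1)[OF M assms]] \<sigma> assms
  unfolding smooth_map_into_iff by auto

lemma has_derivative_into_chart: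
  assumes "q \<in> mcarrier M" "x \<in> U" "\<sigma> x \<in> mdom M q"
  shows "((\<lambda>x. mchart M q (\<sigma> x)) has_derivative frechet_derivative (\<lambda>x. mchart M q (\<sigma> x)) (at x)) (at x)"
  by (rule smooth_on_has_derivative[OF smooth_into_chart(2,1)[OF assms(1)]]) (use assms in simp)

lemma bounded_linear_mfderiv_into:
  assumes "x \<in> U"
  shows "bounded_linear (mfderiv vec_manifold M \<sigma> x)"
  unfolding mfderiv_into
  using has_derivative_bounded_linear[OF has_derivative_into_chart] assms
    smooth_into_carrier[OF \<sigma> assms] smooth_manifoldD(2)[OF M] by blast

text \<open>Tangent vectors at \<open>\<sigma> x\<close> are stored in the chart preferred by that
  point, which changes along \<open>\<sigma>\<close>. Differentiation in \<open>x\<close> needs one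
  fixed chart \<open>q\<close>; the transition map accounts for the difference.\<close>

lemma mfderiv_into_chart:
  assumes q: "q \<in> mcarrier M" and x: "x \<in> U" "\<sigma> x \<in> mdom M q"
  shows "mfderiv vec_manifold M \<sigma> x v =
    frechet_derivative (\<lambda>y. mchart M (\<sigma> x) (mpar M q y)) (at (mchart M q (\<sigma> x)))
      (frechet_derivative (\<lambda>y. mchart M q (\<sigma> y)) (at x) v)"
proof -
  have c: "\<sigma> x \<in> mcarrier M" using smooth_into_carrier[OF \<sigma> x(1)] .
  define T where "T = mchart M q ` (mdom M q \<inter> mdom M (\<sigma> x))"
  have T: "open T" "mchart M q (\<sigma> x) \<in> T"
    using open_chart_image[OF M q smooth_manifoldD(1)[OF M c]] x(2) smooth_manifoldD(2)[OF M c]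
    by (auto simp: T_def Int_commute)
  have d: "((\<lambda>y. mchart M (\<sigma> x) (mpar M q y)) has_derivative
     frechet_derivative (\<lambda>y. mchart M (\<sigma> x) (mpar M q y)) (at (mchart M q (\<sigma> x)))) (at (mchart M q (\<sigma> x)))"
    using smooth_on_has_derivative[OF smooth_manifoldD(5)[OF M q c] _ , of "mchart M q (\<sigma> x)"] T
    by (simp add: o_def T_def)
  have "frechet_derivative (\<lambda>y. mchart M (\<sigma> x) (\<sigma> y)) (at x)
    = frechet_derivative (\<lambda>y. mchart M (\<sigma> x) (mpar M q (mchart M q (\<sigma> y)))) (at x)"
    by (rule frechet_derivative_cong_open[OF smooth_into_chart(1)[OF q]])
      (use x mpar_mchart[OF M q] in auto)
  then show ?thesis
    unfolding mfderiv_into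
    using frechet_derivative_at[OF has_derivative_compose[OF has_derivative_into_chart[OF q x] d]] by metis
qed

lemma pullback1_into_chart:
  assumes q: "q \<in> mcarrier M" and x: "x \<in> U" "\<sigma> x \<in> mdom M q"
  shows "pullback1 vec_manifold M (mpar M q) \<alpha> (mchart M q (\<sigma> x)) (frechet_derivative (\<lambda>y. mchart M q (\<sigma> y)) (at x) v)
    = \<alpha> (\<sigma> x) (mfderiv vec_manifold M \<sigma> x v)"
  unfolding pullback1_def mfderiv_into_chart[OF q x] mfderiv_into[of M "mpar M q"]
  by (simp add: mpar_mchart[OF M q x(2)])

lemma smooth_out_into:
  assumes f: "smooth_map_on M W vec_manifold f" and W: "\<sigma> ` U \<subseteq> W" and U: "open U"
  shows "smooth_on U (\<lambda>x. f (\<sigma> x))"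
    and "x \<in> U \<Longrightarrow> frechet_derivative (\<lambda>x. f (\<sigma> x)) (at x) v = mfderiv M vec_manifold f (\<sigma> x) (mfderiv vec_manifold M \<sigma> x v)"
proof -
  note oW = f[unfolded smooth_map_out_iff, THEN conjunct1]
  have *: "open {y \<in> U. \<sigma> y \<in> mdom M (\<sigma> x)}" "x \<in> {y \<in> U. \<sigma> y \<in> mdom M (\<sigma> x)}"
      "\<And>y. y \<in> {y \<in> U. \<sigma> y \<in> mdom M (\<sigma> x)} \<Longrightarrow> f (mpar M (\<sigma> x) (mchart M (\<sigma> x) (\<sigma> y))) = f (\<sigma> y)"
      "open (mchart M (\<sigma> x) ` (W \<inter> mdom M (\<sigma> x)))"
      "smooth_on (mchart M (\<sigma> x) ` (W \<inter> mdom M (\<sigma> x))) (\<lambda>y. f (mpar M (\<sigma> x) y))"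
      "smooth_on {y \<in> U. \<sigma> y \<in> mdom M (\<sigma> x)} (\<lambda>y. mchart M (\<sigma> x) (\<sigma> y))"
      "\<And>y. y \<in> {y \<in> U. \<sigma> y \<in> mdom M (\<sigma> x)} \<Longrightarrow> mchart M (\<sigma> x) (\<sigma> y) \<in> mchart M (\<sigma> x) ` (W \<inter> mdom M (\<sigma> x))"
    if x: "x \<in> U" for x
  proof -
    have c: "\<sigma> x \<in> mcarrier M" using smooth_into_carrier[OF \<sigma> x] .
    show "open {y \<in> U. \<sigma> y \<in> mdom M (\<sigma> x)}" "smooth_on {y \<in> U. \<sigma> y \<in> mdom M (\<sigma> x)} (\<lambda>y. mchart M (\<sigma> x) (\<sigma> y))"
      using smooth_into_chart[OF c] by auto
    show "x \<in> {y \<in> U. \<sigma> y \<in> mdom M (\<sigma> x)}" using x smooth_manifoldD(2)[OF M c] by simp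
    show "f (mpar M (\<sigma> x) (mchart M (\<sigma> x) (\<sigma> y))) = f (\<sigma> y)" if "y \<in> {y \<in> U. \<sigma> y \<in> mdom M (\<sigma> x)}" for y
      using mpar_mchart[OF M c] that by simp
    show "open (mchart M (\<sigma> x) ` (W \<inter> mdom M (\<sigma> x)))" by (rule open_chart_image[OF M c oW])
    show "smooth_on (mchart M (\<sigma> x) ` (W \<inter> mdom M (\<sigma> x))) (\<lambda>y. f (mpar M (\<sigma> x) y))"
      using f x W unfolding smooth_map_out_iff by blast
    show "mchart M (\<sigma> x) (\<sigma> y) \<in> mchart M (\<sigma> x) ` (W \<inter> mdom M (\<sigma> x))" if "y \<in> {y \<in> U. \<sigma> y \<in> mdom M (\<sigma> x)}" for y
      using that W by auto
  qed
  show "smooth_on U (\<lambda>x. f (\<sigma> x))"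
  proof (rule smooth_on_local)
    fix x assume x: "x \<in> U"
    have "smooth_on {y \<in> U. \<sigma> y \<in> mdom M (\<sigma> x)} (\<lambda>y. f (mpar M (\<sigma> x) (mchart M (\<sigma> x) (\<sigma> y))))"
      by (rule smooth_on_compose[OF *(4)[OF x] *(1)[OF x] *(5)[OF x] *(6)[OF x] *(7)[OF x]])
    moreover have "smooth_on {y \<in> U. \<sigma> y \<in> mdom M (\<sigma> x)} (\<lambda>y. f (mpar M (\<sigma> x) (mchart M (\<sigma> x) (\<sigma> y))))
      \<longleftrightarrow> smooth_on {y \<in> U. \<sigma> y \<in> mdom M (\<sigma> x)} (\<lambda>y. f (\<sigma> y))"
      by (rule smooth_on_cong[OF *(1)[OF x] *(3)[OF x]])
    ultimately have "smooth_on {y \<in> U. \<sigma> y \<in> mdom M (\<sigma> x)} (\<lambda>y. f (\<sigma> y))" by simp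
    then show "\<exists>V. open V \<and> x \<in> V \<and> smooth_on V (\<lambda>x. f (\<sigma> x))"
      using *(1,2)[OF x] by blast
  qed
  show "frechet_derivative (\<lambda>x. f (\<sigma> x)) (at x) v = mfderiv M vec_manifold f (\<sigma> x) (mfderiv vec_manifold M \<sigma> x v)"
    if x: "x \<in> U"
  proof -
    have "frechet_derivative (\<lambda>x. f (\<sigma> x)) (at x)
      = frechet_derivative (\<lambda>y. f (mpar M (\<sigma> x) (mchart M (\<sigma> x) (\<sigma> y)))) (at x)"
      by (rule frechet_derivative_cong_open[OF *(1,2)[OF x]]) (simp add: *(3)[OF x])
    also have "\<dots> = (\<lambda>v. frechet_derivative (\<lambda>y. f (mpar M (\<sigma> x) y)) (at (mchart M (\<sigma> x) (\<sigma> x)))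
       (frechet_derivative (\<lambda>y. mchart M (\<sigma> x) (\<sigma> y)) (at x) v))"
      by (rule frechet_derivative_at[symmetric], rule has_derivative_compose[OF
          smooth_on_has_derivative[OF *(6,1,2)[OF x]] smooth_on_has_derivative[OF *(5,4)[OF x] *(7)[OF x *(2)[OF x]]]])
    finally show ?thesis by (simp add: mfderiv_into mfderiv_out)
  qed
qed

end

lemma smooth_into_compose:
  fixes U :: "'u::euclidean_space set" and k :: "'v::real_normed_vector \<Rightarrow> 'u"
  assumes \<sigma>: "smooth_map_on vec_manifold U M \<sigma>" and V: "open V" and k: "smooth_on V k" "k ` V \<subseteq> U"
  shows "smooth_map_on vec_manifold V M (\<lambda>x. \<sigma> (k x))"
    and "x \<in> V \<Longrightarrow> mfderiv vec_manifold M (\<lambda>x. \<sigma> (k x)) x v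
      = mfderiv vec_manifold M \<sigma> (k x) (frechet_derivative k (at x) v)"
proof -
  have "continuous_map (top_of_set V) (mtop M) (\<sigma> \<circ> k)"
  proof (rule continuous_map_compose)
    show "continuous_map (top_of_set V) (top_of_set U) k"
      using smooth_on_imp_continuous_on[OF k(1)] k(2) by (auto simp: continuous_map_in_subtopology)
    show "continuous_map (top_of_set U) (mtop M) \<sigma>" using \<sigma> unfolding smooth_map_into_iff by blast
  qed
  moreover have "smooth_on {x \<in> V. \<sigma> (k x) \<in> mdom M q} (\<lambda>x. mchart M q (\<sigma> (k x)))" if q: "q \<in> mcarrier M" for q
  proof -
    have "{x \<in> V. \<sigma> (k x) \<in> mdom M q} = V \<inter> k -` {x \<in> U. \<sigma> x \<in> mdom M q}" using k(2) by auto
    then have "open {x \<in> V. \<sigma> (k x) \<in> mdom M q}"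
      using continuous_open_preimage[OF smooth_on_imp_continuous_on[OF k(1)] V smooth_into_chart(1)[OF \<sigma> q]] by simp
    then show ?thesis
      by (rule smooth_on_compose[OF smooth_into_chart(1)[OF \<sigma> q] _ smooth_into_chart(2)[OF \<sigma> q]])
        (use k in \<open>auto intro: smooth_on_subset\<close>)
  qed
  ultimately show "smooth_map_on vec_manifold V M (\<lambda>x. \<sigma> (k x))"
    using V unfolding smooth_map_into_iff by (simp add: o_def)
  show "mfderiv vec_manifold M (\<lambda>x. \<sigma> (k x)) x v
      = mfderiv vec_manifold M \<sigma> (k x) (frechet_derivative k (at x) v)" if x: "x \<in> V"
  proof -
    have "k x \<in> U" using x k(2) by auto
    then have c: "\<sigma> (k x) \<in> mcarrier M" using smooth_into_carrier[OF \<sigma>] by blast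
    show ?thesis
      unfolding mfderiv_into
      using frechet_derivative_at[OF has_derivative_compose[OF smooth_on_has_derivative[OF k(1) V x]
         has_derivative_into_chart[OF \<sigma> c \<open>k x \<in> U\<close> smooth_manifoldD(2)[OF M c]]]] by metis
  qed
qed

lemma smooth_out_compose:
  fixes f :: "'a \<Rightarrow> 'q::euclidean_space" and h :: "'q \<Rightarrow> 'r::real_normed_vector"
  assumes f: "smooth_map_on M W vec_manifold f" and N: "open N" and h: "smooth_on N h"
  shows "smooth_map_on M {x \<in> W. f x \<in> N} vec_manifold (\<lambda>x. h (f x))"
    and "x \<in> W \<Longrightarrow> f x \<in> N \<Longrightarrow> mfderiv M vec_manifold (\<lambda>x. h (f x)) x v
      = frechet_derivative h (at (f x)) (mfderiv M vec_manifold f x v)"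
proof -
  note f' = f[unfolded smooth_map_out_iff]
  have oW: "openin (mtop M) W" using f' by blast
  have "openin (subtopology (mtop M) W) {x \<in> topspace (subtopology (mtop M) W). f x \<in> N}"
    using f' N by (intro openin_continuous_map_preimage[of _ euclidean]) auto
  moreover have "{x \<in> topspace (subtopology (mtop M) W). f x \<in> N} = {x \<in> W. f x \<in> N}"
    using openin_subset[OF oW] by auto
  ultimately have o: "openin (mtop M) {x \<in> W. f x \<in> N}"
    using openin_open_subtopology[OF oW] by auto
  have "continuous_map (subtopology (mtop M) {x \<in> W. f x \<in> N}) euclidean (h \<circ> f)"
  proof (rule continuous_map_compose)
    show "continuous_map (subtopology (mtop M) {x \<in> W. f x \<in> N}) (top_of_set N) f"
      using continuous_map_from_subtopology_mono[of "mtop M" W euclidean f "{x \<in> W. f x \<in> N}"] f'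
      by (auto simp: continuous_map_in_subtopology)
    show "continuous_map (top_of_set N) euclidean h" using smooth_on_imp_continuous_on[OF h] by simp
  qed
  moreover have "smooth_on (mchart M p ` ({x \<in> W. f x \<in> N} \<inter> mdom M p)) (\<lambda>y. h (f (mpar M p y)))"
    if "p \<in> {x \<in> W. f x \<in> N}" for p
  proof -
    have c: "p \<in> mcarrier M" using that openin_subset[OF oW] by (auto simp: mcarrier_def)
    have "smooth_on (mchart M p ` ({x \<in> W. f x \<in> N} \<inter> mdom M p)) (\<lambda>y. f (mpar M p y))"
      using f' that by (auto intro: smooth_on_subset)
    then show ?thesis
      by (rule smooth_on_compose[OF N open_chart_image[OF M c o] h]) (auto simp: mpar_mchart[OF M c])
  qed
  ultimately show "smooth_map_on M {x \<in> W. f x \<in> N} vec_manifold (\<lambda>x. h (f x))"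
    using o unfolding smooth_map_out_iff by (simp add: o_def)
  show "mfderiv M vec_manifold (\<lambda>x. h (f x)) x v
      = frechet_derivative h (at (f x)) (mfderiv M vec_manifold f x v)" if x: "x \<in> W" "f x \<in> N"
  proof -
    have c: "x \<in> mcarrier M" using x openin_subset[OF oW] by (auto simp: mcarrier_def)
    have m: "mpar M x (mchart M x x) = x" using mpar_mchart[OF M c] smooth_manifoldD(2)[OF M c] by simp
    have "((\<lambda>y. f (mpar M x y)) has_derivative frechet_derivative (\<lambda>y. f (mpar M x y)) (at (mchart M x x))) (at (mchart M x x))"
      by (rule smooth_on_has_derivative[of "mchart M x ` (W \<inter> mdom M x)"])
        (use f' x open_chart_image[OF M c oW] smooth_manifoldD(2)[OF M c] in auto)
    from has_derivative_compose[OF this] have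
     "((\<lambda>y. h (f (mpar M x y))) has_derivative (\<lambda>v. frechet_derivative h (at (f x)) (frechet_derivative (\<lambda>y. f (mpar M x y)) (at (mchart M x x)) v))) (at (mchart M x x))"
      using smooth_on_has_derivative[OF h N x(2)] m by simp
    then show ?thesis unfolding mfderiv_out using frechet_derivative_at by metis
  qed
qed

lemma bounded_linear_mfderiv_out:
  assumes f: "smooth_map_on M W vec_manifold f" and x: "x \<in> W"
  shows "bounded_linear (mfderiv M vec_manifold f x)"
proof -
  note f' = f[unfolded smooth_map_out_iff]
  have c: "x \<in> mcarrier M" using x f' openin_subset by (force simp: mcarrier_def)
  have "((\<lambda>y. f (mpar M x y)) has_derivative frechet_derivative (\<lambda>y. f (mpar M x y)) (at (mchart M x x))) (at (mchart M x x))"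
    by (rule smooth_on_has_derivative[of "mchart M x ` (W \<inter> mdom M x)"])
      (use f' x open_chart_image[OF M c] smooth_manifoldD(2)[OF M c] in auto)
  then show ?thesis unfolding mfderiv_out by (rule has_derivative_bounded_linear)
qed

text \<open>Tangent vectors of \<open>Z\<close> are velocities of curves by definition, so
  \<open>v\<close> is turned into the image under \<open>\<sigma>\<close> of the straight line
  through \<open>x\<close>, cut down to an interval on which it stays in \<open>U\<close>.\<close>

lemma mfderiv_in_tangent_set:
  fixes U :: "'u::euclidean_space set"
  assumes \<sigma>: "smooth_map_on vec_manifold U M \<sigma>" "\<sigma> ` U \<subseteq> Z" and x: "x \<in> U"
  shows "mfderiv vec_manifold M \<sigma> x v \<in> tangent_set M Z (\<sigma> x)"
proof -
  have U: "open U" using \<sigma> by (simp add: smooth_map_into_iff)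
  define k where "k = (\<lambda>t::real. x + t *\<^sub>R v)"
  have k: "smooth_on UNIV k"
    unfolding k_def using smooth_on_add[OF open_UNIV smooth_on_const smooth_on_scaleR[OF open_UNIV smooth_on_ident[OF open_UNIV] smooth_on_const]] .
  have dk: "frechet_derivative k (at 0) 1 = v"
  proof -
    have "(k has_derivative (\<lambda>r. r *\<^sub>R v)) (at 0)"
      unfolding k_def by (auto intro!: derivative_eq_intros)
    then show ?thesis using frechet_derivative_at by (metis scaleR_one)
  qed
  have "open (k -` U)"
    using open_vimage[OF U] smooth_on_imp_continuous_on[OF k] by simp
  moreover have "0 \<in> k -` U" using x by (simp add: k_def)
  ultimately obtain e where e: "e > 0" "ball 0 e \<subseteq> k -` U" by (rule openE)
  have ball: "ball 0 e = {-e<..<e}" for e :: real by (auto simp: dist_real_def)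
  have kU: "k ` {-e<..<e} \<subseteq> U" using e(2) unfolding ball by auto
  have ks: "smooth_on {-e<..<e} k" using k smooth_on_subset by blast
  note c = smooth_into_compose[OF \<sigma>(1) open_greaterThanLessThan ks kU]
  have "mfderiv vec_manifold M (\<lambda>t. \<sigma> (k t)) 0 1 = mfderiv vec_manifold M \<sigma> x v"
    using c(2)[of 0 1] e(1) dk by (simp add: k_def)
  then show ?thesis
    unfolding tangent_set_def using e(1) c(1) kU \<sigma>(2)
    by (intro CollectI exI[of _ "\<lambda>t. \<sigma> (k t)"] exI[of _ e]) (auto simp: k_def)
qed

end

text \<open>A smooth parametrization of part of \<open>Z\<close> that splits the inclusion of the tangent space. It
  replaces the choice of slice coordinates on a submanifold \<open>Z\<close>.\<close>

definition parametrized_at :: "('a, 'e::real_normed_vector) manifold \<Rightarrow> 'a set \<Rightarrow> 'a \<Rightarrow> bool" where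
  "parametrized_at M Z z \<longleftrightarrow>
     (\<exists>U \<Psi>. (0::'e) \<in> U \<and> smooth_map_on vec_manifold U M \<Psi> \<and> \<Psi> ` U \<subseteq> Z \<and> \<Psi> 0 = z \<and>
        (\<forall>v\<in>tangent_set M Z z. mfderiv vec_manifold M \<Psi> 0 v = v))"

text \<open>The derivative at 0 produces velocities of curves in \<open>Z\<close>, and it reaches
  all of them because it fixes them. Hence the tangent set, a mere set of velocities, is the image
  of a linear map. Restricting to the preimage of \<open>W\<close> changes nothing at 0.\<close>

lemma parametrized_atE:
  fixes M :: "('a, 'e::euclidean_space) manifold"
  assumes M: "smooth_manifold M" and "parametrized_at M Z z" and W: "openin (mtop M) W" "z \<in> W"
  obtains U :: "'e set" and \<Psi> where "open U" "0 \<in> U" "smooth_map_on vec_manifold U M \<Psi>" "\<Psi> ` U \<subseteq> Z \<inter> W" "\<Psi> 0 = z"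
    "\<And>v. v \<in> tangent_set M Z z \<Longrightarrow> mfderiv vec_manifold M \<Psi> 0 v = v"
    "range (mfderiv vec_manifold M \<Psi> 0) = tangent_set M Z z"
proof -
  obtain U \<Psi> where U: "(0::'e) \<in> U" "smooth_map_on vec_manifold U M \<Psi>" "\<Psi> ` U \<subseteq> Z" "\<Psi> 0 = z"
    "\<And>v. v \<in> tangent_set M Z z \<Longrightarrow> mfderiv vec_manifold M \<Psi> 0 v = v"
    using assms(2) unfolding parametrized_at_def by blast
  have o: "open {x \<in> U. \<Psi> x \<in> W}" by (rule open_preimage_into[OF U(2) W(1)])
  have s: "smooth_map_on vec_manifold {x \<in> U. \<Psi> x \<in> W} M \<Psi>"
    by (rule smooth_map_into_subset[OF U(2) o]) auto
  have "mfderiv vec_manifold M \<Psi> 0 v \<in> tangent_set M Z z" for v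
    using mfderiv_in_tangent_set[OF M U(2,3,1)] U(4) by simp
  then have "range (mfderiv vec_manifold M \<Psi> 0) = tangent_set M Z z"
    using U(5) by (auto simp: image_iff) metis
  then show thesis
    using that[OF o _ s _ U(4,5)] U W by auto
qed

lemma subspace_tangent_set:
  fixes M :: "('a, 'e::euclidean_space) manifold"
  assumes M: "smooth_manifold M" and z: "parametrized_at M Z z" "z \<in> mcarrier M"
  shows "subspace (tangent_set M Z z)"
proof -
  obtain U :: "'e set" and \<Psi> where U: "0 \<in> U" "smooth_map_on vec_manifold U M \<Psi>"
    "range (mfderiv vec_manifold M \<Psi> 0) = tangent_set M Z z"
    by (rule parametrized_atE[OF M z(1) openin_topspace]) (use z(2) in \<open>auto simp: mcarrier_def\<close>)
  then show ?thesis
    using linear_subspace_image[OF bounded_linear.linear[OF bounded_linear_mfderiv_into[OF M U(2,1)]] subspace_UNIV]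
    by simp
qed


section \<open>Comparison of quotient orbifolds\<close>

lemma difference_quotient_tendsto:
  assumes f: "(f has_derivative f') (at u)" and v: "v \<noteq> 0"
    and t: "t \<longlonglongrightarrow> 0" "\<And>n. t n > (0::real)"
  shows "(\<lambda>n. (f (u + t n *\<^sub>R v) - f u) /\<^sub>R t n) \<longlonglongrightarrow> f' v"
proof -
  have lin: "linear f'" using f has_derivative_linear by blast
  have "(\<lambda>n. u + t n *\<^sub>R v) \<longlonglongrightarrow> u + 0 *\<^sub>R v" by (intro tendsto_intros t)
  then have "filterlim (\<lambda>n. u + t n *\<^sub>R v) (at u) sequentially"
    unfolding filterlim_at using t(2) v by (auto simp: less_imp_neq[THEN not_sym])
  from filterlim_compose[OF _ this, of "\<lambda>y. norm (f y - f u - f' (y - u)) / norm (y - u)" "nhds 0"]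
  have "(\<lambda>n. norm (f (u + t n *\<^sub>R v) - f u - f' (t n *\<^sub>R v)) / norm (t n *\<^sub>R v)) \<longlonglongrightarrow> 0"
    using f unfolding has_derivative_iff_norm by simp
  from tendsto_mult_right[OF this, of "norm v"]
  have "(\<lambda>n. norm (f (u + t n *\<^sub>R v) - f u - f' (t n *\<^sub>R v)) / norm (t n *\<^sub>R v) * norm v) \<longlonglongrightarrow> 0" by simp
  moreover have "norm (f (u + t n *\<^sub>R v) - f u - f' (t n *\<^sub>R v)) / norm (t n *\<^sub>R v) * norm v
     = norm ((f (u + t n *\<^sub>R v) - f u) /\<^sub>R t n - f' v)" for n
  proof -
    have e: "(f (u + t n *\<^sub>R v) - f u) /\<^sub>R t n - f' v = (f (u + t n *\<^sub>R v) - f u - f' (t n *\<^sub>R v)) /\<^sub>R t n"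
      using t(2)[of n] by (simp add: linear_cmul[OF lin] scaleR_diff_right)
    show ?thesis unfolding e using t(2)[of n] v by (simp add: divide_inverse)
  qed
  ultimately show ?thesis by (simp add: tendsto_norm_zero_iff LIM_zero_iff)
qed

text \<open>Along any line through \<open>u\<close> some group element agrees with \<open>k\<close> at a sequence
  tending to \<open>u\<close>, so the two have the same derivative in that direction.\<close>

lemma derivative_inj_of_finite_group:
  assumes D: "open D" and fin: "finite \<Gamma>" and grp: "subgroup \<Gamma> (BijGroup D)"
    and smooth: "\<And>\<gamma>. \<gamma> \<in> \<Gamma> \<Longrightarrow> smooth_on D \<gamma>"
    and N: "open N" "u \<in> N" "N \<subseteq> D" and k: "(k has_derivative k') (at u)" "k u = u"
    and orb: "\<And>y. y \<in> N \<Longrightarrow> \<exists>\<gamma>\<in>\<Gamma>. \<gamma> y = k y"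
  shows "inj k'"
proof -
  have uD: "u \<in> D" using N by blast
  have "v = 0" if v: "k' v = 0" for v
  proof (rule ccontr)
    assume nz: "v \<noteq> 0"
    define t where "t = (\<lambda>n. 1 / real (Suc n))"
    have t0: "t \<longlonglongrightarrow> 0" and tp: "\<And>n. t n > 0"
      unfolding t_def using LIMSEQ_Suc[OF lim_1_over_n] by auto
    have "(\<lambda>n. u + t n *\<^sub>R v) \<longlonglongrightarrow> u + 0 *\<^sub>R v" by (intro tendsto_intros t0)
    then have "\<forall>\<^sub>F n in sequentially. u + t n *\<^sub>R v \<in> N"
      using N(1,2) by (simp add: topological_tendstoD)
    then obtain n0 where n0: "\<And>n. n \<ge> n0 \<Longrightarrow> u + t n *\<^sub>R v \<in> N"
      by (auto simp: eventually_sequentially)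
    have "\<exists>\<gamma>\<in>\<Gamma>. infinite {n \<in> {n0..}. \<gamma> (u + t n *\<^sub>R v) = k (u + t n *\<^sub>R v)}"
      using pigeonhole_infinite_rel[OF _ fin, of "{n0..}" "\<lambda>n \<gamma>. \<gamma> (u + t n *\<^sub>R v) = k (u + t n *\<^sub>R v)"]
        orb n0 infinite_Ici by auto
    then obtain \<gamma> where \<gamma>: "\<gamma> \<in> \<Gamma>" and "infinite {n \<in> {n0..}. \<gamma> (u + t n *\<^sub>R v) = k (u + t n *\<^sub>R v)}" by blast
    from infinite_enumerate[OF this(2)]
    obtain r :: "nat \<Rightarrow> nat" where r: "strict_mono r" "\<And>n. \<gamma> (u + t (r n) *\<^sub>R v) = k (u + t (r n) *\<^sub>R v)"
      by auto
    have s0: "(\<lambda>n. t (r n)) \<longlonglongrightarrow> 0" using LIMSEQ_subseq_LIMSEQ[OF t0 r(1)] by (simp add: o_def)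
    note d\<gamma> = smooth_on_has_derivative[OF smooth[OF \<gamma>] D uD]
    have y: "(\<lambda>n. u + t (r n) *\<^sub>R v) \<longlonglongrightarrow> u"
      using tendsto_add[OF tendsto_const tendsto_scaleR[OF s0 tendsto_const]] by simp
    have "(\<lambda>n. \<gamma> (u + t (r n) *\<^sub>R v)) \<longlonglongrightarrow> \<gamma> u"
      using isCont_tendsto_compose[OF has_derivative_continuous[OF d\<gamma>] y] .
    moreover have "(\<lambda>n. \<gamma> (u + t (r n) *\<^sub>R v)) \<longlonglongrightarrow> k u"
      using isCont_tendsto_compose[OF has_derivative_continuous[OF k(1)] y] by (simp add: r(2))
    ultimately have \<gamma>u: "\<gamma> u = u" using k(2) LIMSEQ_unique by metis
    have d0: "frechet_derivative \<gamma> (at u) v = 0"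
      using difference_quotient_tendsto[OF d\<gamma> nz s0 tp] difference_quotient_tendsto[OF k(1) nz s0 tp]
        LIMSEQ_unique v by (simp add: r(2) \<gamma>u k(2))
    \<comment> \<open>The inverse of \<open>\<gamma>\<close> in the group is smooth as well, so the
      chain rule makes the derivative of \<open>\<gamma>\<close> at \<open>u\<close> injective,
      contrary to \<open>d0\<close>.\<close>
    obtain \<delta> where \<delta>: "\<delta> \<in> \<Gamma>" "\<And>y. y \<in> D \<Longrightarrow> \<delta> (\<gamma> y) = y"
    proof
      have g: "\<gamma> \<in> Bij D" using subgroup.subset[OF grp] \<gamma> by (auto simp: BijGroup_def)
      show "restrict (inv_into D \<gamma>) D \<in> \<Gamma>"
        using subgroup.m_inv_closed[OF grp \<gamma>] inv_BijGroup[OF g] by simp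
      show "restrict (inv_into D \<gamma>) D (\<gamma> y) = y" if "y \<in> D" for y
        using that g by (auto simp: Bij_def bij_betw_def)
    qed
    have "((\<lambda>y. \<delta> (\<gamma> y)) has_derivative (\<lambda>v. frechet_derivative \<delta> (at (\<gamma> u)) (frechet_derivative \<gamma> (at u) v))) (at u)"
      using has_derivative_compose[OF d\<gamma>, of \<delta>] smooth_on_has_derivative[OF smooth[OF \<delta>(1)] D] uD \<gamma>u by simp
    moreover have "((\<lambda>y. \<delta> (\<gamma> y)) has_derivative (\<lambda>v. v)) (at u)"
      by (rule has_derivative_transform_within_open[OF has_derivative_ident D uD]) (simp add: \<delta>(2))
    ultimately have "frechet_derivative \<delta> (at (\<gamma> u)) (frechet_derivative \<gamma> (at u) v) = v"
      using has_derivative_unique by metis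
    then show False
      using d0 nz \<gamma>u linear_0[OF has_derivative_linear[OF smooth_on_has_derivative[OF smooth[OF \<delta>(1)] D uD]]] by simp
  qed
  then show ?thesis
    using linear_injective_0[OF has_derivative_linear[OF k(1)]] by blast
qed

text \<open>In the parametrization \<open>f\<close> becomes a map \<open>\<phi>\<close> of vector
  spaces with surjective derivative \<open>L\<close> at 0. Composing \<open>\<phi>\<close> with an
  affine map whose linear part is a right inverse \<open>R\<close> of \<open>L\<close> gives a map
  \<open>k\<close> with derivative the identity, and inverting \<open>k\<close> gives the
  section.\<close>

lemma local_section:
  fixes M :: "('a, 'e::euclidean_space) manifold" and f :: "'a \<Rightarrow> 'p::euclidean_space"
  assumes M: "smooth_manifold M" and f: "smooth_map_on M W vec_manifold f" and z: "z \<in> W"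
    and par: "parametrized_at M Z z" and surj: "mfderiv M vec_manifold f z ` tangent_set M Z z = UNIV"
    and W': "openin (mtop M) W'" "z \<in> W'"
  obtains N s where "open N" "f z \<in> N" "smooth_map_on vec_manifold N M s" "s ` N \<subseteq> Z \<inter> W \<inter> W'"
    "s (f z) = z" "\<And>y. y \<in> N \<Longrightarrow> f (s y) = y"
proof -
  have oWW': "openin (mtop M) (W \<inter> W')" using f W' by (simp add: smooth_map_out_iff openin_Int)
  obtain U :: "'e set" and \<Psi> where U: "open U" "0 \<in> U" "smooth_map_on vec_manifold U M \<Psi>"
    "\<Psi> ` U \<subseteq> Z \<inter> (W \<inter> W')" "\<Psi> 0 = z"
    and rng: "range (mfderiv vec_manifold M \<Psi> 0) = tangent_set M Z z"
    by (rule parametrized_atE[OF M par oWW']) (use z W'(2) in auto)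
  define \<phi> where "\<phi> = (\<lambda>x. f (\<Psi> x))"
  define L where "L = frechet_derivative \<phi> (at 0)"
  have \<Psi>W: "\<Psi> ` U \<subseteq> W" using U(4) by blast
  note so = smooth_out_into[OF M U(3) f \<Psi>W U(1)]
  have s\<phi>: "smooth_on U \<phi>" unfolding \<phi>_def by (rule so(1))
  have L: "L v = mfderiv M vec_manifold f z (mfderiv vec_manifold M \<Psi> 0 v)" for v
    using so(2)[OF U(2)] U(5) by (simp add: L_def \<phi>_def)
  note dL = smooth_on_has_derivative[OF s\<phi> U(1,2), folded L_def]
  have "surj L" unfolding L surj_def using surj rng by (metis UNIV_I imageE)
  then obtain R where R: "linear R" "L \<circ> R = id"
    using linear_surjective_right_inverse[OF has_derivative_linear[OF dL]] by blast
  have bR: "bounded_linear R" using R(1) linear_conv_bounded_linear by blast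
  \<comment> \<open>This is \<open>R (y - f z)\<close>, so \<open>f z\<close> goes to the origin of
    the parametrization.\<close>
  define a where "a = (\<lambda>y. - R (f z) + R y)"
  define N0 where "N0 = {y. a y \<in> U}"
  have a: "smooth_on UNIV a"
    unfolding a_def by (intro smooth_on_add smooth_on_const smooth_on_bounded_linear[OF _ bR] smooth_on_ident open_UNIV)
  have da: "(a has_derivative R) (at y)" for y
    unfolding a_def using bounded_linear_imp_has_derivative[OF bR] by (auto intro!: derivative_eq_intros)
  have N0: "open N0"
    using open_vimage[OF U(1), of a] smooth_on_imp_continuous_on[OF a] by (simp add: N0_def vimage_def)
  have az: "a (f z) = 0" by (simp add: a_def)
  have uN0: "f z \<in> N0" using U(2) az by (simp add: N0_def)
  define k where "k = (\<lambda>y. \<phi> (a y))"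
  have sk: "smooth_on N0 k"
    unfolding k_def by (rule smooth_on_compose[OF U(1) N0 s\<phi> smooth_on_subset[OF a]]) (auto simp: N0_def)
  have kz: "k (f z) = f z" using az U(5) by (simp add: k_def \<phi>_def)
  have "(k has_derivative (\<lambda>v. L (R v))) (at (f z))"
    unfolding k_def by (rule has_derivative_compose[OF da]) (simp add: az dL)
  then have dk: "frechet_derivative k (at (f z)) v = v" for v
    using R(2) frechet_derivative_at by (metis comp_apply id_apply)
  from smooth_inverse_function[OF N0 sk uN0 dk]
  obtain U' V g where V: "U' \<subseteq> N0" "f z \<in> U'" "open V" "homeomorphism U' V k g" "smooth_on V g"
    by metis
  have h: "f z \<in> V" "g (f z) = f z" "\<And>y. y \<in> V \<Longrightarrow> g y \<in> N0" "\<And>y. y \<in> V \<Longrightarrow> k (g y) = y"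
    using V(1,2) kz homeomorphism_image1[OF V(4)] homeomorphism_image2[OF V(4)]
      homeomorphism_apply1[OF V(4)] homeomorphism_apply2[OF V(4)] by (metis image_eqI, metis, blast, blast)
  have sag: "smooth_on V (\<lambda>y. a (g y))"
    by (rule smooth_on_compose[OF open_UNIV V(3) a V(5)]) simp
  have agU: "(\<lambda>y. a (g y)) ` V \<subseteq> U" using h(3) by (auto simp: N0_def)
  show thesis
  proof (rule that[OF V(3) h(1)])
    show "smooth_map_on vec_manifold V M (\<lambda>y. \<Psi> (a (g y)))"
      by (rule smooth_into_compose(1)[OF M U(3) V(3) sag agU])
    show "(\<lambda>y. \<Psi> (a (g y))) ` V \<subseteq> Z \<inter> W \<inter> W'" using agU U(4) by blast
    show "\<Psi> (a (g (f z))) = z" by (simp add: h(2) az U(5))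
    show "f (\<Psi> (a (g y))) = y" if "y \<in> V" for y
      using h(4)[OF that] by (simp add: k_def \<phi>_def)
  qed
qed

section \<open>Orbifold charts of an orbit space\<close>

text \<open>What remains of \<open>quotient_orbifold\<close> without the topology and the transition
  maps; that each chart point lies over an orbit in \<open>Z\<close>, formerly a consequence of the
  topology, is now explicit. These data already determine the transition maps, so they can be
  verified for the cone before it is known to be an orbifold.\<close>

definition quotient_charts ::
  "('a, 'e::real_normed_vector) manifold \<Rightarrow> 'a set \<Rightarrow> 'g monoid \<Rightarrow> ('g \<Rightarrow> 'a \<Rightarrow> 'a) \<Rightarrow>
   ('i, 'a set, 'q::real_normed_vector) orbifold \<Rightarrow> bool" where
  "quotient_charts M Z K act X \<longleftrightarrow>
     (\<forall>i\<in>oidx X.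
        open (odom X i) \<and> finite (ogrp X i) \<and> subgroup (ogrp X i) (BijGroup (odom X i)) \<and>
        (\<forall>\<gamma>\<in>ogrp X i. smooth_on (odom X i) \<gamma>) \<and>
        (\<forall>u\<in>odom X i. \<forall>u'\<in>odom X i.
           omap X i u = omap X i u' \<longleftrightarrow> (\<exists>\<gamma>\<in>ogrp X i. \<gamma> u = u'))) \<and>
     (\<forall>i\<in>oidx X. \<forall>u\<in>odom X i. \<exists>z\<in>Z. omap X i u = orbit K act z) \<and>
     (\<forall>z\<in>Z. \<forall>i\<in>oidx X. \<forall>u\<in>odom X i. omap X i u = orbit K act z \<longrightarrow>
        (\<exists>W f. local_projection M Z K act X i z W f \<and> f z = u \<and>
               mfderiv M vec_manifold f z ` tangent_set M Z z = UNIV))"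

lemma quotient_chartsD:
  assumes "quotient_charts M Z K act X" "i \<in> oidx X"
  shows "open (odom X i)" "finite (ogrp X i)" "subgroup (ogrp X i) (BijGroup (odom X i))"
    "\<gamma> \<in> ogrp X i \<Longrightarrow> smooth_on (odom X i) \<gamma>"
    "u \<in> odom X i \<Longrightarrow> u' \<in> odom X i \<Longrightarrow> omap X i u = omap X i u' \<Longrightarrow> \<exists>\<gamma>\<in>ogrp X i. \<gamma> u = u'"
    "u \<in> odom X i \<Longrightarrow> \<exists>z\<in>Z. omap X i u = orbit K act z"
    "u \<in> odom X i \<Longrightarrow> z \<in> Z \<Longrightarrow> omap X i u = orbit K act z \<Longrightarrow>
       \<exists>W f. local_projection M Z K act X i z W f \<and> f z = u \<and>
         mfderiv M vec_manifold f z ` tangent_set M Z z = UNIV"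
  using assms unfolding quotient_charts_def by simp_all

lemma orbit_space_openin:
  "openin (orbit_space T K act) U \<longleftrightarrow>
     U \<subseteq> orbits K (topspace T) act \<and> openin T {x \<in> topspace T. orbit K act x \<in> U}"
proof -
  have "istopology (\<lambda>U. U \<subseteq> orbits K (topspace T) act \<and> openin T {x \<in> topspace T. orbit K act x \<in> U})"
    unfolding istopology_def
  proof (intro conjI allI impI)
    fix \<U> assume *: "\<forall>U\<in>\<U>. U \<subseteq> orbits K (topspace T) act \<and> openin T {x \<in> topspace T. orbit K act x \<in> U}"
    have "{x \<in> topspace T. orbit K act x \<in> \<Union>\<U>} = (\<Union>U\<in>\<U>. {x \<in> topspace T. orbit K act x \<in> U})" by auto
    then show "openin T {x \<in> topspace T. orbit K act x \<in> \<Union>\<U>}" using * by auto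
  next
    fix U V assume U: "U \<subseteq> orbits K (topspace T) act \<and> openin T {x \<in> topspace T. orbit K act x \<in> U}"
      and V: "V \<subseteq> orbits K (topspace T) act \<and> openin T {x \<in> topspace T. orbit K act x \<in> V}"
    have "{x \<in> topspace T. orbit K act x \<in> U \<inter> V} =
      {x \<in> topspace T. orbit K act x \<in> U} \<inter> {x \<in> topspace T. orbit K act x \<in> V}" by auto
    then show "openin T {x \<in> topspace T. orbit K act x \<in> U \<inter> V}" using U V by auto
  qed auto
  then show ?thesis unfolding orbit_space_def by (simp add: topology_inverse')
qed

lemma topspace_orbit_space: "topspace (orbit_space T K act) = orbits K (topspace T) act"
proof (rule antisym)
  show "topspace (orbit_space T K act) \<subseteq> orbits K (topspace T) act"
    using openin_topspace[of "orbit_space T K act"] unfolding orbit_space_openin by blast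
  have "{x \<in> topspace T. orbit K act x \<in> orbits K (topspace T) act} = topspace T"
    by (auto simp: orbits_def)
  then have "openin (orbit_space T K act) (orbits K (topspace T) act)"
    by (simp add: orbit_space_openin)
  then show "orbits K (topspace T) act \<subseteq> topspace (orbit_space T K act)" by (rule openin_subset)
qed

lemma quotient_map_orbit: "quotient_map T (orbit_space T K act) (orbit K act)"
  unfolding quotient_map_def topspace_orbit_space
  by (auto simp: orbit_space_openin orbits_def)

lemma quotient_orbifold_imp_charts:
  assumes "quotient_orbifold M Z K act X" "Z \<subseteq> mcarrier M"
  shows "quotient_charts M Z K act X"
proof -
  have X: "orbifold_structure X" using assms(1) by (simp add: quotient_orbifold_def)
  have "topspace (otop X) = orbits K Z act"
    using assms unfolding quotient_orbifold_def mcarrier_def by (auto simp: topspace_orbit_space inf_absorb2)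
  moreover have "(\<Union>i\<in>oidx X. omap X i ` odom X i) = topspace (otop X)"
    using X by (simp add: orbifold_structure_def)
  ultimately have "omap X i u \<in> orbits K Z act" if "i \<in> oidx X" "u \<in> odom X i" for i u
    using that by blast
  then have "\<exists>z\<in>Z. omap X i u = orbit K act z" if "i \<in> oidx X" "u \<in> odom X i" for i u
    using that unfolding orbits_def by blast
  then show ?thesis
    using assms X unfolding quotient_charts_def quotient_orbifold_def orbifold_structure_def by auto
qed

context
  fixes M :: "('a, 'e::euclidean_space) manifold" and Z :: "'a set" and K :: "'g monoid" and act :: "'g \<Rightarrow> 'a \<Rightarrow> 'a"
  assumes M: "smooth_manifold M" and par: "\<And>z. z \<in> Z \<Longrightarrow> parametrized_at M Z z"
begin

lemma local_projection_compose:
  fixes X :: "('i, 'a set, 'p::euclidean_space) orbifold" and Y :: "('j, 'a set, 'q::euclidean_space) orbifold"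
  assumes f: "local_projection M Z K act X i z W f" and z: "f z \<in> N" and N: "open N"
    and h: "smooth_on N h" "h ` N \<subseteq> odom Y j" "j \<in> oidx Y" "\<And>y. y \<in> N \<Longrightarrow> omap Y j (h y) = omap X i y"
  shows "local_projection M Z K act Y j z {x \<in> W. f x \<in> N} (\<lambda>x. h (f x))"
    and "mfderiv M vec_manifold (\<lambda>x. h (f x)) z v = frechet_derivative h (at (f z)) (mfderiv M vec_manifold f z v)"
  using assms smooth_out_compose[OF M _ N h(1), of W f] unfolding local_projection_def by auto

text \<open>The transition map is \<open>h = f' \<circ> s\<close>, where \<open>s\<close> is a local section of the projection \<open>f\<close> to the
  first chart and \<open>f'\<close> is a projection to the second.\<close>

lemma transition_map:
  fixes X :: "('i, 'a set, 'p::euclidean_space) orbifold" and Y :: "('j, 'a set, 'q::euclidean_space) orbifold"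
  assumes X: "quotient_charts M Z K act X" and f: "local_projection M Z K act X i z W f" "f z = u"
    "mfderiv M vec_manifold f z ` tangent_set M Z z = UNIV"
    and f': "local_projection M Z K act Y j z W' f'" "f' z = w"
  obtains N h where "open N" "u \<in> N" "N \<subseteq> odom X i" "smooth_on N h" "h u = w" "h ` N \<subseteq> odom Y j"
    "\<And>y. y \<in> N \<Longrightarrow> omap Y j (h y) = omap X i y"
proof -
  have fs: "smooth_map_on M W vec_manifold f" "z \<in> W" "z \<in> Z" "i \<in> oidx X"
    "\<And>x. x \<in> W \<inter> Z \<Longrightarrow> f x \<in> odom X i \<and> omap X i (f x) = orbit K act x"
    and f's: "smooth_map_on M W' vec_manifold f'" "z \<in> W'"
    "\<And>x. x \<in> W' \<inter> Z \<Longrightarrow> f' x \<in> odom Y j \<and> omap Y j (f' x) = orbit K act x"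
    using f(1) f'(1) unfolding local_projection_def by auto
  have oW': "openin (mtop M) W'" using f's(1) by (simp add: smooth_map_out_iff)
  obtain N s where s: "open N" "f z \<in> N" "smooth_map_on vec_manifold N M s" "s ` N \<subseteq> Z \<inter> W \<inter> W'"
    "s (f z) = z" "\<And>y. y \<in> N \<Longrightarrow> f (s y) = y"
    using local_section[OF M fs(1,2) par[OF fs(3)] f(3) oW' f's(2)] by metis
  have sN: "s y \<in> Z" "s y \<in> W" "s y \<in> W'" if "y \<in> N" for y using s(4) that by auto
  show thesis
  proof (rule that[OF s(1)])
    show "u \<in> N" using s(2) f(2) by simp
    show "N \<subseteq> odom X i" using s(6) fs(5) sN by (metis IntI subsetI)
    show "smooth_on N (\<lambda>y. f' (s y))" by (rule smooth_out_into(1)[OF M s(3) f's(1) _ s(1)]) (use s(4) in auto)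
    show "f' (s u) = w" using s(5) f(2) f'(2) by simp
    show "(\<lambda>y. f' (s y)) ` N \<subseteq> odom Y j" using sN f's(3) by auto
    show "omap Y j (f' (s y)) = omap X i y" if "y \<in> N" for y
      using fs(5)[of "s y"] f's(3)[of "s y"] sN[OF that] s(6)[OF that] by simp
  qed
qed

text \<open>\<open>transition_map\<close> gives maps \<open>h\<close> and \<open>h'\<close> in both
  directions, not inverse to each other in general. Their composites lie over the identity of the
  orbit space, so at each point they agree with some element of a finite chart group, and
  \<open>derivative_inj_of_finite_group\<close> makes both derivatives injective. The inverse
  function theorem then makes \<open>h\<close> a local diffeomorphism.\<close>

lemma lifts_everywhere_id:
  fixes X :: "('i, 'a set, 'p::euclidean_space) orbifold" and Y :: "('j, 'a set, 'q::euclidean_space) orbifold"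
  assumes X: "quotient_charts M Z K act X" and Y: "quotient_charts M Z K act Y"
  shows "lifts_everywhere X Y id"
  unfolding lifts_everywhere_def
proof (intro ballI impI)
  fix i j u w assume i: "i \<in> oidx X" and j: "j \<in> oidx Y" and u: "u \<in> odom X i" and w: "w \<in> odom Y j"
    and "id (omap X i u) = omap Y j w"
  then have eq: "omap X i u = omap Y j w" by simp
  obtain z where z: "z \<in> Z" "omap X i u = orbit K act z"
    using quotient_chartsD(6)[OF X i u] by blast
  obtain W f where f: "local_projection M Z K act X i z W f" "f z = u"
    "mfderiv M vec_manifold f z ` tangent_set M Z z = UNIV"
    using quotient_chartsD(7)[OF X i u z] by blast
  obtain W' f' where f': "local_projection M Z K act Y j z W' f'" "f' z = w"
    "mfderiv M vec_manifold f' z ` tangent_set M Z z = UNIV"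
    using quotient_chartsD(7)[OF Y j w z(1)] z(2) eq by auto
  obtain N h where h: "open N" "u \<in> N" "N \<subseteq> odom X i" "smooth_on N h" "h u = w" "h ` N \<subseteq> odom Y j"
    "\<And>y. y \<in> N \<Longrightarrow> omap Y j (h y) = omap X i y"
    by (rule transition_map[OF X f f'(1,2)]) (rule that)
  obtain N' h' where h': "open N'" "w \<in> N'" "N' \<subseteq> odom Y j" "smooth_on N' h'" "h' w = u" "h' ` N' \<subseteq> odom X i"
    "\<And>y. y \<in> N' \<Longrightarrow> omap X i (h' y) = omap Y j y"
    by (rule transition_map[OF Y f' f(1,2)]) (rule that)
  define A where "A = frechet_derivative h (at u)"
  define A' where "A' = frechet_derivative h' (at w)"
  note dh = smooth_on_has_derivative[OF h(4,1,2), folded A_def]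
  note dh' = smooth_on_has_derivative[OF h'(4,1,2), folded A'_def]
  note iX = quotient_chartsD(1-5)[OF X i] and jY = quotient_chartsD(1-5)[OF Y j]
  have "inj (\<lambda>v. A' (A v))"
  proof (rule derivative_inj_of_finite_group[OF iX(1-4), of "{y \<in> N. h y \<in> N'}" u "\<lambda>y. h' (h y)"])
    show "open {y \<in> N. h y \<in> N'}"
      using continuous_open_preimage[OF smooth_on_imp_continuous_on[OF h(4)] h(1) h'(1)]
      by (simp add: vimage_def Int_def)
    show "((\<lambda>y. h' (h y)) has_derivative (\<lambda>v. A' (A v))) (at u)"
      using has_derivative_compose[OF dh, of h' A'] dh' h(5) by simp
    show "\<exists>\<gamma>\<in>ogrp X i. \<gamma> y = h' (h y)" if "y \<in> {y \<in> N. h y \<in> N'}" for y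
      by (rule iX(5)) (use that h h' in auto)
  qed (use h h' in auto)
  then have injA: "inj A" by (metis (no_types, lifting) injD injI)
  have "inj (\<lambda>v. A (A' v))"
  proof (rule derivative_inj_of_finite_group[OF jY(1-4), of "{y \<in> N'. h' y \<in> N}" w "\<lambda>y. h (h' y)"])
    show "open {y \<in> N'. h' y \<in> N}"
      using continuous_open_preimage[OF smooth_on_imp_continuous_on[OF h'(4)] h'(1) h(1)]
      by (simp add: vimage_def Int_def)
    show "((\<lambda>y. h (h' y)) has_derivative (\<lambda>v. A (A' v))) (at w)"
      using has_derivative_compose[OF dh', of h A] dh h'(5) by simp
    show "\<exists>\<gamma>\<in>ogrp Y j. \<gamma> y = h (h' y)" if "y \<in> {y \<in> N'. h' y \<in> N}" for y
      by (rule jY(5)) (use that h h' in auto)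
  qed (use h h' in auto)
  then have injA': "inj A'" by (metis (no_types, lifting) injD injI)
  have lA: "linear A" "linear A'" using dh dh' has_derivative_linear by blast+
  \<comment> \<open>The model types \<open>'p\<close> and \<open>'q\<close> are unrelated a priori;
    the two injections force equal dimensions, so \<open>A\<close> is an isomorphism.\<close>
  have "dim (UNIV :: 'p set) = dim (UNIV :: 'q set)"
    using dim_image_eq[OF lA(1), of UNIV] dim_image_eq[OF lA(2), of UNIV] injA injA'
      dim_subset[OF subset_UNIV, of "range A"] dim_subset[OF subset_UNIV, of "range A'"] by simp
  then obtain B where B: "linear B" "\<And>x. B (A x) = x" "\<And>x. A (B x) = x"
    using linear_injective_isomorphism[OF lA(1) injA] by metis
  have bB: "bounded_linear B" using B(1) linear_conv_bounded_linear by blast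
  \<comment> \<open>Composing with the inverse of the derivative at \<open>u\<close> gives a map
    into \<open>'p\<close> itself with derivative the identity, as
    \<open>smooth_inverse_function\<close> requires.\<close>
  define k where "k = (\<lambda>y. B (h y))"
  have sk: "smooth_on N k" unfolding k_def by (rule smooth_on_bounded_linear[OF h(1) bB h(4)])
  have "(k has_derivative (\<lambda>v. B (A v))) (at u)"
    unfolding k_def by (rule bounded_linear.has_derivative[OF bB dh])
  then have "frechet_derivative k (at u) v = v" for v using frechet_derivative_at B(2) by metis
  from smooth_inverse_function[OF h(1) sk h(2) this]
  obtain U V g where V: "open U" "U \<subseteq> N" "u \<in> U" "open V" "homeomorphism U V k g" "smooth_on V g" by metis
  have hk: "h y = A (k y)" for y by (simp add: k_def B(3))
  have im: "h ` U = {y. B y \<in> V}"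
  proof -
    have "h ` U = A ` (k ` U)" unfolding hk by (simp add: image_image)
    also have "\<dots> = A ` V" using V(5) by (simp add: homeomorphism_def)
    also have "\<dots> = {y. B y \<in> V}" using B(2,3) by (auto simp: image_iff) metis
    finally show ?thesis .
  qed
  have inj: "inj_on h U"
    using V(5) unfolding hk inj_on_def homeomorphism_def by (metis B(2))
  have "diffeo_on U (h ` U) h"
    unfolding diffeo_on_def
  proof (intro conjI)
    show "open U" by fact
    show o: "open (h ` U)"
      unfolding im using open_vimage[OF V(4) linear_continuous_on[OF bB], unfolded vimage_def] .
    show "bij_betw h U (h ` U)" using inj by (simp add: bij_betw_def)
    show "smooth_on U h" using h(4) V(2) smooth_on_subset by blast
    have "smooth_on (h ` U) (\<lambda>y. g (B y))"
      using smooth_on_compose_affine[OF V(4) bB o V(6), of 0] im by simp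
    moreover have "inv_into U h y = g (B y)" if "y \<in> h ` U" for y
    proof -
      from that obtain x where x: "x \<in> U" "y = h x" by blast
      then have "g (B y) = x" using V(5) by (simp add: homeomorphism_def k_def)
      then show ?thesis using inv_into_f_f[OF inj x(1)] x(2) by simp
    qed
    ultimately show "smooth_on (h ` U) (inv_into U h)"
      using smooth_on_cong[OF o, of "inv_into U h" "\<lambda>y. g (B y)"] by simp
  qed
  moreover have "h ` U \<subseteq> odom Y j" "U \<subseteq> odom X i" "\<forall>y\<in>U. omap Y j (h y) = id (omap X i y)"
    using h(3,7) V(2) order_trans[OF image_mono[OF V(2)] h(6)] by auto
  ultimately have "local_lift X Y id i j U h"
    unfolding local_lift_def using i j by simp
  then show "\<exists>N h. local_lift X Y id i j N h \<and> u \<in> N \<and> h u = w" using V(3) h(5) by blast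
qed

text \<open>Composing the projection \<open>f\<close> to chart \<open>i\<close> with a lift
  \<open>h\<close> of the identity gives a projection to chart \<open>j\<close>. Thus tensors in
  both charts can be compared with one tensor on the manifold at \<open>z\<close>.\<close>

lemma lift_projections:
  fixes X :: "('i, 'a set, 'p::euclidean_space) orbifold" and Y :: "('j, 'a set, 'q::euclidean_space) orbifold"
  assumes X: "quotient_charts M Z K act X" and h: "local_lift X Y id i j N h" and y: "y \<in> N"
  obtains z W f W' where "z \<in> Z" "local_projection M Z K act X i z W f" "f z = y"
    "mfderiv M vec_manifold f z ` tangent_set M Z z = UNIV"
    "local_projection M Z K act Y j z W' (\<lambda>x. h (f x))"
    "\<And>v. mfderiv M vec_manifold (\<lambda>x. h (f x)) z v = frechet_derivative h (at y) (mfderiv M vec_manifold f z v)"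
proof -
  have h': "i \<in> oidx X" "j \<in> oidx Y" "N \<subseteq> odom X i" "h ` N \<subseteq> odom Y j" "open N" "smooth_on N h"
    "\<And>y. y \<in> N \<Longrightarrow> omap Y j (h y) = omap X i y"
    using h unfolding local_lift_def diffeo_on_def by auto
  then have yX: "y \<in> odom X i" using y by blast
  obtain z where z: "z \<in> Z" "omap X i y = orbit K act z"
    using quotient_chartsD(6)[OF X h'(1) yX] by blast
  obtain W f where f: "local_projection M Z K act X i z W f" "f z = y"
    "mfderiv M vec_manifold f z ` tangent_set M Z z = UNIV"
    using quotient_chartsD(7)[OF X h'(1) yX z] by blast
  have "f z \<in> N" using f(2) y by simp
  note c = local_projection_compose[OF f(1) this h'(5,6,4,2,7)]
  show thesis using that[OF z(1) f c(1)] c(2) f(2) by simp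
qed

text \<open>Vectors at \<open>y\<close> lift to tangent vectors of \<open>Z\<close> at
  \<open>z\<close>, because the derivative of \<open>f\<close> is onto there. Both forms, read
  through \<open>f\<close> and through \<open>h\<close> after \<open>f\<close>, equal
  \<open>\<omega>\<close> on these lifts.\<close>

lemma matches2_projects:
  fixes X :: "('i, 'a set, 'p::euclidean_space) orbifold" and Y :: "('j, 'a set, 'q::euclidean_space) orbifold"
  assumes X: "quotient_charts M Z K act X"
    and \<omega>: "projects2 M Z K act X \<omega> \<alpha>" "projects2 M Z K act Y \<omega> \<beta>"
  shows "matches2 X Y id \<alpha> \<beta>"
  unfolding matches2_def
proof (intro allI impI ballI)
  fix i j N h y v w assume h: "local_lift X Y id i j N h" and y: "y \<in> N"
  obtain z W f W' where f: "z \<in> Z" "local_projection M Z K act X i z W f" "f z = y"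
    "mfderiv M vec_manifold f z ` tangent_set M Z z = UNIV"
    "local_projection M Z K act Y j z W' (\<lambda>x. h (f x))"
    "\<And>v. mfderiv M vec_manifold (\<lambda>x. h (f x)) z v = frechet_derivative h (at y) (mfderiv M vec_manifold f z v)"
    by (rule lift_projections[OF X h y]) (rule that)
  obtain v' w' where v': "v' \<in> tangent_set M Z z" "v = mfderiv M vec_manifold f z v'"
    and w': "w' \<in> tangent_set M Z z" "w = mfderiv M vec_manifold f z w'"
    using f(4) by (metis UNIV_I imageE)
  have "\<alpha> i (f z) v w = \<omega> z v' w'"
    using \<omega>(1) f(2) v' w' unfolding projects2_def by blast
  moreover have "\<beta> j (h (f z)) (frechet_derivative h (at y) v) (frechet_derivative h (at y) w) = \<omega> z v' w'"
    using \<omega>(2) f(5) v' w' unfolding projects2_def f(6)[symmetric] by (metis f(6))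
  ultimately show "\<beta> j (h y) (frechet_derivative h (at y) v) (frechet_derivative h (at y) w) = \<alpha> i y v w"
    using f(3) by simp
qed

end

section \<open>Comparison of projected metrics\<close>

text \<open>\<open>T\<close> records the values of \<open>B n\<close> on a basis of
  \<open>N\<close>. Positivity makes it injective on \<open>N\<close>, hence onto \<open>N\<close>
  by dimension, and solving \<open>T n = T v\<close> yields the orthogonal projection of
  \<open>v\<close>.\<close>

lemma positive_form_projection:
  fixes B :: "'e::euclidean_space \<Rightarrow> 'e \<Rightarrow> real"
  assumes B: "bilinear B" and pos: "\<And>v. v \<noteq> 0 \<Longrightarrow> B v v > 0" and N: "subspace N"
  obtains n where "n \<in> N" "\<And>k. k \<in> N \<Longrightarrow> B (v - n) k = 0"
proof -
  obtain E where E: "E \<subseteq> N" "independent E" "N \<subseteq> span E" "card E = dim N" by (rule basis_exists)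
  have fin: "finite E" using E(2) by (rule independent_imp_finite)
  have sp: "span E = N" using E(1,3) N by (metis span_minimal subset_antisym)
  define T where "T = (\<lambda>n. \<Sum>b\<in>E. B n b *\<^sub>R b)"
  have l: "linear T"
    unfolding T_def by (rule linearI)
      (simp_all add: bilinear_ladd[OF B] bilinear_lmul[OF B] scaleR_left_distrib sum.distrib scaleR_sum_right)
  have TN: "T n \<in> N" for n
    unfolding T_def using E(1) by (intro subspace_sum[OF N] subspace_scale[OF N]) auto
  have zero: "B n k = 0" if "T n = 0" "k \<in> N" for n k
  proof -
    have b: "B n b = 0" if "b \<in> E" for b
      using independentD[OF E(2) fin subset_refl, of "\<lambda>b. B n b"] \<open>T n = 0\<close> that by (simp add: T_def)
    have "k \<in> span E" using sp that by simp
    then show ?thesis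
      by (induction rule: span_induct_alt) (simp_all add: bilinear_rzero[OF B] bilinear_radd[OF B] bilinear_rmul[OF B] b)
  qed
  have "inj_on T (span N)"
  proof (rule inj_onI)
    fix x y assume xy: "x \<in> span N" "y \<in> span N" "T x = T y"
    then have "T (x - y) = 0" "x - y \<in> N" using N by (auto simp: linear_diff[OF l] subspace_diff span_eq_iff[THEN iffD2])
    then have "B (x - y) (x - y) = 0" by (rule zero)
    then show "x = y" using pos[of "x - y"] by force
  qed
  then have "dim (T ` N) = dim N" by (rule dim_image_eq[OF l])
  then have "T ` N = N"
    using subspace_dim_equal[OF linear_subspace_image[OF l N] N] TN by auto
  then obtain n where n: "n \<in> N" "T n = T v" using TN[of v] by (metis imageE)
  then have "T (v - n) = 0" by (simp add: linear_diff[OF l])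
  then show thesis using that[OF n(1)] zero by blast
qed

text \<open>A projected metric is prescribed on horizontal vectors only. Each chart vector has a
  horizontal lift, obtained from any lift by subtracting its orthogonal projection to the kernel;
  and since the derivative of \<open>h\<close> is injective, \<open>f\<close> and \<open>h\<close>
  after \<open>f\<close> have the same horizontal vectors.\<close>

lemma matches2_projects_metric:
  fixes M :: "('a, 'e::euclidean_space) manifold"
    and X :: "('i, 'a set, 'p::euclidean_space) orbifold" and Y :: "('j, 'a set, 'q::euclidean_space) orbifold"
  assumes M: "smooth_manifold M" and par: "\<And>z. z \<in> Z \<Longrightarrow> parametrized_at M Z z" and Z: "Z \<subseteq> mcarrier M"
    and g: "\<And>z. z \<in> Z \<Longrightarrow> bilinear (g z)" "\<And>z v. z \<in> Z \<Longrightarrow> v \<noteq> 0 \<Longrightarrow> g z v v > 0"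
    and X: "quotient_charts M Z K act X"
    and p: "projects_metric M Z K act X g \<alpha>" "projects_metric M Z K act Y g \<beta>"
  shows "matches2 X Y id \<alpha> \<beta>"
  unfolding matches2_def
proof (intro allI impI ballI)
  fix i j N h y v w assume h: "local_lift X Y id i j N h" and y: "y \<in> N"
  obtain z W f W' where f: "z \<in> Z" "local_projection M Z K act X i z W f" "f z = y"
    "mfderiv M vec_manifold f z ` tangent_set M Z z = UNIV"
    "local_projection M Z K act Y j z W' (\<lambda>x. h (f x))"
    "\<And>v. mfderiv M vec_manifold (\<lambda>x. h (f x)) z v = frechet_derivative h (at y) (mfderiv M vec_manifold f z v)"
    by (rule lift_projections[OF M par X h y]) (assumption | rule that)+
  define T where "T = tangent_set M Z z"
  define L where "L = mfderiv M vec_manifold f z"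
  have T: "subspace T" unfolding T_def using subspace_tangent_set[OF M par[OF f(1)]] Z f(1) by blast
  have L: "linear L"
    unfolding L_def using bounded_linear_mfderiv_out[OF M] f(2) bounded_linear.linear unfolding local_projection_def by blast
  have N: "subspace {k \<in> T. L k = 0}"
    using subspace_inter[OF T linear_subspace_kernel[OF L]] by (simp add: Int_def)
  have hor: "\<exists>v'. v' \<in> horizontal M Z g f z \<and> v = L v'" for v
  proof -
    obtain v0 where v0: "v0 \<in> T" "v = L v0" using f(4) unfolding T_def L_def by (metis UNIV_I imageE)
    obtain n where n: "n \<in> {k \<in> T. L k = 0}" "\<And>k. k \<in> {k \<in> T. L k = 0} \<Longrightarrow> g z (v0 - n) k = 0"
      by (rule positive_form_projection[OF g(1)[OF f(1)] g(2)[OF f(1)] N, of v0]) (assumption, rule that)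
    then show ?thesis
      using v0 subspace_diff[OF T v0(1)] linear_diff[OF L, of v0 n]
      by (intro exI[of _ "v0 - n"]) (auto simp: horizontal_def T_def L_def)
  qed
  have "inj (frechet_derivative h (at y))"
  proof -
    have d: "open N" "smooth_on N h" "open (h ` N)" "smooth_on (h ` N) (inv_into N h)" "inj_on h N"
      using h unfolding local_lift_def diffeo_on_def bij_betw_def by auto
    have "((\<lambda>x. inv_into N h (h x)) has_derivative
        (\<lambda>v. frechet_derivative (inv_into N h) (at (h y)) (frechet_derivative h (at y) v))) (at y)"
      by (rule has_derivative_compose[OF smooth_on_has_derivative[OF d(2,1) y] smooth_on_has_derivative[OF d(4,3)]])
        (use y in blast)
    moreover have "((\<lambda>x. inv_into N h (h x)) has_derivative (\<lambda>v. v)) (at y)"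
      by (rule has_derivative_transform_within_open[OF has_derivative_ident d(1) y]) (simp add: d(5))
    ultimately have "frechet_derivative (inv_into N h) (at (h y)) (frechet_derivative h (at y) v) = v" for v
      using has_derivative_unique by metis
    then show ?thesis by (metis injI)
  qed
  moreover have lh: "linear (frechet_derivative h (at y))"
    using h y smooth_on_has_derivative has_derivative_linear unfolding local_lift_def diffeo_on_def by blast
  ultimately have "frechet_derivative h (at y) v = 0 \<longleftrightarrow> v = 0" for v
    by (metis linear_0 linear_injective_0)
  then have hor_eq: "horizontal M Z g (\<lambda>x. h (f x)) z = horizontal M Z g f z"
    unfolding horizontal_def f(6) by simp
  obtain v' w' where v': "v' \<in> horizontal M Z g f z" "v = L v'" and w': "w' \<in> horizontal M Z g f z" "w = L w'"
    using hor by metis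
  have "\<alpha> i (f z) v w = g z v' w'"
    using p(1) f(2) v' w' unfolding projects_metric_def L_def by blast
  moreover have "\<beta> j (h (f z)) (mfderiv M vec_manifold (\<lambda>x. h (f x)) z v') (mfderiv M vec_manifold (\<lambda>x. h (f x)) z w') = g z v' w'"
    using p(2) f(5) v'(1) w'(1) hor_eq unfolding projects_metric_def by blast
  ultimately show "\<beta> j (h y) (frechet_derivative h (at y) v) (frechet_derivative h (at y) w) = \<alpha> i y v w"
    using f(3,6) v'(2) w'(2) by (simp add: L_def)
qed


section \<open>Products, one-forms and momentum maps\<close>

lemma smooth_on_cong_imp:
  "open U \<Longrightarrow> (\<And>y. y \<in> U \<Longrightarrow> f y = g y) \<Longrightarrow> smooth_on U f \<Longrightarrow> smooth_on U g"
  using smooth_on_cong[of U f g] by blast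

lemma second_countable_prod_topology:
  assumes "second_countable X" "second_countable Y"
  shows "second_countable (prod_topology X Y)"
proof -
  obtain \<B> where B: "countable \<B>" "\<And>V. V \<in> \<B> \<Longrightarrow> openin X V"
    "\<And>U x. openin X U \<Longrightarrow> x \<in> U \<Longrightarrow> \<exists>V\<in>\<B>. x \<in> V \<and> V \<subseteq> U"
    using assms(1) unfolding second_countable_def by metis
  obtain \<C> where C: "countable \<C>" "\<And>V. V \<in> \<C> \<Longrightarrow> openin Y V"
    "\<And>U x. openin Y U \<Longrightarrow> x \<in> U \<Longrightarrow> \<exists>V\<in>\<C>. x \<in> V \<and> V \<subseteq> U"
    using assms(2) unfolding second_countable_def by metis
  show ?thesis
    unfolding second_countable_def
  proof (intro exI conjI ballI allI impI)
    show "countable ((\<lambda>(U, V). U \<times> V) ` (\<B> \<times> \<C>))" using B(1) C(1) by blast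
    show "openin (prod_topology X Y) W" if "W \<in> (\<lambda>(U, V). U \<times> V) ` (\<B> \<times> \<C>)" for W
      using that B(2) C(2) by (auto simp: openin_prod_Times_iff)
    fix W p assume W: "openin (prod_topology X Y) W \<and> p \<in> W"
    obtain x y where p: "p = (x, y)" by fastforce
    obtain U V where UV: "openin X U" "openin Y V" "x \<in> U" "y \<in> V" "U \<times> V \<subseteq> W"
      using W p openin_prod_topology_alt by metis
    obtain U' V' where "U' \<in> \<B>" "x \<in> U'" "U' \<subseteq> U" "V' \<in> \<C>" "y \<in> V'" "V' \<subseteq> V"
      using B(3)[OF UV(1,3)] C(3)[OF UV(2,4)] by blast
    then show "\<exists>V\<in>(\<lambda>(U, V). U \<times> V) ` (\<B> \<times> \<C>). p \<in> V \<and> V \<subseteq> W"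
      using p UV(5) by (intro bexI[of _ "U' \<times> V'"]) auto
  qed
qed

lemma mcarrier_prod: "mcarrier (prod_manifold M N) = mcarrier M \<times> mcarrier N"
  by (simp add: mcarrier_def prod_manifold_def)

lemma mdom_prod: "mdom (prod_manifold M N) (p, q) = mdom M p \<times> mdom N q"
  by (simp add: prod_manifold_def)

lemma mchart_prod: "mchart (prod_manifold M N) (p, q) = map_prod (mchart M p) (mchart N q)"
  by (simp add: prod_manifold_def)

lemma mtop_prod: "mtop (prod_manifold M N) = prod_topology (mtop M) (mtop N)"
  by (simp add: prod_manifold_def)

lemma mpar_prod:
  assumes M: "smooth_manifold M" "p \<in> mcarrier M" and N: "smooth_manifold N" "q \<in> mcarrier N"
    and y: "y \<in> mchart M p ` mdom M p" "y' \<in> mchart N q ` mdom N q"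
  shows "mpar (prod_manifold M N) (p, q) (y, y') = (mpar M p y, mpar N q y')"
  unfolding mpar_def[of "prod_manifold M N"] mdom_prod mchart_prod
proof (rule inv_into_f_eq)
  have inj: "inj_on (mchart M p) (mdom M p)" "inj_on (mchart N q) (mdom N q)"
    using mpar_mchart[OF M] mpar_mchart[OF N] by (auto intro: inj_on_inverseI)
  show "inj_on (map_prod (mchart M p) (mchart N q)) (mdom M p \<times> mdom N q)"
    by (rule map_prod_inj_on[OF inj])
qed (use mchart_mpar[OF y(1)] mchart_mpar[OF y(2)] in auto)

lemma homeomorphic_map_prod:
  assumes "homeomorphic_map X X' f" "homeomorphic_map Y Y' g"
  shows "homeomorphic_map (prod_topology X Y) (prod_topology X' Y') (map_prod f g)"
proof -
  obtain f' g' where "homeomorphic_maps X X' f f'" "homeomorphic_maps Y Y' g g'"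
    using assms unfolding homeomorphic_map_maps by blast
  then have "homeomorphic_maps (prod_topology X Y) (prod_topology X' Y') (\<lambda>(x, y). (f x, g y)) (\<lambda>(x, y). (f' x, g' y))"
    unfolding homeomorphic_maps_prod by blast
  then show ?thesis unfolding homeomorphic_map_maps map_prod_def by blast
qed

lemma smooth_on_map_prod:
  fixes f :: "'a::real_normed_vector \<Rightarrow> 'c::real_normed_vector" and g :: "'b::real_normed_vector \<Rightarrow> 'd::real_normed_vector"
  assumes "open U" "open V" "smooth_on U f" "smooth_on V g"
  shows "smooth_on (U \<times> V) (map_prod f g)"
proof -
  have o: "open (U \<times> V)" using assms by (simp add: open_Times)
  have "smooth_on (U \<times> V) (\<lambda>p. (f (0 + fst p), g (0 + snd p)))"
    by (intro smooth_on_Pair[OF o] smooth_on_compose_affine[OF assms(1) bounded_linear_fst o assms(3)]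
        smooth_on_compose_affine[OF assms(2) bounded_linear_snd o assms(4)]) auto
  then show ?thesis by (simp add: map_prod_def case_prod_unfold)
qed

lemma smooth_manifold_prod:
  assumes M: "smooth_manifold M" and N: "smooth_manifold N"
  shows "smooth_manifold (prod_manifold M N)"
  unfolding smooth_manifold_def
proof (intro conjI ballI)
  show "Hausdorff_space (mtop (prod_manifold M N))" "second_countable (mtop (prod_manifold M N))"
    using M N by (auto simp: mtop_prod smooth_manifold_def Hausdorff_space_prod_topology second_countable_prod_topology)
next
  fix x assume x: "x \<in> mcarrier (prod_manifold M N)"
  obtain p q where pq: "x = (p, q)" "p \<in> mcarrier M" "q \<in> mcarrier N"
    using x by (auto simp: mcarrier_prod)
  note P = smooth_manifoldD[OF M pq(2)] and Q = smooth_manifoldD[OF N pq(3)]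
  have im: "mchart (prod_manifold M N) x ` mdom (prod_manifold M N) x
    = (mchart M p ` mdom M p) \<times> (mchart N q ` mdom N q)"
    unfolding pq(1) mdom_prod mchart_prod by (rule map_prod_image)
  show "openin (mtop (prod_manifold M N)) (mdom (prod_manifold M N) x)" "x \<in> mdom (prod_manifold M N) x"
    using P(1,2) Q(1,2) by (auto simp: pq(1) mdom_prod mtop_prod openin_prod_Times_iff)
  show "open (mchart (prod_manifold M N) x ` mdom (prod_manifold M N) x)"
    unfolding im using P(3) Q(3) by (rule open_Times)
  show "homeomorphic_map (subtopology (mtop (prod_manifold M N)) (mdom (prod_manifold M N) x))
          (top_of_set (mchart (prod_manifold M N) x ` mdom (prod_manifold M N) x)) (mchart (prod_manifold M N) x)"
    using homeomorphic_map_prod[OF P(4) Q(4)]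
    unfolding im by (simp add: pq(1) mdom_prod mchart_prod mtop_prod subtopology_Times)
  fix x' assume x': "x' \<in> mcarrier (prod_manifold M N)"
  obtain p' q' where pq': "x' = (p', q')" "p' \<in> mcarrier M" "q' \<in> mcarrier N"
    using x' by (auto simp: mcarrier_prod)
  define A where "A = mchart M p ` (mdom M p \<inter> mdom M p')"
  define B where "B = mchart N q ` (mdom N q \<inter> mdom N q')"
  have im': "mchart (prod_manifold M N) x ` (mdom (prod_manifold M N) x \<inter> mdom (prod_manifold M N) x') = A \<times> B"
    unfolding pq(1) pq'(1) mdom_prod mchart_prod Times_Int_Times A_def B_def by (rule map_prod_image)
  have o: "open A" "open B"
    unfolding A_def B_def
    using open_chart_image[OF M pq(2) smooth_manifoldD(1)[OF M pq'(2)]]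
      open_chart_image[OF N pq(3) smooth_manifoldD(1)[OF N pq'(3)]] by (simp_all add: Int_commute)
  have "smooth_on (A \<times> B) (map_prod (mchart M p' \<circ> mpar M p) (mchart N q' \<circ> mpar N q))"
    using smooth_on_map_prod[OF o] P(5)[OF pq'(2)] Q(5)[OF pq'(3)] by (simp add: A_def B_def)
  moreover have "map_prod (mchart M p' \<circ> mpar M p) (mchart N q' \<circ> mpar N q) y
      = (mchart (prod_manifold M N) x' \<circ> mpar (prod_manifold M N) x) y" if "y \<in> A \<times> B" for y
  proof -
    obtain y1 y2 where y: "y = (y1, y2)" "y1 \<in> mchart M p ` mdom M p" "y2 \<in> mchart N q ` mdom N q"
      using \<open>y \<in> A \<times> B\<close> by (auto simp: A_def B_def)
    show ?thesis using mpar_prod[OF M pq(2) N pq(3) y(2,3)] by (simp add: y(1) pq(1) pq'(1) mchart_prod)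
  qed
  ultimately have "smooth_on (A \<times> B) (mchart (prod_manifold M N) x' \<circ> mpar (prod_manifold M N) x)"
    by (rule smooth_on_cong_imp[OF open_Times[OF o], rotated])
  then show "smooth_on (mchart (prod_manifold M N) x ` (mdom (prod_manifold M N) x \<inter> mdom (prod_manifold M N) x'))
     (mchart (prod_manifold M N) x' \<circ> mpar (prod_manifold M N) x)" unfolding im' .
qed

section \<open>One-forms in charts\<close>

lemma smooth_mpar:
  assumes M: "smooth_manifold M" and p: "p \<in> mcarrier M"
  shows "smooth_map_on vec_manifold (mchart M p ` mdom M p) M (mpar M p)"
  unfolding smooth_map_into_iff
proof (intro conjI ballI)
  show "smooth_on {x \<in> mchart M p ` mdom M p. mpar M p x \<in> mdom M q} (\<lambda>x. mchart M q (mpar M p x))"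
    if q: "q \<in> mcarrier M" for q
    using smooth_manifoldD(5)[OF M p q]
    unfolding chart_image_eq[OF M p, of "mdom M q", symmetric] by (simp add: Int_commute o_def)
qed (use smooth_manifoldD(3)[OF M p] continuous_map_mpar[OF M p] in auto)

lemma mfderiv_mpar_at:
  assumes M: "smooth_manifold M" and p: "p \<in> mcarrier M"
  shows "mfderiv vec_manifold M (mpar M p) (mchart M p p) v = v"
proof -
  note d = smooth_manifoldD(2,3)[OF M p]
  have pp: "mpar M p (mchart M p p) = p" by (rule mpar_mchart[OF M p d(1)])
  have "frechet_derivative (\<lambda>y. mchart M p (mpar M p y)) (at (mchart M p p)) = frechet_derivative (\<lambda>y. y) (at (mchart M p p))"
    by (rule frechet_derivative_cong_open[OF d(2)]) (use d(1) in blast, rule mchart_mpar(1))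
  then show ?thesis
    unfolding mfderiv_into pp using frechet_derivative_at[OF has_derivative_ident] by metis
qed

context
  fixes M :: "('a, 'e::euclidean_space) manifold" and \<alpha>
  assumes M: "smooth_manifold M" and \<alpha>: "one_form M \<alpha>"
begin

lemma linear_pullback1_mpar:
  assumes p: "p \<in> mcarrier M" and y: "y \<in> mchart M p ` mdom M p"
  shows "linear (pullback1 vec_manifold M (mpar M p) \<alpha> y)"
proof -
  have "linear (\<alpha> (mpar M p y))"
    using \<alpha> mchart_mpar(2)[OF y] mdom_subset[OF M p] by (auto simp: one_form_def)
  then show ?thesis
    unfolding pullback1_def
    using linear_compose[OF bounded_linear.linear[OF bounded_linear_mfderiv_into[OF M smooth_mpar[OF M p] y]]]
    by (simp add: o_def)
qed

lemma smooth_pullback1_mpar: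
  assumes p: "p \<in> mcarrier M"
  shows "smooth_on (mchart M p ` mdom M p) (\<lambda>y. pullback1 vec_manifold M (mpar M p) \<alpha> y v)"
  using \<alpha> p by (simp add: one_form_def)

text \<open>Both forms are pulled back along a parametrization of \<open>Z\<close>, where they agree as forms on an open
  set of the model space.\<close>

lemma projects2_ext_d:
  fixes X :: "('i, 'a set, 'q::euclidean_space) orbifold"
  assumes par: "\<And>z. z \<in> Z \<Longrightarrow> parametrized_at M Z z" and Z: "Z \<subseteq> mcarrier M"
    and \<beta>: "\<And>i. i \<in> oidx X \<Longrightarrow> open (odom X i)" "\<And>i u. i \<in> oidx X \<Longrightarrow> u \<in> odom X i \<Longrightarrow> linear (\<beta> i u)"
      "\<And>i v. i \<in> oidx X \<Longrightarrow> smooth_on (odom X i) (\<lambda>u. \<beta> i u v)"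
    and p: "projects1 M Z K act X \<alpha> \<beta>"
  shows "projects2 M Z K act X (ext_deriv M \<alpha>) (\<lambda>i. ext_d (\<beta> i))"
  unfolding projects2_def
proof (intro allI impI ballI)
  fix i z W f v w
  assume f: "local_projection M Z K act X i z W f" and v: "v \<in> tangent_set M Z z" and w: "w \<in> tangent_set M Z z"
  have f': "i \<in> oidx X" "z \<in> W" "z \<in> Z" "smooth_map_on M W vec_manifold f"
    "\<And>x. x \<in> W \<inter> Z \<Longrightarrow> f x \<in> odom X i"
    using f unfolding local_projection_def by auto
  have zc: "z \<in> mcarrier M" using Z f'(3) by blast
  note zd = smooth_manifoldD(1,2)[OF M zc]
  \<comment> \<open>Keeps the parametrization inside a single chart of \<open>M\<close>, where
    \<open>\<alpha>\<close> becomes a form \<open>\<alpha>z\<close> on an open set of the model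
    space.\<close>
  have oW: "openin (mtop M) (W \<inter> mdom M z)" using f'(4) zd(1) by (simp add: smooth_map_out_iff openin_Int)
  obtain U :: "'e set" and \<Psi> where U: "open U" "0 \<in> U" "smooth_map_on vec_manifold U M \<Psi>"
    "\<Psi> ` U \<subseteq> Z \<inter> (W \<inter> mdom M z)" "\<Psi> 0 = z"
    and id: "\<And>v. v \<in> tangent_set M Z z \<Longrightarrow> mfderiv vec_manifold M \<Psi> 0 v = v"
    by (rule parametrized_atE[OF M par[OF f'(3)] oW]) (use zd(2) f'(2) in auto)
  have \<Psi>: "\<Psi> y \<in> Z" "\<Psi> y \<in> W" "\<Psi> y \<in> mdom M z" if "y \<in> U" for y using U(4) that by auto
  define c where "c = (\<lambda>y. mchart M z (\<Psi> y))"
  define \<tau> where "\<tau> = (\<lambda>y. f (\<Psi> y))"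
  define \<alpha>z where "\<alpha>z = pullback1 vec_manifold M (mpar M z) \<alpha>"
  have "{y \<in> U. \<Psi> y \<in> mdom M z} = U" using \<Psi> by auto
  then have c: "smooth_on U c" using smooth_into_chart(2)[OF M U(3) zc] by (simp add: c_def)
  have \<Psi>W: "\<Psi> ` U \<subseteq> W" using \<Psi> by blast
  note so = smooth_out_into[OF M U(3) f'(4) \<Psi>W U(1)]
  have \<tau>: "smooth_on U \<tau>" unfolding \<tau>_def by (rule so(1))
  have d\<tau>: "frechet_derivative \<tau> (at y) e = mfderiv M vec_manifold f (\<Psi> y) (mfderiv vec_manifold M \<Psi> y e)" if "y \<in> U" for y e
    unfolding \<tau>_def by (rule so(2)[OF that])
  \<comment> \<open>Exterior derivatives need the equality of the pulled back forms on a whole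
    neighbourhood. It holds because \<open>W\<close> and \<open>f\<close> give a local projection at
    every \<open>\<Psi> y\<close>, not only at \<open>z\<close>.\<close>
  have eq: "\<beta> i (\<tau> y) (frechet_derivative \<tau> (at y) e) = \<alpha>z (c y) (frechet_derivative c (at y) e)" if y: "y \<in> U" for y e
  proof -
    have "local_projection M Z K act X i (\<Psi> y) W f"
      using f \<Psi>[OF y] by (simp add: local_projection_def)
    moreover have "mfderiv vec_manifold M \<Psi> y e \<in> tangent_set M Z (\<Psi> y)"
      by (rule mfderiv_in_tangent_set[OF M U(3) _ y]) (use \<Psi> in auto)
    ultimately have "\<beta> i (f (\<Psi> y)) (mfderiv M vec_manifold f (\<Psi> y) (mfderiv vec_manifold M \<Psi> y e))
        = \<alpha> (\<Psi> y) (mfderiv vec_manifold M \<Psi> y e)"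
      using p unfolding projects1_def by blast
    then have "\<beta> i (\<tau> y) (frechet_derivative \<tau> (at y) e) = \<alpha> (\<Psi> y) (mfderiv vec_manifold M \<Psi> y e)"
      unfolding d\<tau>[OF y] by (simp add: \<tau>_def)
    then show ?thesis
      using pullback1_into_chart[OF M U(3) zc y \<Psi>(3)[OF y], of \<alpha> e] by (simp add: \<alpha>z_def c_def)
  qed
  have dc: "frechet_derivative c (at 0) v = mfderiv vec_manifold M \<Psi> 0 v" for v
    unfolding mfderiv_into c_def U(5) by simp
  have "ext_d (\<beta> i) (\<tau> 0) (frechet_derivative \<tau> (at 0) v) (frechet_derivative \<tau> (at 0) w)
    = ext_d (\<lambda>y v. \<beta> i (\<tau> y) (frechet_derivative \<tau> (at y) v)) 0 v w"
    by (rule ext_d_pullback[OF U(1) \<beta>(1)[OF f'(1)] \<tau> _ \<beta>(2)[OF f'(1)] \<beta>(3)[OF f'(1)] U(2), symmetric])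
      (use f'(5) \<Psi> in \<open>auto simp: \<tau>_def\<close>)
  also have "\<dots> = ext_d (\<lambda>y v. \<alpha>z (c y) (frechet_derivative c (at y) v)) 0 v w"
    using ext_d_cong_open[OF U(1,2) eq] by simp
  also have "\<dots> = ext_d \<alpha>z (c 0) (frechet_derivative c (at 0) v) (frechet_derivative c (at 0) w)"
    unfolding \<alpha>z_def
    by (rule ext_d_pullback[OF U(1) smooth_manifoldD(3)[OF M zc] c _ linear_pullback1_mpar[OF zc]
          smooth_pullback1_mpar[OF zc] U(2)])
      (use \<Psi> in \<open>auto simp: c_def\<close>)
  finally show "ext_d (\<beta> i) (f z) (mfderiv M vec_manifold f z v) (mfderiv M vec_manifold f z w) = ext_deriv M \<alpha> z v w"
    unfolding d\<tau>[OF U(2)] dc using id[OF v] id[OF w] U(5) by (simp add: ext_deriv_def \<alpha>z_def c_def \<tau>_def)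
qed

end

section \<open>Smoothness of the momentum map\<close>

text \<open>Coordinates on the Lie algebra write \<open>F\<close> as a combination of fixed
  functionals \<open>C b\<close>, the coefficients being the values on basis vectors. A linear
  \<open>P\<close> passes through this finite sum, so no argument about its continuity is
  required.\<close>

lemma smooth_on_blinfun:
  fixes F :: "'d::real_normed_vector \<Rightarrow> 'l::{real_normed_vector, heine_borel} \<Rightarrow>\<^sub>L real"
  assumes D: "open D" and F: "\<And>\<xi>. smooth_on D (\<lambda>y. blinfun_apply (F y) \<xi>)"
  shows "smooth_on D F" and "linear P \<Longrightarrow> smooth_on D (\<lambda>y. P (F y))"
    and "linear P \<Longrightarrow> y \<in> D \<Longrightarrow> frechet_derivative (\<lambda>y. P (F y)) (at y) v = P (frechet_derivative F (at y) v)"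
proof -
  obtain B :: "'l set" and c where B: "finite B" "\<And>b. b \<in> B \<Longrightarrow> bounded_linear (c b)"
    "\<And>v. v = (\<Sum>b\<in>B. c b v *\<^sub>R b)"
    using heine_borel_coordinates by metis
  define C where "C = (\<lambda>b. Blinfun (c b))"
  have F_eq: "F y = (\<Sum>b\<in>B. blinfun_apply (F y) b *\<^sub>R C b)" for y
  proof (rule blinfun_eqI)
    fix \<xi>
    have "blinfun_apply (F y) \<xi> = blinfun_apply (F y) (\<Sum>b\<in>B. c b \<xi> *\<^sub>R b)" using B(3) by metis
    then show "blinfun_apply (F y) \<xi> = blinfun_apply (\<Sum>b\<in>B. blinfun_apply (F y) b *\<^sub>R C b) \<xi>"
      by (simp add: C_def blinfun.sum_right blinfun.sum_left blinfun.scaleR_right blinfun.scaleR_left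
          bounded_linear_Blinfun_apply[OF B(2)] mult.commute)
  qed
  have PF: "P (F y) = (\<Sum>b\<in>B. blinfun_apply (F y) b *\<^sub>R P (C b))" if "linear P" for P :: "('l \<Rightarrow>\<^sub>L real) \<Rightarrow> 'z::real_normed_vector" and y
    by (subst F_eq) (simp add: linear_sum[OF that] linear_cmul[OF that])
  have sP: "smooth_on D (\<lambda>y. \<Sum>b\<in>B. blinfun_apply (F y) b *\<^sub>R Q b)" for Q :: "'l \<Rightarrow> 'z::real_normed_vector"
    by (intro smooth_on_sum[OF D] smooth_on_scaleR[OF D] F smooth_on_const)
  have F_fun: "F = (\<lambda>y. \<Sum>b\<in>B. blinfun_apply (F y) b *\<^sub>R C b)" by (rule ext, rule F_eq)
  show sF: "smooth_on D F" by (subst F_fun, rule sP)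
  show "smooth_on D (\<lambda>y. P (F y))" if "linear P" using sP PF[OF that] by simp
  show "frechet_derivative (\<lambda>y. P (F y)) (at y) v = P (frechet_derivative F (at y) v)"
    if P: "linear P" and y: "y \<in> D"
  proof -
    define d where "d = (\<lambda>b v. frechet_derivative (\<lambda>y. blinfun_apply (F y) b) (at y) v)"
    have h: "((\<lambda>y. \<Sum>b\<in>B. blinfun_apply (F y) b *\<^sub>R Q b) has_derivative (\<lambda>v. \<Sum>b\<in>B. d b v *\<^sub>R Q b)) (at y)"
      for Q :: "'l \<Rightarrow> 'z::real_normed_vector"
      unfolding d_def
      by (intro has_derivative_sum has_derivative_scaleR_left smooth_on_has_derivative[OF F D y])
    have "(F has_derivative (\<lambda>v. \<Sum>b\<in>B. d b v *\<^sub>R C b)) (at y)" by (subst F_fun, rule h)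
    from fun_cong[OF frechet_derivative_at[OF this], of v]
    have 1: "frechet_derivative F (at y) v = (\<Sum>b\<in>B. d b v *\<^sub>R C b)" by (rule sym)
    have "((\<lambda>y. P (F y)) has_derivative (\<lambda>v. \<Sum>b\<in>B. d b v *\<^sub>R P (C b))) (at y)" using h PF[OF P] by simp
    from fun_cong[OF frechet_derivative_at[OF this], of v]
    have "frechet_derivative (\<lambda>y. P (F y)) (at y) v = (\<Sum>b\<in>B. d b v *\<^sub>R P (C b))" by (rule sym)
    then show ?thesis unfolding 1 by (simp add: linear_sum[OF P] linear_cmul[OF P])
  qed
qed

text \<open>In coordinates the generator of \<open>\<xi>\<close> is the derivative
  \<open>\<kappa>\<close> of the action map at the identity in direction \<open>\<xi>\<close>, hence
  smooth in the point; the momentum is its contraction with the smooth form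
  \<open>\<eta>\<close>.\<close>

lemma smooth_momentum:
  fixes S :: "('a, 's::euclidean_space) manifold" and L :: "('g, 'l::real_normed_vector) manifold"
  assumes S: "smooth_manifold S" and \<eta>: "one_form S \<eta>" and L: "lie_group L G"
    and act: "smooth_action L G S act" and mom: "contact_momentum_map L G S \<eta> act \<Phi>" and z: "z \<in> mcarrier S"
  shows "smooth_on (mchart S z ` mdom S z) (\<lambda>y. blinfun_apply (\<Phi> (mpar S z y)) \<xi>)"
proof -
  have L': "smooth_manifold L" "mcarrier L = carrier G" "group G" using L by (auto simp: lie_group_def)
  define e where "e = \<one>\<^bsub>G\<^esub>"
  have e: "e \<in> mcarrier L" unfolding e_def using monoid.one_closed[OF group.is_monoid[OF L'(3)]] L'(2) by simp
  have act_e: "act e x = x" if "x \<in> mcarrier S" for x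
    using fun_cong[OF group_action.id_eq_one, of G "mcarrier S" act x] act that
    by (simp add: smooth_action_def e_def)
  define D where "D = mchart S z ` mdom S z"
  define a where "a = mchart L e e"
  define W where "W = {x \<in> (carrier G \<times> mcarrier S) \<inter> mdom (prod_manifold L S) (e, z). (\<lambda>(h, x). act h x) x \<in> mdom S z}"
  define Q where "Q = mchart (prod_manifold L S) (e, z) ` W"
  define \<theta> where "\<theta> = mchart S z \<circ> (\<lambda>(h, x). act h x) \<circ> mpar (prod_manifold L S) (e, z)"
  have LS: "smooth_manifold (prod_manifold L S)" by (rule smooth_manifold_prod[OF L'(1) S])
  have ez: "(e, z) \<in> mcarrier (prod_manifold L S)" using e z by (simp add: mcarrier_prod)
  have sm: "smooth_map_on (prod_manifold L S) (carrier G \<times> mcarrier S) S (\<lambda>(h, x). act h x)"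
    using act by (simp add: smooth_action_def)
  have \<theta>: "smooth_on Q \<theta>"
    using sm ez z e L'(2) unfolding smooth_map_on_def Q_def W_def \<theta>_def mcarrier_prod by auto
  have oW: "openin (mtop (prod_manifold L S)) W"
  proof -
    have "openin (subtopology (mtop (prod_manifold L S)) (carrier G \<times> mcarrier S))
      {x \<in> topspace (subtopology (mtop (prod_manifold L S)) (carrier G \<times> mcarrier S)). (\<lambda>(h, x). act h x) x \<in> mdom S z}"
      by (rule openin_continuous_map_preimage[OF _ smooth_manifoldD(1)[OF S z]]) (use sm in \<open>simp add: smooth_map_on_def\<close>)
    moreover have "openin (mtop (prod_manifold L S)) (carrier G \<times> mcarrier S)"
      using sm by (simp add: smooth_map_on_def)
    ultimately have "openin (mtop (prod_manifold L S))
      {x \<in> topspace (subtopology (mtop (prod_manifold L S)) (carrier G \<times> mcarrier S)). (\<lambda>(h, x). act h x) x \<in> mdom S z}"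
      by (simp only: openin_open_subtopology)
    from openin_Int[OF this smooth_manifoldD(1)[OF LS ez]] show ?thesis
      unfolding W_def by (rule back_subst[of "openin _"]) (use L'(2) in \<open>auto simp: mtop_prod mcarrier_def\<close>)
  qed
  have oO: "open Q"
    using open_chart_image[OF LS ez oW] unfolding Q_def W_def by (simp add: Int_def conj_ac)
  have aD: "(a, y) \<in> Q" if "y \<in> D" for y
  proof -
    obtain x where x: "x \<in> mdom S z" "y = mchart S z x" using \<open>y \<in> D\<close> by (auto simp: D_def)
    have "(e, x) \<in> W" using x e L'(2) mdom_subset[OF S z] smooth_manifoldD(2)[OF L'(1) e] act_e
      by (auto simp: W_def mdom_prod)
    then show ?thesis unfolding Q_def x(2) a_def by (force simp: mchart_prod)
  qed
  have D: "open D" unfolding D_def by (rule smooth_manifoldD(3)[OF S z])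
  define \<kappa> where "\<kappa> = (\<lambda>y. frechet_derivative \<theta> (at (a, y)) (\<xi>, 0))"
  have \<kappa>: "smooth_on D \<kappa>"
  proof -
    have "smooth_on D (\<lambda>y. frechet_derivative \<theta> (at ((a, 0) + (0, y))) (\<xi>, 0))"
      by (rule smooth_on_compose_affine[OF oO _ D smooth_on_frechet_derivative[OF \<theta> oO], of "\<lambda>y. (0, y)"])
        (use aD in \<open>auto intro!: bounded_linear_Pair bounded_linear_zero bounded_linear_ident\<close>)
    then show ?thesis by (simp add: \<kappa>_def)
  qed
  define \<eta>z where "\<eta>z = pullback1 vec_manifold S (mpar S z) \<eta>"
  have key: "blinfun_apply (\<Phi> (mpar S z y)) \<xi> = \<eta>z y (\<kappa> y)" if y: "y \<in> D" for y
  proof -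
    define x where "x = mpar S z y"
    have xd: "x \<in> mdom S z" "mchart S z x = y" using mchart_mpar[OF y[unfolded D_def]] by (simp_all add: x_def)
    have xc: "x \<in> mcarrier S" using xd(1) mdom_subset[OF S z] by blast
    define V where "V = {h. (h, y) \<in> Q}"
    have V: "open V"
      using open_vimage[OF oO, of "\<lambda>h. (h, y)"] by (simp add: V_def vimage_def continuous_on_Pair continuous_on_const continuous_on_id)
    have aV: "a \<in> V" using aD[OF y] by (simp add: V_def)
    have par: "h \<in> mchart L e ` mdom L e" "mpar (prod_manifold L S) (e, z) (h, y) = (mpar L e h, x)"
        "act (mpar L e h) x \<in> mdom S z" if h: "h \<in> V" for h
    proof -
      obtain k x' where k: "(k, x') \<in> W" "h = mchart L e k" "y = mchart S z x'"
        using h by (auto simp: V_def Q_def mchart_prod)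
      then have k': "k \<in> mdom L e" "x' \<in> mdom S z" "act k x' \<in> mdom S z" by (auto simp: W_def mdom_prod)
      show h': "h \<in> mchart L e ` mdom L e" using k k' by blast
      show "mpar (prod_manifold L S) (e, z) (h, y) = (mpar L e h, x)"
        using mpar_prod[OF L'(1) e S z h'] y by (simp add: D_def x_def)
      have "x' = x" using k(3) k'(2) mpar_mchart[OF S z] by (simp add: x_def)
      then show "act (mpar L e h) x \<in> mdom S z" using k'(1,3) k(2) mpar_mchart[OF L'(1) e] by simp
    qed
    have \<theta>V: "mpar S z (\<theta> (h, y)) = act (mpar L e h) x" if "h \<in> V" for h
      using par[OF that] mpar_mchart[OF S z] by (simp add: \<theta>_def)
    have oV: "((\<lambda>h. \<theta> (h, y)) has_derivative (\<lambda>\<xi>. frechet_derivative \<theta> (at (a, y)) (\<xi>, 0))) (at a)"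
      by (rule has_derivative_compose[of "\<lambda>h. (h, y)", OF _ smooth_on_has_derivative[OF \<theta> oO aD[OF y]]])
        (auto intro!: derivative_eq_intros)
    have pa: "mpar L e a = e" unfolding a_def by (rule mpar_mchart[OF L'(1) e smooth_manifoldD(2)[OF L'(1) e]])
    have \<theta>a: "\<theta> (a, y) = y"
      using par(2)[OF aV] pa act_e[OF xc] xd by (simp add: \<theta>_def)
    have yD: "y \<in> mchart S z ` mdom S z" using y by (simp add: D_def)
    \<comment> \<open>The generator at \<open>x\<close> is stored in the chart at \<open>x\<close>,
      whereas \<open>\<kappa> y\<close> refers to the chart at \<open>z\<close>; the derivative of
      this transition map converts the latter into the former.\<close>
    have ty: "((\<lambda>u. mchart S x (mpar S z u)) has_derivative frechet_derivative (\<lambda>u. mchart S x (mpar S z u)) (at y)) (at y)"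
      using has_derivative_into_chart[OF S smooth_mpar[OF S z] xc yD] smooth_manifoldD(2)[OF S xc]
      by (simp add: x_def)
    have "inf_generator L G S act \<xi> x = frechet_derivative (\<lambda>h. mchart S x (act (mpar L e h) x)) (at a) \<xi>"
      by (simp add: inf_generator_def mfderiv_def e_def[symmetric] act_e[OF xc] a_def o_def)
    also have "frechet_derivative (\<lambda>h. mchart S x (act (mpar L e h) x)) (at a)
      = frechet_derivative (\<lambda>h. mchart S x (mpar S z (\<theta> (h, y)))) (at a)"
      by (rule frechet_derivative_cong_open[OF V aV]) (simp add: \<theta>V)
    also have "\<dots> = (\<lambda>\<xi>. frechet_derivative (\<lambda>u. mchart S x (mpar S z u)) (at y) (frechet_derivative \<theta> (at (a, y)) (\<xi>, 0)))"
      by (rule frechet_derivative_at[symmetric], rule has_derivative_compose[OF oV]) (use ty in \<open>simp add: \<theta>a\<close>)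
    finally have "inf_generator L G S act \<xi> x = mfderiv vec_manifold S (mpar S z) y (\<kappa> y)"
      by (simp add: mfderiv_into x_def \<kappa>_def)
    then show ?thesis
      using mom xc by (simp add: contact_momentum_map_def \<eta>z_def pullback1_def x_def)
  qed
  have "smooth_on D (\<lambda>y. \<Sum>b\<in>Basis. (\<kappa> y \<bullet> b) *\<^sub>R \<eta>z y b)"
    unfolding \<eta>z_def D_def
    by (intro smooth_on_sum smooth_on_scaleR smooth_on_bounded_linear[OF _ bounded_linear_inner_left]
        D[unfolded D_def] \<kappa>[unfolded D_def] smooth_pullback1_mpar[OF S \<eta> z])
  moreover have "(\<Sum>b\<in>Basis. (\<kappa> y \<bullet> b) *\<^sub>R \<eta>z y b) = blinfun_apply (\<Phi> (mpar S z y)) \<xi>" if "y \<in> D" for y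
    using linear_euclidean_sum[OF linear_pullback1_mpar[OF S \<eta> z, of y], of "\<kappa> y"] that key[OF that]
    by (simp add: \<eta>z_def D_def)
  ultimately show ?thesis
    unfolding D_def[symmetric] by (rule smooth_on_cong_imp[OF D, rotated])
qed


section \<open>Level sets of rays\<close>

lemma tangent_setE:
  assumes "v \<in> tangent_set M Z z"
  obtains \<gamma> \<epsilon> where "\<epsilon> > 0" "smooth_map_on vec_manifold {-\<epsilon><..<\<epsilon>} M \<gamma>" "\<gamma> ` {-\<epsilon><..<\<epsilon>} \<subseteq> Z" "\<gamma> 0 = z"
    "v = mfderiv vec_manifold M \<gamma> 0 (1::real)"
  using assms unfolding tangent_set_def
  by blast

lemma ray_subset_span: "l \<in> ray \<mu> \<Longrightarrow> l \<in> span {\<mu>}"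
  by (auto simp: ray_def intro: span_scale span_base)

text \<open>Linear algebra only sees the line \<open>span {\<mu>}\<close>; this returns to the open
  ray. For nonzero \<open>\<mu>\<close>, a multiple of \<open>\<mu>\<close> at distance less than
  \<open>norm l0\<close> from \<open>l0\<close> has a positive coefficient. If
  \<open>l0 = 0\<close>, then \<open>\<mu> = 0\<close> and line and ray coincide, so the radius 1 is
  an arbitrary positive value.\<close>

lemma span_near_ray:
  fixes \<mu> :: "'d::real_normed_vector"
  assumes "l0 \<in> ray \<mu>" "l \<in> span {\<mu>}" "norm (l - l0) < (if l0 = 0 then 1 else norm l0)"
  shows "l \<in> ray \<mu>"
proof -
  obtain r where r: "r > 0" "l0 = r *\<^sub>R \<mu>" using assms(1) by (auto simp: ray_def)
  obtain c where c: "l = c *\<^sub>R \<mu>" using assms(2) by (auto simp: span_singleton)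
  show ?thesis
  proof (cases "\<mu> = 0")
    case True
    then show ?thesis using c by (auto simp: ray_def intro: exI[of _ 1])
  next
    case False
    have "norm (l - l0) = \<bar>c - r\<bar> * norm \<mu>" using r c by (simp flip: scaleR_diff_left)
    then have "\<bar>c - r\<bar> * norm \<mu> < r * norm \<mu>" using assms(3) r False by simp
    then have "c > 0" using False by simp
    then show ?thesis using c by (auto simp: ray_def)
  qed
qed

text \<open>\<open>\<pi>\<close> is a projection onto the preimage of \<open>span {\<mu>}\<close> under \<open>T\<close>.\<close>

lemma transverse_splitting:
  fixes T :: "'s::euclidean_space \<Rightarrow> 'd::real_vector"
  assumes T: "linear T" and tr: "{T v + c | v c. c \<in> span {\<mu>}} = UNIV"
  obtains P :: "'d \<Rightarrow> 's" and \<pi> where "linear P" "linear \<pi>" "\<And>l. P l = 0 \<longleftrightarrow> l \<in> span {\<mu>}" "\<And>v. P (T v) = v - \<pi> v"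
    "\<And>v. \<pi> (\<pi> v) = \<pi> v" "\<And>l. \<pi> (P l) = 0"
proof -
  define V where "V = {v. T v \<in> span {\<mu>}}"
  have V: "subspace V"
    unfolding V_def using linear_subspace_vimage[OF T subspace_span] by (simp add: vimage_def)
  obtain \<pi> where \<pi>: "range \<pi> \<subseteq> V" "linear \<pi>" "\<And>v. v \<in> V \<Longrightarrow> \<pi> v = v"
    using linear_exists_left_inverse_on[OF linear_id V] by auto
  define Q where "Q = (\<lambda>p. T (fst p) + snd p *\<^sub>R \<mu>)"
  have Q: "linear Q"
    unfolding Q_def by (rule linearI) (simp_all add: linear_add[OF T] linear_cmul[OF T] algebra_simps)
  have "surj Q"
    unfolding surj_def
  proof
    fix l
    have "l \<in> {T v + c | v c. c \<in> span {\<mu>}}" using tr by simp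
    then obtain v a where "l = T v + a *\<^sub>R \<mu>" by (auto simp: span_singleton)
    then show "\<exists>p. l = Q p" by (intro exI[of _ "(v, a)"]) (simp add: Q_def)
  qed
  then obtain R where R: "linear R" "Q \<circ> R = id" using linear_surjective_right_inverse[OF Q] by blast
  \<comment> \<open>\<open>T\<close> sends \<open>P0 l\<close> to \<open>l\<close> up to a multiple
    of \<open>\<mu>\<close>.\<close>
  define P0 where "P0 = (\<lambda>l. fst (R l))"
  have P0: "linear P0" unfolding P0_def using linear_compose[OF R(1) linear_fst] by (simp add: o_def)
  have TP0: "l - T (P0 l) \<in> span {\<mu>}" for l
  proof -
    have "T (P0 l) + snd (R l) *\<^sub>R \<mu> = l" using R(2) by (simp add: fun_eq_iff Q_def P0_def)
    then have "l - T (P0 l) = snd (R l) *\<^sub>R \<mu>" by (metis add_diff_cancel_left')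
    then show ?thesis by (auto simp: span_singleton)
  qed
  have \<pi>\<pi>: "\<pi> (\<pi> v) = \<pi> v" for v using \<pi> by blast
  have P0V: "P0 l \<in> V \<longleftrightarrow> l \<in> span {\<mu>}" for l
    unfolding V_def using TP0[of l] span_add[of "l - T (P0 l)" "{\<mu>}" "T (P0 l)"]
      span_diff[of l "{\<mu>}" "l - T (P0 l)"] by auto
  show thesis
  \<comment> \<open>Removing the part of \<open>P0 l\<close> in \<open>V\<close> gives a map
    vanishing exactly on \<open>span {\<mu>}\<close>, because \<open>P0 l\<close> lies in
    \<open>V\<close> exactly for \<open>l\<close> in that span.\<close>
  proof (rule that[of "\<lambda>l. P0 l - \<pi> (P0 l)" \<pi>])
    show "linear (\<lambda>l. P0 l - \<pi> (P0 l))"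
      by (rule linearI) (simp_all add: linear_add[OF P0] linear_add[OF \<pi>(2)] linear_cmul[OF P0] linear_cmul[OF \<pi>(2)] scaleR_diff_right)
    show "P0 l - \<pi> (P0 l) = 0 \<longleftrightarrow> l \<in> span {\<mu>}" for l
      using P0V[of l] \<pi>(1) \<pi>(3)[of "P0 l"] by (metis eq_iff_diff_eq_0 range_subsetD)
    show "P0 (T v) - \<pi> (P0 (T v)) = v - \<pi> v" for v
    proof -
      have "T (v - P0 (T v)) \<in> span {\<mu>}" using TP0[of "T v"] by (simp add: linear_diff[OF T])
      then have "\<pi> (v - P0 (T v)) = v - P0 (T v)" by (intro \<pi>(3)) (simp add: V_def)
      then show ?thesis by (simp add: linear_diff[OF \<pi>(2)] algebra_simps)
    qed
    show "\<pi> (P0 l - \<pi> (P0 l)) = 0" for l by (simp add: linear_diff[OF \<pi>(2)] \<pi>\<pi>)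
  qed (use \<pi>(2) \<pi>\<pi> in auto)
qed

text \<open>With \<open>P\<close> and \<open>\<pi>\<close> as above, \<open>F y = \<pi> (y - y\<^sub>0) + P (\<Phi> y)\<close> has derivative the identity at
  \<open>y\<^sub>0\<close> and maps the level set into the range of \<open>\<pi>\<close>; its local inverse composed with \<open>\<pi>\<close> is the
  parametrization.\<close>

lemma parametrized_at_ray_level:
  fixes S :: "('a, 's::euclidean_space) manifold"
    and \<Phi> :: "'a \<Rightarrow> 'l::{real_normed_vector, heine_borel} \<Rightarrow>\<^sub>L real"
  assumes S: "smooth_manifold S"
    and \<Phi>: "\<And>z \<xi>. z \<in> mcarrier S \<Longrightarrow> smooth_on (mchart S z ` mdom S z) (\<lambda>y. blinfun_apply (\<Phi> (mpar S z y)) \<xi>)"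
    and tr: "transverse_to_ray S \<Phi> \<mu>" and z: "z \<in> ray_level S \<Phi> \<mu>"
  shows "parametrized_at S (ray_level S \<Phi> \<mu>) z"
proof -
  have zc: "z \<in> mcarrier S" "\<Phi> z \<in> ray \<mu>" using z by (auto simp: ray_level_def)
  define D where "D = mchart S z ` mdom S z"
  define y0 where "y0 = mchart S z z"
  have D: "open D" "y0 \<in> D"
    using smooth_manifoldD(2,3)[OF S zc(1)] by (auto simp: D_def y0_def)
  have zy0: "mpar S z y0 = z"
    unfolding y0_def by (rule mpar_mchart[OF S zc(1) smooth_manifoldD(2)[OF S zc(1)]])
  define f where "f = (\<lambda>y. \<Phi> (mpar S z y))"
  have "smooth_on D (\<lambda>y. blinfun_apply (f y) \<xi>)" for \<xi>
    using \<Phi>[OF zc(1)] by (simp add: D_def f_def)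
  note sm = smooth_on_blinfun[OF D(1) this]
  define T where "T = frechet_derivative f (at y0)"
  have T: "linear T"
    unfolding T_def by (rule has_derivative_linear[OF smooth_on_has_derivative[OF sm(1) D]])
  have "mfderiv S vec_manifold \<Phi> z = T" by (simp add: mfderiv_out T_def f_def y0_def)
  then have surj: "{T v + c | v c. c \<in> span {\<mu>}} = UNIV"
    using tr z unfolding transverse_to_ray_def by auto
  obtain P :: "('l \<Rightarrow>\<^sub>L real) \<Rightarrow> 's" and \<pi> where P: "linear P" "linear \<pi>"
    "\<And>l. P l = 0 \<longleftrightarrow> l \<in> span {\<mu>}" "\<And>v. P (T v) = v - \<pi> v" "\<And>v. \<pi> (\<pi> v) = \<pi> v" "\<And>l. \<pi> (P l) = 0"
    by (rule transverse_splitting[OF T surj]) (rule that)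
  have b\<pi>: "bounded_linear \<pi>" using P(2) linear_conv_bounded_linear by blast
  note sP = sm(2)[OF P(1)] and dP = sm(3)[OF P(1) D(2), folded T_def]
  define F where "F = (\<lambda>y. (- \<pi> y0 + \<pi> y) + P (f y))"
  have sF: "smooth_on D F"
    unfolding F_def
    by (rule smooth_on_add[OF D(1) smooth_on_add[OF D(1) smooth_on_const
      smooth_on_bounded_linear[OF D(1) b\<pi> smooth_on_ident[OF D(1)]]] sP])
  have dF: "frechet_derivative F (at y0) v = v" for v
  proof -
    have "(F has_derivative (\<lambda>v. (0 + \<pi> v) + frechet_derivative (\<lambda>y. P (f y)) (at y0) v)) (at y0)"
      unfolding F_def
      by (intro has_derivative_add has_derivative_const bounded_linear_imp_has_derivative[OF b\<pi>]
          smooth_on_has_derivative[OF sP D])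
    from fun_cong[OF frechet_derivative_at[OF this], of v] show ?thesis by (simp add: dP P(4))
  qed
  have Pf0: "P (f y0) = 0" using zc(2) zy0 by (simp add: P(3) f_def ray_subset_span)
  then have F0: "F y0 = 0" by (simp add: F_def)
  from smooth_inverse_function[OF D(1) sF D(2) dF]
  obtain U' V h where V: "U' \<subseteq> D" "y0 \<in> U'" "open V" "homeomorphism U' V F h" "smooth_on V h"
    and dh: "\<And>v. frechet_derivative h (at 0) v = v"
    using F0 by metis
  have h: "0 \<in> V" "h 0 = y0" "\<And>a. a \<in> V \<Longrightarrow> h a \<in> D" "\<And>a. a \<in> V \<Longrightarrow> F (h a) = a"
    using V(1,2) F0 homeomorphism_image1[OF V(4)] homeomorphism_image2[OF V(4)]
      homeomorphism_apply1[OF V(4)] homeomorphism_apply2[OF V(4)] by (metis image_eqI, metis, blast, blast)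
  define V' where "V' = {a. \<pi> a \<in> V}"
  have V': "open V'"
    using open_vimage[OF V(3) linear_continuous_on[OF b\<pi>, of UNIV]] by (simp add: V'_def vimage_def)
  define k where "k = (\<lambda>a. h (\<pi> a))"
  have k: "smooth_on V' k"
    using smooth_on_compose_affine[OF V(3) b\<pi> V' V(5), of 0] by (simp add: k_def V'_def)
  have kD: "k a \<in> D" if "a \<in> V'" for a using that h(3) by (simp add: k_def V'_def)
  \<comment> \<open>The radius of \<open>span_near_ray\<close>: values this close to
    \<open>\<Phi> z\<close> that lie on the line also lie on the ray.\<close>
  define \<epsilon> where "\<epsilon> = (if \<Phi> z = 0 then 1 else norm (\<Phi> z))"
  define U where "U = {a \<in> V'. f (k a) \<in> ball (\<Phi> z) \<epsilon>}"
  have "continuous_on V' (\<lambda>a. f (k a))"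
    using continuous_on_compose2[OF smooth_on_imp_continuous_on[OF sm(1)] smooth_on_imp_continuous_on[OF k]] kD by blast
  from continuous_open_preimage[OF this V' open_ball] have U: "open U"
    by (simp add: U_def Int_def vimage_def)
  have \<pi>0: "\<pi> 0 = 0" by (rule linear_0[OF P(2)])
  have k0: "k 0 = y0" by (simp add: k_def \<pi>0 h(2))
  have "\<epsilon> > 0" by (simp add: \<epsilon>_def)
  then have U0: "0 \<in> U" using h(1) zy0 by (simp add: U_def V'_def \<pi>0 k0 f_def)
  have level: "mpar S z (k a) \<in> ray_level S \<Phi> \<mu>" if a: "a \<in> U" for a
  proof -
    have a': "a \<in> V'" "\<pi> a \<in> V" "dist (\<Phi> z) (f (k a)) < \<epsilon>" using a by (auto simp: U_def V'_def)
    \<comment> \<open>As \<open>h\<close> inverts \<open>F\<close>, the value of \<open>F\<close>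
      lies in the range of \<open>\<pi>\<close> and is fixed by \<open>\<pi>\<close>. Its summand
      \<open>P (f (k a))\<close> is killed by \<open>\<pi>\<close>, while the other summands are
      fixed, so that summand vanishes.\<close>
    have "F (k a) = \<pi> a" using h(4)[OF a'(2)] by (simp add: k_def)
    then have "\<pi> (F (k a)) = F (k a)" by (simp add: P(5))
    then have "P (f (k a)) = 0" by (simp add: F_def linear_add[OF P(2)] linear_diff[OF P(2)] P(5,6))
    then have "f (k a) \<in> span {\<mu>}" by (simp add: P(3))
    then have "f (k a) \<in> ray \<mu>"
      by (rule span_near_ray[OF zc(2)]) (use a'(3) in \<open>simp add: \<epsilon>_def dist_norm norm_minus_commute\<close>)
    moreover have "mpar S z (k a) \<in> mcarrier S"
      using mchart_mpar(2)[OF kD[OF a'(1), unfolded D_def]] mdom_subset[OF S zc(1)] by blast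
    ultimately show ?thesis by (simp add: ray_level_def f_def)
  qed
  have kU: "smooth_on U k" using k by (rule smooth_on_subset) (auto simp: U_def)
  have kUD: "k ` U \<subseteq> mchart S z ` mdom S z" using kD by (auto simp: U_def D_def)
  note comp = smooth_into_compose[OF S smooth_mpar[OF S zc(1)] U kU kUD]
  have "(k has_derivative (\<lambda>v. frechet_derivative h (at (\<pi> 0)) (\<pi> v))) (at 0)"
    unfolding k_def
    by (rule has_derivative_compose[OF bounded_linear_imp_has_derivative[OF b\<pi>]])
      (use smooth_on_has_derivative[OF V(5,3) h(1)] in \<open>simp add: \<pi>0\<close>)
  from fun_cong[OF frechet_derivative_at[OF this]] have dk: "frechet_derivative k (at 0) v = \<pi> v" for v
    by (simp add: \<pi>0 dh)
  have d\<Psi>: "mfderiv vec_manifold S (\<lambda>a. mpar S z (k a)) 0 v = \<pi> v" for v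
    using comp(2)[OF U0] mfderiv_mpar_at[OF S zc(1)] by (simp add: k0 y0_def dk)
  \<comment> \<open>Along a curve in the level set \<open>P\<close> of the momentum is constantly 0.
    Its derivative is \<open>P (T v) = v - \<pi> v\<close>.\<close>
  have tan: "\<pi> v = v" if tangent: "v \<in> tangent_set S (ray_level S \<Phi> \<mu>) z" for v
  proof -
    obtain \<gamma> \<delta> where \<gamma>: "\<delta> > 0" "smooth_map_on vec_manifold {-\<delta><..<\<delta>} S \<gamma>"
      "\<gamma> ` {-\<delta><..<\<delta>} \<subseteq> ray_level S \<Phi> \<mu>" "\<gamma> 0 = z" "v = mfderiv vec_manifold S \<gamma> 0 (1::real)"
      using tangent by (rule tangent_setE)
    define I where "I = {t \<in> {-\<delta><..<\<delta>}. \<gamma> t \<in> mdom S z}"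
    define c where "c = (\<lambda>t. mchart S z (\<gamma> t))"
    have I: "open I" unfolding I_def by (rule smooth_into_chart(1)[OF S \<gamma>(2) zc(1)])
    have I0: "0 \<in> I" using \<gamma>(1,4) smooth_manifoldD(2)[OF S zc(1)] by (simp add: I_def)
    have dc: "(c has_derivative frechet_derivative c (at 0)) (at 0)"
      unfolding c_def by (rule has_derivative_into_chart[OF S \<gamma>(2) zc(1)]) (use I0 in \<open>auto simp: I_def\<close>)
    have c0: "c 0 = y0" by (simp add: c_def \<gamma>(4) y0_def)
    have v: "frechet_derivative c (at 0) 1 = v"
      by (simp add: \<gamma>(5) mfderiv_into c_def \<gamma>(4))
    have "((\<lambda>t. P (f (c t))) has_derivative (\<lambda>t. frechet_derivative (\<lambda>y. P (f y)) (at y0) (frechet_derivative c (at 0) t))) (at 0)"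
      by (rule has_derivative_compose[OF dc]) (simp add: c0 smooth_on_has_derivative[OF sP D])
    moreover have "((\<lambda>t. P (f (c t))) has_derivative (\<lambda>t. 0)) (at 0)"
    proof (rule has_derivative_transform_within_open[OF has_derivative_const[of 0] I I0])
      fix t assume t: "t \<in> I"
      then have "f (c t) = \<Phi> (\<gamma> t)" "\<gamma> t \<in> ray_level S \<Phi> \<mu>"
        using mpar_mchart[OF S zc(1)] \<gamma>(3) by (auto simp: f_def c_def I_def)
      then show "0 = P (f (c t))" using P(3) ray_subset_span by (force simp: ray_level_def)
    qed
    ultimately have "frechet_derivative (\<lambda>y. P (f y)) (at y0) (frechet_derivative c (at 0) 1) = 0"
      using has_derivative_unique by metis
    then show "\<pi> v = v" by (simp add: v dP P(4))
  qed
  show ?thesis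
    unfolding parametrized_at_def
    using U0 comp(1) level d\<Psi> tan k0 zy0 by (intro exI[of _ U] exI[of _ "\<lambda>a. mpar S z (k a)"]) auto
qed


section \<open>The cone of a manifold\<close>

lemma half_line_simps [simp]:
  "mtop half_line = top_of_set {0<..}" "mdom half_line r = {0<..}" "mchart half_line r = (\<lambda>s. s)"
  "mcarrier half_line = {0<..}"
  by (auto simp: half_line_def mcarrier_def)

lemma mpar_half_line [simp]: "s > 0 \<Longrightarrow> mpar half_line r s = s"
  unfolding mpar_def by (rule inv_into_f_eq) auto

lemma smooth_manifold_half_line: "smooth_manifold half_line"
  unfolding smooth_manifold_def
proof (intro conjI ballI)
  show "second_countable (mtop half_line)"
  proof -
    obtain \<B> :: "real set set" where B: "countable \<B>" "\<And>C. C \<in> \<B> \<Longrightarrow> open C"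
      "\<And>S. open S \<Longrightarrow> \<exists>U. U \<subseteq> \<B> \<and> S = \<Union>U"
      using univ_second_countable by blast
    have "\<exists>V\<in>\<B>. x \<in> V \<and> V \<subseteq> U" if "open U" "x \<in> U" for U x
      using B(3)[OF that(1)] that(2) by blast
    then have "second_countable (euclidean :: real topology)"
      using B(1,2) unfolding second_countable_def by (intro exI[of _ \<B>]) auto
    then show ?thesis using second_countable_subtopology by simp
  qed
  show "homeomorphic_map (subtopology (mtop half_line) (mdom half_line p))
      (top_of_set (mchart half_line p ` mdom half_line p)) (mchart half_line p)" for p
    using homeomorphic_map_id[of "top_of_set {0::real<..}" "top_of_set {0::real<..}"]
    by (simp add: subtopology_subtopology id_def)
  show "smooth_on (mchart half_line p ` (mdom half_line p \<inter> mdom half_line q)) (mchart half_line q \<circ> mpar half_line p)"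
    for p q
    by (rule smooth_on_cong_imp[OF _ _ smooth_on_ident]) auto
qed (auto simp: Hausdorff_space_subtopology)

lemma smooth_manifold_riem_cone: "smooth_manifold S \<Longrightarrow> smooth_manifold (riem_cone S)"
  unfolding riem_cone_def by (rule smooth_manifold_prod[OF _ smooth_manifold_half_line])

lemma riem_cone_simps:
  "mcarrier (riem_cone S) = mcarrier S \<times> {0<..}" "mdom (riem_cone S) (x, r) = mdom S x \<times> {0<..}"
  "mchart (riem_cone S) (x, r) (y, s) = (mchart S x y, s)"
  "mtop (riem_cone S) = prod_topology (mtop S) (top_of_set {0<..})"
  by (simp_all add: riem_cone_def mcarrier_prod mdom_prod mchart_prod mtop_prod)

lemma mchart_riem_cone_image:
  "mchart (riem_cone S) (x, r) ` (A \<times> B) = (mchart S x ` A) \<times> B"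
  by (auto simp: riem_cone_simps image_iff)

lemma mpar_riem_cone:
  assumes "smooth_manifold S" "x \<in> mcarrier S" "r > 0" "y \<in> mchart S x ` mdom S x" "s > 0"
  shows "mpar (riem_cone S) (x, r) (y, s) = (mpar S x y, s)"
  unfolding riem_cone_def
  using mpar_prod[OF assms(1,2) smooth_manifold_half_line, of r y s] assms by simp

section \<open>Liouville form and metric of the cone\<close>

lemma linear_liouville: "linear (\<beta> x) \<Longrightarrow> linear (liouville \<beta> (x, r))"
  unfolding liouville_def by (rule linearI) (auto simp: linear_add linear_cmul distrib_left)

lemma smooth_on_liouville:
  assumes D: "open D" and \<beta>: "\<And>v. smooth_on D (\<lambda>u. \<beta> u v)"
  shows "smooth_on (D \<times> {0<..}) (\<lambda>p. liouville \<beta> p v)"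
proof -
  have o: "open (D \<times> {0::real<..})" using D by (simp add: open_Times)
  have "smooth_on (D \<times> {0::real<..}) (\<lambda>p. snd p * snd p * \<beta> (0 + fst p) (fst v))"
    by (intro smooth_on_bounded_bilinear[OF o bounded_bilinear_mult]
        smooth_on_bounded_linear[OF o bounded_linear_snd smooth_on_ident[OF o]]
        smooth_on_compose_affine[OF D bounded_linear_fst o \<beta>]) auto
  then show ?thesis by (simp add: liouville_def case_prod_unfold power2_eq_square)
qed

lemma two_form_ext_d_liouville:
  assumes D: "open D" and lin: "\<And>u. u \<in> D \<Longrightarrow> linear (\<beta> u)" and \<beta>: "\<And>v. smooth_on D (\<lambda>u. \<beta> u v)"
  shows "p \<in> D \<times> {0<..} \<Longrightarrow> bilinear (ext_d (liouville \<beta>) p)"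
    and "smooth_on (D \<times> {0<..}) (\<lambda>p. ext_d (liouville \<beta>) p v w)"
proof -
  have o: "open (D \<times> {0::real<..})" using D by (simp add: open_Times)
  have l: "linear (liouville \<beta> p)" if "p \<in> D \<times> {0<..}" for p
    using that linear_liouville[OF lin] by auto
  show "bilinear (ext_d (liouville \<beta>) p)" if "p \<in> D \<times> {0<..}"
    by (rule bilinear_ext_d[OF o that l smooth_on_liouville[OF D \<beta>]])
  show "smooth_on (D \<times> {0<..}) (\<lambda>p. ext_d (liouville \<beta>) p v w)"
    by (rule smooth_on_ext_d[OF o smooth_on_liouville[OF D \<beta>]])
qed

lemma smooth_on_cone_metric:
  assumes D: "open D" and g: "\<And>v w. smooth_on D (\<lambda>u. g u v w)"
  shows "smooth_on (D \<times> {0<..}) (\<lambda>p. cone_metric g p v w)"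
proof -
  have o: "open (D \<times> {0::real<..})" using D by (simp add: open_Times)
  have "smooth_on (D \<times> {0::real<..}) (\<lambda>p. snd p * snd p * g (0 + fst p) (fst v) (fst w) + snd v * snd w)"
    by (intro smooth_on_add[OF o] smooth_on_const smooth_on_bounded_bilinear[OF o bounded_bilinear_mult]
        smooth_on_bounded_linear[OF o bounded_linear_snd smooth_on_ident[OF o]]
        smooth_on_compose_affine[OF D bounded_linear_fst o g]) auto
  then show ?thesis by (simp add: cone_metric_def case_prod_unfold power2_eq_square)
qed

lemma cone_metric_positive:
  assumes "bilinear (g x)" "\<And>v. v \<noteq> 0 \<Longrightarrow> g x v v > 0" "r > 0"
  shows "bilinear (cone_metric g (x, r))" "p \<noteq> 0 \<Longrightarrow> cone_metric g (x, r) p p > 0"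
proof -
  note b = assms(1)
  show "bilinear (cone_metric g (x, r))"
    unfolding bilinear_def cone_metric_def
    by (intro conjI allI linearI)
      (auto simp: bilinear_ladd[OF b] bilinear_radd[OF b] bilinear_lmul[OF b] bilinear_rmul[OF b] algebra_simps)
  show "cone_metric g (x, r) p p > 0" if p: "p \<noteq> 0"
  proof -
    obtain v a where va: "p = (v, a)" by fastforce
    show ?thesis
    proof (cases "v = 0")
      case True
      then show ?thesis using p by (simp add: va cone_metric_def bilinear_lzero[OF b] zero_prod_def)
          (metis not_real_square_gt_zero)
    next
      case False
      then have "r\<^sup>2 * g x v v > 0" using assms(2,3) by simp
      then show ?thesis by (simp add: va cone_metric_def add_pos_nonneg)
    qed
  qed
qed

lemma ray_level_cone:
  fixes \<Phi> :: "'a \<Rightarrow> 'd::real_vector"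
  shows "ray_level (riem_cone S) (cone_momentum \<Phi>) \<mu> = ray_level S \<Phi> \<mu> \<times> {0<..}"
proof -
  have "r\<^sup>2 *\<^sub>R l \<in> ray \<mu> \<longleftrightarrow> l \<in> ray \<mu>" if "r > 0" for r :: real and l :: 'd
  proof
    assume "r\<^sup>2 *\<^sub>R l \<in> ray \<mu>"
    then obtain s where s: "s > 0" "r\<^sup>2 *\<^sub>R l = s *\<^sub>R \<mu>" by (auto simp: ray_def)
    then have "(1 / r\<^sup>2) *\<^sub>R (r\<^sup>2 *\<^sub>R l) = (1 / r\<^sup>2) *\<^sub>R (s *\<^sub>R \<mu>)" by simp
    then have "l = (s / r\<^sup>2) *\<^sub>R \<mu>" using \<open>r > 0\<close> by simp
    then show "l \<in> ray \<mu>" using s \<open>r > 0\<close> by (auto simp: ray_def)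
  next
    assume "l \<in> ray \<mu>"
    then obtain s where "s > 0" "l = s *\<^sub>R \<mu>" by (auto simp: ray_def)
    then show "r\<^sup>2 *\<^sub>R l \<in> ray \<mu>"
      using \<open>r > 0\<close> unfolding ray_def by (intro CollectI exI[of _ "r\<^sup>2 * s"]) simp
  qed
  then show ?thesis
    unfolding ray_level_def by (auto simp: riem_cone_simps cone_momentum_def)
qed

section \<open>Maps into and out of the cone\<close>

context
  fixes S :: "('a, 's::euclidean_space) manifold"
  assumes S: "smooth_manifold S"
begin

lemma smooth_into_coneI:
  fixes U :: "'u::real_normed_vector set"
  assumes \<sigma>: "smooth_map_on vec_manifold U S \<sigma>" and \<rho>: "smooth_on U \<rho>" "\<forall>x\<in>U. \<rho> x > 0"
  shows "smooth_map_on vec_manifold U (riem_cone S) (\<lambda>x. (\<sigma> x, \<rho> x))"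
    and "x \<in> U \<Longrightarrow> mfderiv vec_manifold (riem_cone S) (\<lambda>x. (\<sigma> x, \<rho> x)) x v
      = (mfderiv vec_manifold S \<sigma> x v, frechet_derivative \<rho> (at x) v)"
proof -
  have U: "open U" and c\<sigma>: "continuous_map (top_of_set U) (mtop S) \<sigma>" using \<sigma> by (auto simp: smooth_map_into_iff)
  have "continuous_map (top_of_set U) (top_of_set {0<..}) \<rho>"
    using smooth_on_imp_continuous_on[OF \<rho>(1)] \<rho>(2) by (auto simp: continuous_map_in_subtopology)
  with c\<sigma> have "continuous_map (top_of_set U) (mtop (riem_cone S)) (\<lambda>x. (\<sigma> x, \<rho> x))"
    unfolding riem_cone_simps by (rule continuous_map_pairedI)
  moreover have "smooth_on {x \<in> U. (\<sigma> x, \<rho> x) \<in> mdom (riem_cone S) q} (\<lambda>x. mchart (riem_cone S) q (\<sigma> x, \<rho> x))"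
    if "q \<in> mcarrier (riem_cone S)" for q
  proof -
    obtain y s where q: "q = (y, s)" "y \<in> mcarrier S" using \<open>q \<in> mcarrier (riem_cone S)\<close> by (auto simp: riem_cone_simps)
    have "{x \<in> U. (\<sigma> x, \<rho> x) \<in> mdom (riem_cone S) q} = {x \<in> U. \<sigma> x \<in> mdom S y}"
      using \<rho>(2) by (auto simp: q(1) riem_cone_simps)
    moreover have "smooth_on {x \<in> U. \<sigma> x \<in> mdom S y} \<rho>" using \<rho>(1) by (rule smooth_on_subset) auto
    ultimately show ?thesis
      using smooth_on_Pair[OF smooth_into_chart[OF S \<sigma> q(2)]] by (simp add: q(1) riem_cone_simps)
  qed
  ultimately show "smooth_map_on vec_manifold U (riem_cone S) (\<lambda>x. (\<sigma> x, \<rho> x))"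
    using U by (simp add: smooth_map_into_iff)
  show "mfderiv vec_manifold (riem_cone S) (\<lambda>x. (\<sigma> x, \<rho> x)) x v
      = (mfderiv vec_manifold S \<sigma> x v, frechet_derivative \<rho> (at x) v)" if x: "x \<in> U"
  proof -
    have c: "\<sigma> x \<in> mcarrier S" by (rule smooth_into_carrier[OF \<sigma> x])
    have "((\<lambda>y. (mchart S (\<sigma> x) (\<sigma> y), \<rho> y)) has_derivative
       (\<lambda>v. (frechet_derivative (\<lambda>y. mchart S (\<sigma> x) (\<sigma> y)) (at x) v, frechet_derivative \<rho> (at x) v))) (at x)"
      by (rule has_derivative_Pair[OF has_derivative_into_chart[OF S \<sigma> c x smooth_manifoldD(2)[OF S c]]
            smooth_on_has_derivative[OF \<rho>(1) U x]])
    from fun_cong[OF frechet_derivative_at[OF this], of v, symmetric] show ?thesis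
      by (simp add: mfderiv_into riem_cone_simps)
  qed
qed

lemma smooth_into_coneD:
  fixes U :: "'u::real_normed_vector set"
  assumes \<sigma>: "smooth_map_on vec_manifold U (riem_cone S) \<sigma>"
  shows "smooth_map_on vec_manifold U S (\<lambda>x. fst (\<sigma> x))" "smooth_on U (\<lambda>x. snd (\<sigma> x))"
    "\<forall>x\<in>U. snd (\<sigma> x) > 0"
proof -
  have U: "open U" and c\<sigma>: "continuous_map (top_of_set U) (prod_topology (mtop S) (top_of_set {0<..})) \<sigma>"
    using \<sigma> by (auto simp: smooth_map_into_iff riem_cone_simps)
  show pos: "\<forall>x\<in>U. snd (\<sigma> x) > 0"
    using smooth_into_carrier[OF \<sigma>] by (auto simp: riem_cone_simps mem_Times_iff)
  note C = smooth_manifold_riem_cone[OF S]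
  have s: "smooth_on {x \<in> U. fst (\<sigma> x) \<in> mdom S q} (\<lambda>x. (mchart S q (fst (\<sigma> x)), snd (\<sigma> x)))"
      "open {x \<in> U. fst (\<sigma> x) \<in> mdom S q}" if q: "q \<in> mcarrier S" for q
  proof -
    have q': "(q, 1) \<in> mcarrier (riem_cone S)" using q by (simp add: riem_cone_simps)
    have e: "{x \<in> U. \<sigma> x \<in> mdom (riem_cone S) (q, 1)} = {x \<in> U. fst (\<sigma> x) \<in> mdom S q}"
      using pos by (auto simp: riem_cone_simps mem_Times_iff)
    have m: "mchart (riem_cone S) (q, 1) (\<sigma> x) = (mchart S q (fst (\<sigma> x)), snd (\<sigma> x))" for x
      by (metis prod.collapse riem_cone_simps(3))
    have "smooth_on {x \<in> U. \<sigma> x \<in> mdom (riem_cone S) (q, 1)} (\<lambda>x. mchart (riem_cone S) (q, 1) (\<sigma> x))"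
      using \<sigma> q' unfolding smooth_map_into_iff by blast
    then show "smooth_on {x \<in> U. fst (\<sigma> x) \<in> mdom S q} (\<lambda>x. (mchart S q (fst (\<sigma> x)), snd (\<sigma> x)))"
      unfolding e m .
    show "open {x \<in> U. fst (\<sigma> x) \<in> mdom S q}"
      using open_preimage_into[OF \<sigma> smooth_manifoldD(1)[OF C q']] unfolding e .
  qed
  have "continuous_map (top_of_set U) (mtop S) (fst \<circ> \<sigma>)"
    using c\<sigma> continuous_map_fst by (rule continuous_map_compose)
  moreover have "smooth_on {x \<in> U. fst (\<sigma> x) \<in> mdom S q} (\<lambda>x. mchart S q (fst (\<sigma> x)))" if q: "q \<in> mcarrier S" for q
    using smooth_on_bounded_linear[OF s(2)[OF q] bounded_linear_fst s(1)[OF q]] by simp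
  ultimately show "smooth_map_on vec_manifold U S (\<lambda>x. fst (\<sigma> x))"
    using U by (simp add: smooth_map_into_iff o_def)
  show "smooth_on U (\<lambda>x. snd (\<sigma> x))"
  proof (rule smooth_on_local)
    fix x assume x: "x \<in> U"
    have q: "fst (\<sigma> x) \<in> mcarrier S" using smooth_into_carrier[OF \<sigma> x] by (auto simp: riem_cone_simps mem_Times_iff)
    have "smooth_on {y \<in> U. fst (\<sigma> y) \<in> mdom S (fst (\<sigma> x))} (\<lambda>x. snd (\<sigma> x))"
      using smooth_on_bounded_linear[OF s(2)[OF q] bounded_linear_snd s(1)[OF q]] by simp
    then show "\<exists>V. open V \<and> x \<in> V \<and> smooth_on V (\<lambda>x. snd (\<sigma> x))"
      using s(2)[OF q] x smooth_manifoldD(2)[OF S q] by blast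
  qed
qed

lemma tangent_set_cone:
  assumes r: "r > 0"
  shows "tangent_set (riem_cone S) (Z \<times> {0<..}) (x, r) = tangent_set S Z x \<times> UNIV"
proof (rule subset_antisym; rule subsetI)
  fix p assume "p \<in> tangent_set (riem_cone S) (Z \<times> {0<..}) (x, r)"
  then obtain \<gamma> \<epsilon> where \<gamma>: "\<epsilon> > 0" "smooth_map_on vec_manifold {-\<epsilon><..<\<epsilon>} (riem_cone S) \<gamma>"
    "\<gamma> ` {-\<epsilon><..<\<epsilon>} \<subseteq> Z \<times> {0<..}" "\<gamma> 0 = (x, r)" "p = mfderiv vec_manifold (riem_cone S) \<gamma> 0 (1::real)"
    by (rule tangent_setE)
  note d = smooth_into_coneD[OF \<gamma>(2)]
  have "p = (mfderiv vec_manifold S (\<lambda>x. fst (\<gamma> x)) 0 1, frechet_derivative (\<lambda>x. snd (\<gamma> x)) (at 0) 1)"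
    using smooth_into_coneI(2)[OF d, of 0] \<gamma>(1,5) by simp
  moreover have "mfderiv vec_manifold S (\<lambda>x. fst (\<gamma> x)) 0 (1::real) \<in> tangent_set S Z x"
    unfolding tangent_set_def
    using \<gamma>(1,3,4) d(1) by (intro CollectI exI[of _ "\<lambda>x. fst (\<gamma> x)"] exI[of _ \<epsilon>]) force
  ultimately show "p \<in> tangent_set S Z x \<times> UNIV" by simp
next
  fix p assume "p \<in> tangent_set S Z x \<times> (UNIV :: real set)"
  then obtain v a where p: "p = (v, a)" "v \<in> tangent_set S Z x" by blast
  obtain \<gamma> \<epsilon> where \<gamma>: "\<epsilon> > 0" "smooth_map_on vec_manifold {-\<epsilon><..<\<epsilon>} S \<gamma>"
    "\<gamma> ` {-\<epsilon><..<\<epsilon>} \<subseteq> Z" "\<gamma> 0 = x" "v = mfderiv vec_manifold S \<gamma> 0 (1::real)"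
    using p(2) by (rule tangent_setE)
  \<comment> \<open>The second bound keeps \<open>r + t * a\<close> positive; the summand 1 avoids a
    zero denominator for \<open>a = 0\<close>.\<close>
  define \<delta> where "\<delta> = min \<epsilon> (r / (\<bar>a\<bar> + 1))"
  have \<delta>: "\<delta> > 0" "\<delta> \<le> \<epsilon>" using \<gamma>(1) r by (auto simp: \<delta>_def)
  have pos: "\<forall>t\<in>{-\<delta><..<\<delta>}. r + t * a > 0"
  proof
    fix t assume that: "t \<in> {-\<delta><..<\<delta>}"
    have "\<bar>t * a\<bar> \<le> \<bar>t\<bar> * (\<bar>a\<bar> + 1)" by (simp add: abs_mult mult_left_mono)
    also have "\<dots> < r / (\<bar>a\<bar> + 1) * (\<bar>a\<bar> + 1)"
      by (rule mult_strict_right_mono) (use that in \<open>auto simp: \<delta>_def\<close>)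
    finally show "r + t * a > 0" by (simp add: abs_if split: if_splits)
  qed
  have \<gamma>\<delta>: "smooth_map_on vec_manifold {-\<delta><..<\<delta>} S \<gamma>"
    by (rule smooth_map_into_subset[OF \<gamma>(2)]) (use \<delta> in auto)
  have s: "smooth_on {-\<delta><..<\<delta>} (\<lambda>t. r + t * a)"
    using smooth_on_add[OF open_greaterThanLessThan smooth_on_const
        smooth_on_bounded_linear[OF open_greaterThanLessThan bounded_linear_mult_left smooth_on_ident[OF open_greaterThanLessThan]]] .
  note c = smooth_into_coneI[OF \<gamma>\<delta> s pos]
  have "((\<lambda>t. r + t * a) has_derivative (\<lambda>t. t * a)) (at 0)"
    by (auto intro!: derivative_eq_intros)
  from fun_cong[OF frechet_derivative_at[OF this], of 1, symmetric]
  have "p = mfderiv vec_manifold (riem_cone S) (\<lambda>t. (\<gamma> t, r + t * a)) 0 1"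
    using c(2)[of 0 1] \<delta>(1) by (simp add: p(1) \<gamma>(5))
  then show "p \<in> tangent_set (riem_cone S) (Z \<times> {0<..}) (x, r)"
    unfolding tangent_set_def
    using \<delta> c(1) pos \<gamma>(3,4)
    by (intro CollectI exI[of _ "\<lambda>t. (\<gamma> t, r + t * a)"] exI[of _ \<delta>]) force
qed

lemma parametrized_at_cone:
  assumes "parametrized_at S Z x" and r: "r > 0"
  shows "parametrized_at (riem_cone S) (Z \<times> {0<..}) (x, r)"
proof -
  obtain U :: "'s set" and \<Psi> where U: "0 \<in> U" "smooth_map_on vec_manifold U S \<Psi>" "\<Psi> ` U \<subseteq> Z" "\<Psi> 0 = x"
    and id: "\<And>v. v \<in> tangent_set S Z x \<Longrightarrow> mfderiv vec_manifold S \<Psi> 0 v = v"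
    using assms(1) unfolding parametrized_at_def by blast
  have oU: "open U" using U(2) by (simp add: smooth_map_into_iff)
  \<comment> \<open>The radius is written as \<open>r + snd p\<close>, which puts
    \<open>(x, r)\<close> at the origin of the model space.\<close>
  define V where "V = U \<times> {-r<..}"
  have V: "open V" using oU by (simp add: V_def open_Times)
  have f: "smooth_on V fst" and s: "smooth_on V (\<lambda>p. r + snd p)"
    using smooth_on_bounded_linear[OF V bounded_linear_fst smooth_on_ident[OF V]]
      smooth_on_add[OF V smooth_on_const smooth_on_bounded_linear[OF V bounded_linear_snd smooth_on_ident[OF V]]] by auto
  have fV: "fst ` V \<subseteq> U" by (auto simp: V_def)
  note c = smooth_into_compose[OF S U(2) V f fV]
  have pos: "\<forall>p\<in>V. r + snd p > 0" by (auto simp: V_def)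
  note d = smooth_into_coneI[OF c(1) s pos]
  have V0: "0 \<in> V" using U(1) r by (simp add: V_def zero_prod_def)
  have df: "frechet_derivative fst (at p) = fst" for p :: "'s \<times> real"
    by (rule frechet_derivative_at[symmetric]) (auto intro!: derivative_eq_intros)
  have "((\<lambda>p. r + snd p) has_derivative snd) (at p)" for p :: "'s \<times> real"
    by (auto intro!: derivative_eq_intros)
  from frechet_derivative_at[OF this, symmetric] have ds: "frechet_derivative (\<lambda>p. r + snd p) (at p) = snd" for p :: "'s \<times> real"
    by simp
  have "mfderiv vec_manifold (riem_cone S) (\<lambda>p. (\<Psi> (fst p), r + snd p)) 0 v = v"
    if "v \<in> tangent_set (riem_cone S) (Z \<times> {0<..}) (x, r)" for v
    using that id d(2)[OF V0, of v] c(2)[OF V0, of v] by (auto simp: tangent_set_cone[OF r] df ds)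
  moreover have "(\<lambda>p. (\<Psi> (fst p), r + snd p)) ` V \<subseteq> Z \<times> {0<..}" using U(3) by (auto simp: V_def)
  ultimately show ?thesis
    unfolding parametrized_at_def
    using V0 d(1) U(4) by (intro exI[of _ V] exI[of _ "\<lambda>p. (\<Psi> (fst p), r + snd p)"]) simp
qed

text \<open>In charts the inclusion of the slice at radius \<open>r\<close> is affine, so
  \<open>smooth_on_compose_affine\<close> applies. The map \<open>A\<close> is there to extract the
  first component of \<open>f\<close>.\<close>

lemma smooth_out_slice:
  fixes f :: "'a \<times> real \<Rightarrow> 'q::real_normed_vector"
  assumes f: "smooth_map_on (riem_cone S) W vec_manifold f" and r: "r > 0" and A: "bounded_linear A"
  shows "smooth_map_on S {x. (x, r) \<in> W} vec_manifold (\<lambda>x. A (f (x, r)))"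
  unfolding smooth_map_out_iff
proof (intro conjI ballI)
  have oW: "openin (prod_topology (mtop S) (top_of_set {0<..})) W"
    and cf: "continuous_map (subtopology (prod_topology (mtop S) (top_of_set {0<..})) W) euclidean f"
    using f by (auto simp: smooth_map_out_iff riem_cone_simps)
  have sub: "W \<subseteq> mcarrier S \<times> {0<..}" using openin_subset[OF oW] by (auto simp: mcarrier_def)
  have cr: "continuous_map (mtop S) (prod_topology (mtop S) (top_of_set {0<..})) (\<lambda>x. (x, r))"
    using r by (intro continuous_map_pairedI) auto
  have "{x \<in> topspace (mtop S). (x, r) \<in> W} = {x. (x, r) \<in> W}" using sub by (auto simp: mcarrier_def)
  then show oWr: "openin (mtop S) {x. (x, r) \<in> W}"
    using openin_continuous_map_preimage[OF cr oW] by simp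
  have "continuous_map (subtopology (mtop S) {x. (x, r) \<in> W}) euclidean (A \<circ> (f \<circ> (\<lambda>x. (x, r))))"
  proof (intro continuous_map_compose)
    show "continuous_map (subtopology (mtop S) {x. (x, r) \<in> W}) (subtopology (prod_topology (mtop S) (top_of_set {0<..})) W) (\<lambda>x. (x, r))"
      using continuous_map_from_subtopology[OF cr] by (auto simp: continuous_map_in_subtopology)
    show "continuous_map euclidean euclidean A" using linear_continuous_on[OF A, of UNIV] by simp
  qed (rule cf)
  then show "continuous_map (subtopology (mtop S) {x. (x, r) \<in> W}) euclidean (\<lambda>x. A (f (x, r)))" by (simp add: o_def)
  fix p assume p: "p \<in> {x. (x, r) \<in> W}"
  have pc: "p \<in> mcarrier S" using p sub by auto
  have C: "smooth_manifold (riem_cone S)" by (rule smooth_manifold_riem_cone[OF S])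
  define D where "D = mchart (riem_cone S) (p, r) ` (W \<inter> mdom (riem_cone S) (p, r))"
  define E where "E = mchart S p ` ({x. (x, r) \<in> W} \<inter> mdom S p)"
  have pr: "(p, r) \<in> mcarrier (riem_cone S)" using pc r by (simp add: riem_cone_simps)
  have oD: "open D" unfolding D_def by (rule open_chart_image[OF C pr]) (use oW in \<open>simp add: riem_cone_simps\<close>)
  have oE: "open E" unfolding E_def by (rule open_chart_image[OF S pc oWr])
  have ED: "(0, r) + (y, 0) \<in> D" if y: "y \<in> E" for y
  proof -
    obtain x where "(x, r) \<in> W" "x \<in> mdom S p" "y = mchart S p x" using y by (auto simp: E_def)
    then show ?thesis unfolding D_def using r
      by (intro image_eqI[of _ _ "(x, r)"]) (auto simp: riem_cone_simps)
  qed
  have bl: "bounded_linear (\<lambda>y::'s. (y, 0::real))"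
    by (intro bounded_linear_Pair bounded_linear_ident bounded_linear_zero)
  have "smooth_on D (\<lambda>y. f (mpar (riem_cone S) (p, r) y))"
    using f p unfolding smooth_map_out_iff D_def by blast
  from smooth_on_compose_affine[OF oD bl oE this ED]
  have "smooth_on E (\<lambda>y. f (mpar (riem_cone S) (p, r) ((0, r) + (y, 0))))" .
  from smooth_on_bounded_linear[OF oE A this]
  have "smooth_on E (\<lambda>y. A (f (mpar (riem_cone S) (p, r) (y, r))))" by simp
  then have "smooth_on E (\<lambda>y. A (f (mpar S p y, r)))"
    by (rule smooth_on_cong_imp[OF oE, rotated]) (auto simp: E_def mpar_riem_cone[OF S pc r _ r])
  then show "smooth_on (mchart S p ` ({x. (x, r) \<in> W} \<inter> mdom S p)) (\<lambda>y. A (f (mpar S p y, r)))"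
    by (simp add: E_def)
qed

lemma smooth_out_map_prod:
  fixes f :: "'a \<Rightarrow> 'q::real_normed_vector"
  assumes f: "smooth_map_on S W vec_manifold f"
  shows "smooth_map_on (riem_cone S) (W \<times> {0<..}) vec_manifold (map_prod f id)"
  unfolding smooth_map_out_iff
proof (intro conjI ballI)
  have oW: "openin (mtop S) W" and cf: "continuous_map (subtopology (mtop S) W) euclidean f"
    using f by (auto simp: smooth_map_out_iff)
  show o: "openin (mtop (riem_cone S)) (W \<times> {0<..})"
    using oW by (simp add: riem_cone_simps openin_prod_Times_iff)
  have "continuous_map (prod_topology (subtopology (mtop S) W) (top_of_set {0::real<..}))
      (prod_topology euclidean euclidean) (\<lambda>(x, y). (f x, y))"
    unfolding continuous_map_prod_top using cf continuous_map_from_subtopology[OF continuous_map_id] by (auto simp: id_def)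
  then show "continuous_map (subtopology (mtop (riem_cone S)) (W \<times> {0<..})) euclidean (map_prod f id)"
    by (simp add: riem_cone_simps subtopology_Times subtopology_subtopology map_prod_def)
  fix p assume p: "p \<in> W \<times> {0::real<..}"
  obtain x r where xr: "p = (x, r)" "x \<in> W" "r > 0" using p by auto
  have xc: "x \<in> mcarrier S" using openin_subset[OF oW] xr(2) by (auto simp: mcarrier_def)
  define D where "D = mchart S x ` (W \<inter> mdom S x)"
  have D: "open D" unfolding D_def by (rule open_chart_image[OF S xc oW])
  have im: "mchart (riem_cone S) p ` ((W \<times> {0<..}) \<inter> mdom (riem_cone S) p) = D \<times> {0<..}"
    unfolding xr(1) riem_cone_simps(2) Times_Int_Times mchart_riem_cone_image D_def by simp
  have "smooth_on D (\<lambda>y. f (mpar S x y))" using f xr(2) unfolding smooth_map_out_iff D_def by blast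
  from smooth_on_map_prod[OF D open_greaterThan this smooth_on_ident[OF open_greaterThan]]
  have "smooth_on (D \<times> {0<..}) (map_prod (\<lambda>y. f (mpar S x y)) (\<lambda>s::real. s))" .
  then have "smooth_on (D \<times> {0<..}) (\<lambda>y. map_prod f id (mpar (riem_cone S) p y))"
    by (rule smooth_on_cong_imp[OF open_Times[OF D open_greaterThan], rotated])
      (auto simp: D_def xr(1) mpar_riem_cone[OF S xc xr(3)])
  then show "smooth_on (mchart (riem_cone S) p ` ((W \<times> {0<..}) \<inter> mdom (riem_cone S) p))
      (\<lambda>y. map_prod f id (mpar (riem_cone S) p y))"
    unfolding im .
qed

text \<open>The fibres of \<open>omap X i\<close> are finite, so \<open>f (x, r)\<close> does not depend on \<open>r\<close> except through its
  second component.\<close>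

lemma cone_projection_slice:
  fixes X :: "('i, 'a set, 'q::euclidean_space) orbifold" and f :: "'a \<times> real \<Rightarrow> 'q \<times> real"
  assumes X: "quotient_charts S Z K act X" and i: "i \<in> oidx X" and x: "x \<in> Z" and r: "r > 0" and W: "(x, r) \<in> W"
    and f: "smooth_map_on (riem_cone S) W vec_manifold f"
    and proj: "\<And>x' r'. (x', r') \<in> W \<Longrightarrow> x' \<in> Z \<Longrightarrow> r' > 0 \<Longrightarrow>
      fst (f (x', r')) \<in> odom X i \<and> omap X i (fst (f (x', r'))) = orbit K act x' \<and> snd (f (x', r')) = r'"
  shows "local_projection S Z K act X i x {x'. (x', r) \<in> W} (\<lambda>x'. fst (f (x', r)))"
    and "v \<in> tangent_set S Z x \<Longrightarrow> mfderiv (riem_cone S) vec_manifold f (x, r) (v, a)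
      = (mfderiv S vec_manifold (\<lambda>x'. fst (f (x', r))) x v, a)"
proof -
  have C: "smooth_manifold (riem_cone S)" by (rule smooth_manifold_riem_cone[OF S])
  have oW: "openin (mtop (riem_cone S)) W" using f by (simp add: smooth_map_out_iff)
  have xc: "x \<in> mcarrier S" using openin_subset[OF oW] W by (auto simp: riem_cone_simps mcarrier_def)
  note sl = smooth_out_slice[OF f r bounded_linear_fst]
  show "local_projection S Z K act X i x {x'. (x', r) \<in> W} (\<lambda>x'. fst (f (x', r)))"
    unfolding local_projection_def using i W x sl proj r by auto
  define df where "df = mfderiv (riem_cone S) vec_manifold f (x, r)"
  have ldf: "linear df"
    unfolding df_def by (rule bounded_linear.linear[OF bounded_linear_mfderiv_out[OF C f W]])
  have vertical: "df (0, 1) = (0, 1)"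
  proof -
    have cx: "smooth_map_on vec_manifold {-r<..} S (\<lambda>t::real. x)"
      using xc by (auto simp: smooth_map_into_iff smooth_on_const mcarrier_def)
    have sr: "smooth_on {-r<..} (\<lambda>t. r + t)"
      by (intro smooth_on_add smooth_on_const smooth_on_ident open_greaterThan)
    have "((\<lambda>t. r + t) has_derivative (\<lambda>t. t)) (at 0)" by (auto intro!: derivative_eq_intros)
    note dr = fun_cong[OF frechet_derivative_at[OF this], of 1]
    have pos: "\<forall>t\<in>{-r<..}. 0 < r + t" by auto
    note c = smooth_into_coneI[OF cx sr pos]
    have "open {t \<in> {-r<..}. (x, r + t) \<in> W}" by (rule open_preimage_into[OF c(1) oW])
    moreover have "0 \<in> {t \<in> {-r<..}. (x, r + t) \<in> W}" using W r by simp
    ultimately obtain e where e: "e > 0" "ball 0 e \<subseteq> {t \<in> {-r<..}. (x, r + t) \<in> W}" by (rule openE)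
    have c': "smooth_map_on vec_manifold (ball 0 e) (riem_cone S) (\<lambda>t. (x, r + t))"
      by (rule smooth_map_into_subset[OF c(1)]) (use e(2) in auto)
    have cW: "(\<lambda>t. (x, r + t)) ` ball 0 e \<subseteq> W" using e(2) by blast
    note fc = smooth_out_into[OF C c' f cW open_ball]
    have P: "fst (f (x, r + t)) \<in> odom X i" "omap X i (fst (f (x, r + t))) = orbit K act x" "snd (f (x, r + t)) = r + t"
      if "t \<in> ball 0 e" for t
      using proj[of x "r + t"] x e(2) that by auto
    have 0: "0 \<in> ball 0 e" using e(1) by simp
    \<comment> \<open>The first components lie in one orbit of the finite chart group, and over an
      interval of radii they form a connected set, hence a single point.\<close>
    have const: "fst (f (x, r + t)) = fst (f (x, r))" if t: "t \<in> ball 0 e" for t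
    proof -
      define I where "I = (\<lambda>t. fst (f (x, r + t))) ` ball 0 e"
      have "I \<subseteq> (\<lambda>\<gamma>. \<gamma> (fst (f (x, r)))) ` ogrp X i"
      proof
        fix u assume "u \<in> I"
        then obtain t where t: "t \<in> ball 0 e" "u = fst (f (x, r + t))" by (auto simp: I_def)
        have "\<exists>\<gamma>\<in>ogrp X i. \<gamma> (fst (f (x, r + 0))) = u"
          by (rule quotient_chartsD(5)[OF X i]) (use P[OF 0] P[OF t(1)] t(2) in auto)
        then show "u \<in> (\<lambda>\<gamma>. \<gamma> (fst (f (x, r)))) ` ogrp X i" by auto
      qed
      then have "finite I" using quotient_chartsD(2)[OF X i] finite_surj by blast
      moreover have "connected I"
        unfolding I_def
        by (rule connected_continuous_image[OF continuous_on_fst[OF smooth_on_imp_continuous_on[OF fc(1)]] connected_ball])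
      ultimately obtain c where "I = {c}" using connected_finite_iff_sing[of I] 0 by (auto simp: I_def)
      moreover have "fst (f (x, r + t)) \<in> I" "fst (f (x, r + 0)) \<in> I" using t 0 unfolding I_def by blast+
      ultimately show ?thesis by simp
    qed
    have "((\<lambda>t. (fst (f (x, r)), r + t)) has_derivative (\<lambda>t. (0, t))) (at 0)"
      by (auto intro!: derivative_eq_intros)
    then have "((\<lambda>t. f (x, r + t)) has_derivative (\<lambda>t. (0, t))) (at 0)"
      by (rule has_derivative_transform_within_open[OF _ open_ball 0])
        (use const P(3) in \<open>metis prod.collapse\<close>)
    from fun_cong[OF frechet_derivative_at[OF this], of 1]
    have "(0, 1) = mfderiv (riem_cone S) vec_manifold f (x, r) (mfderiv vec_manifold (riem_cone S) (\<lambda>t. (x, r + t)) 0 1)"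
      using fc(2)[OF 0, of 1] by simp
    moreover have "mfderiv vec_manifold (riem_cone S) (\<lambda>t. (x, r + t)) 0 1 = (0, 1)"
      using c(2)[of 0 1] r dr[symmetric] by (simp add: mfderiv_into)
    ultimately show ?thesis by (simp add: df_def)
  qed
  \<comment> \<open>Off \<open>Z\<close> the map \<open>f\<close> is unconstrained, so its second
    component is known only along curves in \<open>Z\<close>; this is why \<open>v\<close> has to be
    tangent to \<open>Z\<close>.\<close>
  have horiz: "df (v, 0) = (mfderiv S vec_manifold (\<lambda>x'. fst (f (x', r))) x v, 0)" if v: "v \<in> tangent_set S Z x" for v
  proof -
    obtain \<gamma> \<epsilon> where \<gamma>: "\<epsilon> > 0" "smooth_map_on vec_manifold {-\<epsilon><..<\<epsilon>} S \<gamma>"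
      "\<gamma> ` {-\<epsilon><..<\<epsilon>} \<subseteq> Z" "\<gamma> 0 = x" "v = mfderiv vec_manifold S \<gamma> 0 (1::real)"
      using v by (rule tangent_setE)
    have pos: "\<forall>t\<in>{-\<epsilon><..<\<epsilon>}. 0 < r" using r by simp
    note c = smooth_into_coneI[OF \<gamma>(2) smooth_on_const pos]
    define U where "U = {t \<in> {-\<epsilon><..<\<epsilon>}. (\<gamma> t, r) \<in> W}"
    have U: "open U" unfolding U_def by (rule open_preimage_into[OF c(1) oW])
    have U0: "0 \<in> U" using \<gamma>(1,4) W by (simp add: U_def)
    have cU: "smooth_map_on vec_manifold U (riem_cone S) (\<lambda>t. (\<gamma> t, r))"
      by (rule smooth_map_into_subset[OF c(1) U]) (auto simp: U_def)
    have \<gamma>U: "smooth_map_on vec_manifold U S \<gamma>"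
      by (rule smooth_map_into_subset[OF \<gamma>(2) U]) (auto simp: U_def)
    have W1: "(\<lambda>t. (\<gamma> t, r)) ` U \<subseteq> W" and W2: "\<gamma> ` U \<subseteq> {x'. (x', r) \<in> W}" by (auto simp: U_def)
    note f1 = smooth_out_into[OF C cU f W1 U] and f2 = smooth_out_into[OF S \<gamma>U sl W2 U]
    have "((\<lambda>t. (fst (f (\<gamma> t, r)), r)) has_derivative (\<lambda>t. (frechet_derivative (\<lambda>t. fst (f (\<gamma> t, r))) (at 0) t, 0))) (at 0)"
      by (intro has_derivative_Pair has_derivative_const smooth_on_has_derivative[OF f2(1) U U0])
    then have "((\<lambda>t. f (\<gamma> t, r)) has_derivative (\<lambda>t. (frechet_derivative (\<lambda>t. fst (f (\<gamma> t, r))) (at 0) t, 0))) (at 0)"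
    proof (rule has_derivative_transform_within_open[OF _ U U0])
      fix t assume "t \<in> U"
      then have "(\<gamma> t, r) \<in> W" "\<gamma> t \<in> Z" using \<gamma>(3) by (auto simp: U_def)
      then have "snd (f (\<gamma> t, r)) = r" using proj r by blast
      then show "(fst (f (\<gamma> t, r)), r) = f (\<gamma> t, r)" by (simp add: prod_eq_iff)
    qed
    from fun_cong[OF frechet_derivative_at[OF this], of 1]
    have "df (mfderiv vec_manifold (riem_cone S) (\<lambda>t. (\<gamma> t, r)) 0 1)
      = (mfderiv S vec_manifold (\<lambda>x'. fst (f (x', r))) x (mfderiv vec_manifold S \<gamma> 0 1), 0)"
      using f1(2)[OF U0, of 1] f2(2)[OF U0, of 1] by (simp add: df_def \<gamma>(4))
    moreover have "mfderiv vec_manifold (riem_cone S) (\<lambda>t. (\<gamma> t, r)) 0 1 = (v, 0)"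
      using c(2)[of 0 1] \<gamma>(1,5) by simp
    ultimately show ?thesis by (simp add: \<gamma>(5))
  qed
  show "mfderiv (riem_cone S) vec_manifold f (x, r) (v, a)
      = (mfderiv S vec_manifold (\<lambda>x'. fst (f (x', r))) x v, a)" if v: "v \<in> tangent_set S Z x"
  proof -
    have "df ((v, 0) + a *\<^sub>R (0, 1)) = df (v, 0) + a *\<^sub>R df (0, 1)"
      by (simp only: linear_add[OF ldf] linear_cmul[OF ldf])
    then show ?thesis using horiz[OF v] vertical by (simp add: df_def)
  qed
qed

text \<open>In a product chart the pullback of \<open>liouville \<eta>\<close> is the Liouville form
  of the coordinate expression of \<open>\<eta>\<close>, so \<open>ext_d_liouville\<close> applies;
  at the base point of the chart that expression is \<open>\<eta>\<close> itself.\<close>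

lemma ext_deriv_cone:
  assumes \<eta>: "one_form S \<eta>" and x: "x \<in> mcarrier S" and r: "r > 0"
  shows "ext_deriv (riem_cone S) (liouville \<eta>) (x, r) (v, a) (w, b)
    = r * (a * \<eta> x w - b * \<eta> x v) + r\<^sup>2 * ext_deriv S \<eta> x v w"
proof -
  define D where "D = mchart S x ` mdom S x"
  define \<eta>x where "\<eta>x = pullback1 vec_manifold S (mpar S x) \<eta>"
  have D: "open D" "mchart S x x \<in> D" using smooth_manifoldD(2,3)[OF S x] by (auto simp: D_def)
  have oD: "open (D \<times> {0::real<..})" using D(1) by (simp add: open_Times)
  have eq: "pullback1 vec_manifold (riem_cone S) (mpar (riem_cone S) (x, r)) (liouville \<eta>) p u = liouville \<eta>x p u"
    if p: "p \<in> D \<times> {0<..}" for p u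
  proof -
    obtain y s where ys: "p = (y, s)" "y \<in> D" "s > 0" using p by auto
    obtain v a where u: "u = (v, a)" by fastforce
    have f: "smooth_on (D \<times> {0::real<..}) fst" and s: "smooth_on (D \<times> {0::real<..}) snd"
      using smooth_on_bounded_linear[OF oD bounded_linear_fst smooth_on_ident[OF oD]]
        smooth_on_bounded_linear[OF oD bounded_linear_snd smooth_on_ident[OF oD]] by auto
    have fD: "fst ` (D \<times> {0::real<..}) \<subseteq> mchart S x ` mdom S x" by (auto simp: D_def)
    note c = smooth_into_compose[OF S smooth_mpar[OF S x] oD f fD]
    have pos: "\<forall>p\<in>D \<times> {0::real<..}. 0 < snd p" by auto
    note d = smooth_into_coneI(2)[OF c(1) s pos p]
    have df: "frechet_derivative fst (at q) = fst" and ds: "frechet_derivative snd (at q) = snd" for q :: "'s \<times> real"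
      by (rule frechet_derivative_at[symmetric], auto intro!: derivative_eq_intros)+
    have mp: "mpar (riem_cone S) (x, r) q = (mpar S x (fst q), snd q)" if "q \<in> D \<times> {0<..}" for q
      using that mpar_riem_cone[OF S x r] by (auto simp: D_def)
    have "mfderiv vec_manifold (riem_cone S) (mpar (riem_cone S) (x, r)) p u
       = mfderiv vec_manifold (riem_cone S) (\<lambda>p. (mpar S x (fst p), snd p)) p u"
      unfolding mfderiv_into mp[OF p]
      by (rule fun_cong[OF frechet_derivative_cong_open[OF oD p]]) (simp add: mp)
    also have "\<dots> = (mfderiv vec_manifold S (mpar S x) y v, a)"
      using d[of u] c(2)[OF p, of u] by (simp add: df ds u ys(1))
    finally show ?thesis
      by (simp add: pullback1_def mp[OF p[unfolded ys(1)]] ys(1) u liouville_def \<eta>x_def)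
  qed
  have s\<eta>x: "smooth_on D (\<lambda>y. \<eta>x y v)" for v
    unfolding D_def \<eta>x_def by (rule smooth_pullback1_mpar[OF S \<eta> x])
  have px: "\<eta>x (mchart S x x) v = \<eta> x v" for v
    unfolding \<eta>x_def pullback1_def mfderiv_mpar_at[OF S x]
    by (simp add: mpar_mchart[OF S x smooth_manifoldD(2)[OF S x]])
  have "ext_deriv (riem_cone S) (liouville \<eta>) (x, r) = ext_d (liouville \<eta>x) (mchart S x x, r)"
    unfolding ext_deriv_def riem_cone_simps
    by (rule ext_d_cong_open[OF oD _ eq]) (use D(2) r in auto)
  then have "ext_deriv (riem_cone S) (liouville \<eta>) (x, r) (v, a) (w, b)
      = ext_d (liouville \<eta>x) (mchart S x x, r) (v, a) (w, b)" by simp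
  also have "\<dots> = r * (a * \<eta>x (mchart S x x) w - b * \<eta>x (mchart S x x) v)
      + r\<^sup>2 * ext_d \<eta>x (mchart S x x) v w"
    by (rule ext_d_liouville[OF D s\<eta>x])
  finally show ?thesis by (simp add: px ext_deriv_def[of S] \<eta>x_def[symmetric])
qed

end


section \<open>Reduction of the cone\<close>

text \<open>An orbit of the lifted action is an orbit in the base times a point, so its two
  projections give the orbit and the radius. No representative is chosen, and well-definedness needs
  no argument.\<close>

definition cone_orbit_map :: "('a \<times> real) set \<Rightarrow> 'a set \<times> real" where
  "cone_orbit_map A = (fst ` A, the_elem (snd ` A))"

lemma orbit_lifted_action: "orbit H (lifted_action act) (x, r) = orbit H act x \<times> {r}"
  by (auto simp: orbit_def lifted_action_def)

lemma orbit_nonempty: "carrier H \<noteq> {} \<Longrightarrow> orbit H act x \<noteq> {}"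
  by (auto simp: orbit_def)

lemma cone_orbit_map_orbit:
  "carrier H \<noteq> {} \<Longrightarrow> cone_orbit_map (orbit H (lifted_action act) (x, r)) = (orbit H act x, r)"
  using orbit_nonempty[of H act x] by (simp add: orbit_lifted_action cone_orbit_map_def)

text \<open>Both sides are quotients of the same product: a quotient map times the identity of a
  locally compact Hausdorff space is again a quotient map. So \<open>cone_orbit_map\<close> is
  itself a quotient map, and an injective quotient map is a homeomorphism.\<close>

lemma homeomorphic_map_cone_orbit_map:
  assumes H: "carrier H \<noteq> {}" and Z: "Z \<subseteq> mcarrier S"
  shows "homeomorphic_map
    (orbit_space (subtopology (mtop (riem_cone S)) (Z \<times> {0<..})) H (lifted_action act))
    (prod_topology (orbit_space (subtopology (mtop S) Z) H act) (top_of_set {0<..})) cone_orbit_map"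
proof -
  define T0 where "T0 = subtopology (mtop (riem_cone S)) (Z \<times> {0<..})"
  have T0: "T0 = prod_topology (subtopology (mtop S) Z) (top_of_set {0<..})"
    by (simp add: T0_def riem_cone_simps subtopology_Times subtopology_subtopology)
  have top: "topspace T0 = Z \<times> {0<..}" using Z by (auto simp: T0 mcarrier_def)
  have loc: "locally_compact_space (top_of_set {0::real<..})"
    using locally_compact_space_open_subset[of euclidean "{0::real<..}"] locally_compact_space_euclidean
    by auto
  have "quotient_map T0 (prod_topology (orbit_space (subtopology (mtop S) Z) H act) (top_of_set {0<..}))
      (\<lambda>(x, r). (orbit H act x, r))"
    unfolding T0 by (rule quotient_map_prod_left[OF loc _ quotient_map_orbit]) (simp add: Hausdorff_space_subtopology)
  moreover have "(\<lambda>(x, r). (orbit H act x, r)) = cone_orbit_map \<circ> orbit H (lifted_action act)"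
    by (simp add: fun_eq_iff cone_orbit_map_orbit[OF H])
  ultimately have q: "quotient_map (orbit_space T0 H (lifted_action act))
      (prod_topology (orbit_space (subtopology (mtop S) Z) H act) (top_of_set {0<..})) cone_orbit_map"
    using quotient_map_compose_eq[OF quotient_map_orbit[of T0 H "lifted_action act"]] by metis
  have "inj_on cone_orbit_map (topspace (orbit_space T0 H (lifted_action act)))"
    unfolding topspace_orbit_space top
  proof (rule inj_onI)
    fix A B assume "A \<in> orbits H (Z \<times> {0<..}) (lifted_action act)" "B \<in> orbits H (Z \<times> {0<..}) (lifted_action act)"
      and eq: "cone_orbit_map A = cone_orbit_map B"
    then obtain x r y s where AB: "A = orbit H (lifted_action act) (x, r)" "B = orbit H (lifted_action act) (y, s)"
      by (auto simp: orbits_def)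
    then have "orbit H act x = orbit H act y" "r = s" using eq by (simp_all add: cone_orbit_map_orbit[OF H])
    then show "A = B" by (simp add: AB orbit_lifted_action)
  qed
  with q show ?thesis unfolding homeomorphic_map_def T0_def by blast
qed

section \<open>The cone orbifold carried to the orbit space\<close>

context
  fixes S :: "('a, 's::euclidean_space) manifold" and Z :: "'a set" and H :: "'g monoid"
    and act :: "'g \<Rightarrow> 'a \<Rightarrow> 'a" and X :: "('i, 'a set, 'q::euclidean_space) orbifold"
    and T :: "('a \<times> real) set topology" and X' :: "('i, ('a \<times> real) set, 'q \<times> real) orbifold"
  assumes S: "smooth_manifold S" and Z: "Z \<subseteq> mcarrier S" and H: "carrier H \<noteq> {}"
    and par: "\<And>z. z \<in> Z \<Longrightarrow> parametrized_at S Z z"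
    and X: "quotient_orbifold S Z H act X"
    and T: "T = orbit_space (subtopology (mtop (riem_cone S)) (Z \<times> {0<..})) H (lifted_action act)"
    and X': "X' = transport_orbifold T cone_orbit_map (cone_orbifold X)"
begin

lemma reduced_charts: "quotient_charts S Z H act X"
  by (rule quotient_orbifold_imp_charts[OF X Z])

lemma cone_manifold: "smooth_manifold (riem_cone S)"
  by (rule smooth_manifold_riem_cone[OF S])

lemma cone_subset: "Z \<times> {0<..} \<subseteq> mcarrier (riem_cone S)"
  using Z by (auto simp: riem_cone_simps)

lemma cone_parametrized: "p \<in> Z \<times> {0<..} \<Longrightarrow> parametrized_at (riem_cone S) (Z \<times> {0<..}) p"
  using parametrized_at_cone[OF S par] by auto

lemma cone_homeomorphic: "homeomorphic_map T (otop (cone_orbifold X)) cone_orbit_map"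
  using homeomorphic_map_cone_orbit_map[OF H Z] X
  by (simp add: T cone_orbifold_def quotient_orbifold_def)

lemma topspace_cone_orbit_space: "topspace T = {orbit H (lifted_action act) (x, r) | x r. x \<in> Z \<and> r > 0}"
proof -
  have "topspace (subtopology (mtop (riem_cone S)) (Z \<times> {0<..})) = Z \<times> {0<..}"
    using cone_subset by (auto simp: mcarrier_def)
  then show ?thesis by (auto simp: T topspace_orbit_space orbits_def)
qed

lemma transport_simps:
  "oidx X' = oidx X" "odom X' i = odom X i \<times> {0<..}" "otop X' = T"
  "ogrp X' i = (\<lambda>\<gamma>. restrict (map_prod \<gamma> id) (odom X i \<times> {0<..})) ` ogrp X i"
  "omap X' i p = inv_into (topspace T) cone_orbit_map (map_prod (omap X i) id p)"
  by (simp_all add: X' transport_orbifold_def cone_orbifold_def)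

lemma omap_transport:
  assumes "omap X i u = orbit H act x" "x \<in> Z" "r > 0"
  shows "omap X' i (u, r) = orbit H (lifted_action act) (x, r)"
proof -
  have "inj_on cone_orbit_map (topspace T)" by (rule homeomorphic_imp_injective_map[OF cone_homeomorphic])
  moreover have "orbit H (lifted_action act) (x, r) \<in> topspace T" using assms by (auto simp: topspace_cone_orbit_space)
  moreover have "map_prod (omap X i) id (u, r) = cone_orbit_map (orbit H (lifted_action act) (x, r))"
    using assms by (simp add: cone_orbit_map_orbit[OF H])
  ultimately show ?thesis by (simp add: transport_simps inv_into_f_f)
qed

lemma orbit_lifted_eq_iff:
  "orbit H (lifted_action act) (x, r) = orbit H (lifted_action act) (y, s) \<longleftrightarrow> orbit H act x = orbit H act y \<and> r = s"
  unfolding orbit_lifted_action using orbit_nonempty[OF H, of act x] orbit_nonempty[OF H, of act y]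
  by (auto simp: times_eq_iff)

lemma omap_transport_eq_iff:
  assumes "i \<in> oidx X" "u \<in> odom X i" "s > 0" "x \<in> Z" "r > 0"
  shows "omap X' i (u, s) = orbit H (lifted_action act) (x, r) \<longleftrightarrow> omap X i u = orbit H act x \<and> s = r"
proof -
  obtain z where z: "z \<in> Z" "omap X i u = orbit H act z" using quotient_chartsD(6)[OF reduced_charts assms(1,2)] by blast
  show ?thesis using omap_transport[OF z(2,1) assms(3)] z(2) orbit_lifted_eq_iff by auto
qed

lemma local_projection_cone_iff:
  "local_projection (riem_cone S) (Z \<times> {0<..}) H (lifted_action act) X' i (x, r) W f \<longleftrightarrow>
     i \<in> oidx X \<and> (x, r) \<in> W \<and> x \<in> Z \<and> r > 0 \<and> smooth_map_on (riem_cone S) W vec_manifold f \<and>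
     (\<forall>x' r'. (x', r') \<in> W \<and> x' \<in> Z \<and> r' > 0 \<longrightarrow> fst (f (x', r')) \<in> odom X i \<and>
        omap X i (fst (f (x', r'))) = orbit H act x' \<and> snd (f (x', r')) = r')"
proof -
  have key: "f (x', r') \<in> odom X' i \<and> omap X' i (f (x', r')) = orbit H (lifted_action act) (x', r')
    \<longleftrightarrow> fst (f (x', r')) \<in> odom X i \<and> omap X i (fst (f (x', r'))) = orbit H act x' \<and> snd (f (x', r')) = r'"
    if "i \<in> oidx X" "x' \<in> Z" "r' > 0" for x' r'
  proof -
    obtain u s where f: "f (x', r') = (u, s)" by fastforce
    show ?thesis
      using omap_transport_eq_iff[OF that(1) _ _ that(2,3), of u s] that(3) by (auto simp: f transport_simps(1,2))
  qed
  have "(\<forall>p\<in>W \<inter> (Z \<times> {0<..}). f p \<in> odom X' i \<and> omap X' i (f p) = orbit H (lifted_action act) p) \<longleftrightarrow>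
     (\<forall>x' r'. (x', r') \<in> W \<and> x' \<in> Z \<and> r' > 0 \<longrightarrow> fst (f (x', r')) \<in> odom X i \<and>
        omap X i (fst (f (x', r'))) = orbit H act x' \<and> snd (f (x', r')) = r')" if "i \<in> oidx X"
    by (simp add: Ball_def key[OF that])
  then show ?thesis
    unfolding local_projection_def transport_simps(1) by (simp add: conj_ac cong: conj_cong)
qed

lemma slice_projection:
  assumes "local_projection (riem_cone S) (Z \<times> {0<..}) H (lifted_action act) X' i (x, r) W f"
  shows "local_projection S Z H act X i x {x'. (x', r) \<in> W} (\<lambda>x'. fst (f (x', r)))"
    and "v \<in> tangent_set S Z x \<Longrightarrow> mfderiv (riem_cone S) vec_manifold f (x, r) (v, a)
      = (mfderiv S vec_manifold (\<lambda>x'. fst (f (x', r))) x v, a)"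
    and "f (x, r) = (fst (f (x, r)), r)" "fst (f (x, r)) \<in> odom X i"
proof -
  note f = assms[unfolded local_projection_cone_iff]
  have *: "i \<in> oidx X" "x \<in> Z" "r > 0" "(x, r) \<in> W" "smooth_map_on (riem_cone S) W vec_manifold f"
    "\<And>x' r'. (x', r') \<in> W \<Longrightarrow> x' \<in> Z \<Longrightarrow> r' > 0 \<Longrightarrow>
      fst (f (x', r')) \<in> odom X i \<and> omap X i (fst (f (x', r'))) = orbit H act x' \<and> snd (f (x', r')) = r'"
    using f by auto
  show "local_projection S Z H act X i x {x'. (x', r) \<in> W} (\<lambda>x'. fst (f (x', r)))"
    by (rule cone_projection_slice(1)[OF S reduced_charts *])
  show "v \<in> tangent_set S Z x \<Longrightarrow> mfderiv (riem_cone S) vec_manifold f (x, r) (v, a)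
      = (mfderiv S vec_manifold (\<lambda>x'. fst (f (x', r))) x v, a)"
    by (rule cone_projection_slice(2)[OF S reduced_charts *])
  show "f (x, r) = (fst (f (x, r)), r)" "fst (f (x, r)) \<in> odom X i"
    using *(6)[OF *(4,2,3)] by (auto simp: prod_eq_iff)
qed

text \<open>The set is the image of \<open>\<Gamma>\<close> under the homomorphism that extends a
  bijection by the identity on \<open>R\<close>. The restriction keeps the result extensional, as
  elements of \<open>BijGroup\<close> are.\<close>

lemma subgroup_cone:
  assumes G: "subgroup \<Gamma> (BijGroup D)"
  shows "subgroup ((\<lambda>\<gamma>. restrict (map_prod \<gamma> id) (D \<times> R)) ` \<Gamma>) (BijGroup (D \<times> R))"
proof -
  let ?h = "\<lambda>\<gamma>. restrict (map_prod \<gamma> id) (D \<times> R)"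
  have bij: "?h \<gamma> \<in> Bij (D \<times> R)" if "\<gamma> \<in> Bij D" for \<gamma>
  proof -
    have "bij_betw (map_prod \<gamma> id) (D \<times> R) (D \<times> R)"
      by (rule bij_betw_map_prod) (use that in \<open>auto simp: Bij_def bij_betw_id\<close>)
    then show ?thesis unfolding Bij_def by (simp cong: bij_betw_cong)
  qed
  have "?h \<in> hom (BijGroup D) (BijGroup (D \<times> R))"
  proof (rule homI)
    show "?h \<gamma> \<in> carrier (BijGroup (D \<times> R))" if "\<gamma> \<in> carrier (BijGroup D)" for \<gamma>
      using bij that by (simp add: BijGroup_def)
    fix \<gamma> \<delta> assume "\<gamma> \<in> carrier (BijGroup D)" "\<delta> \<in> carrier (BijGroup D)"
    then have gd: "\<gamma> \<in> Bij D" "\<delta> \<in> Bij D" by (auto simp: BijGroup_def)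
    have "?h (compose D \<gamma> \<delta>) = compose (D \<times> R) (?h \<gamma>) (?h \<delta>)"
      using Bij_imp_funcset[OF gd(2)] by (auto simp: fun_eq_iff compose_def restrict_def)
    then show "?h (\<gamma> \<otimes>\<^bsub>BijGroup D\<^esub> \<delta>) = ?h \<gamma> \<otimes>\<^bsub>BijGroup (D \<times> R)\<^esub> ?h \<delta>"
      using gd bij[OF gd(1)] bij[OF gd(2)] by (simp add: BijGroup_def)
  qed
  then have "group_hom (BijGroup D) (BijGroup (D \<times> R)) ?h"
    by (simp add: group_hom_def group_hom_axioms_def group_BijGroup)
  then show ?thesis by (rule group_hom.subgroup_img_is_subgroup[OF _ G])
qed

lemma cone_charts: "quotient_charts (riem_cone S) (Z \<times> {0<..}) H (lifted_action act) X'"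
  unfolding quotient_charts_def transport_simps(1,2)
proof (intro conjI ballI impI)
  fix i assume i: "i \<in> oidx X"
  note C = quotient_chartsD[OF reduced_charts i]
  show "open (odom X i \<times> {0::real<..})" using C(1) by (simp add: open_Times)
  show "finite (ogrp X' i)" using C(2) by (simp add: transport_simps)
  show "subgroup (ogrp X' i) (BijGroup (odom X i \<times> {0<..}))"
    unfolding transport_simps by (rule subgroup_cone[OF C(3)])
  show "smooth_on (odom X i \<times> {0<..}) \<gamma>" if "\<gamma> \<in> ogrp X' i" for \<gamma>
  proof -
    obtain \<delta> where d: "\<delta> \<in> ogrp X i" "\<gamma> = restrict (map_prod \<delta> id) (odom X i \<times> {0<..})"
      using \<open>\<gamma> \<in> ogrp X' i\<close> by (auto simp: transport_simps)
    have "smooth_on (odom X i \<times> {0::real<..}) (map_prod \<delta> (\<lambda>s. s))"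
      by (rule smooth_on_map_prod[OF C(1) open_greaterThan C(4)[OF d(1)] smooth_on_ident[OF open_greaterThan]])
    then show ?thesis
      unfolding d(2) by (rule smooth_on_cong_imp[OF open_Times[OF C(1) open_greaterThan], rotated]) auto
  qed
  fix p assume p: "p \<in> odom X i \<times> {0::real<..}"
  obtain u s where us: "p = (u, s)" "u \<in> odom X i" "s > 0" using p by auto
  obtain z where z: "z \<in> Z" "omap X i u = orbit H act z" using C(6)[OF us(2)] by blast
  note om = omap_transport[OF z(2,1) us(3)]
  show "\<exists>z\<in>Z \<times> {0<..}. omap X' i p = orbit H (lifted_action act) z"
    using om z us by (intro bexI[of _ "(z, s)"]) auto
  show "omap X' i p = omap X' i p' \<longleftrightarrow> (\<exists>\<gamma>\<in>ogrp X' i. \<gamma> p = p')" if p': "p' \<in> odom X i \<times> {0<..}" for p'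
  proof -
    obtain u' s' where us': "p' = (u', s')" "u' \<in> odom X i" "s' > 0" using p' by auto
    have "omap X' i p = omap X' i p' \<longleftrightarrow> omap X' i (u', s') = orbit H (lifted_action act) (z, s)"
      using om us us' by auto
    also have "\<dots> \<longleftrightarrow> omap X i u = omap X i u' \<and> s' = s"
      using omap_transport_eq_iff[OF i us'(2,3) z(1) us(3)] z(2) by auto
    also have "\<dots> \<longleftrightarrow> (\<exists>\<gamma>\<in>ogrp X i. \<gamma> u = u') \<and> s' = s"
      using reduced_charts i us(2) us'(2) unfolding quotient_charts_def by blast
    also have "\<dots> \<longleftrightarrow> (\<exists>\<gamma>\<in>ogrp X' i. \<gamma> p = p')"
      using us us' by (auto simp: transport_simps)
    finally show ?thesis .
  qed
next
  fix p i q assume p: "p \<in> Z \<times> {0::real<..}" and i: "i \<in> oidx X" and q: "q \<in> odom X i \<times> {0::real<..}"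
    and eq: "omap X' i q = orbit H (lifted_action act) p"
  obtain x r where xr: "p = (x, r)" "x \<in> Z" "r > 0" using p by auto
  obtain u s where us: "q = (u, s)" "u \<in> odom X i" "s > 0" using q by auto
  have e: "omap X i u = orbit H act x" "s = r"
    using omap_transport_eq_iff[OF i us(2,3) xr(2,3)] eq us(1) xr(1) by auto
  obtain W f where f: "local_projection S Z H act X i x W f" "f x = u"
    "mfderiv S vec_manifold f x ` tangent_set S Z x = UNIV"
    using quotient_chartsD(7)[OF reduced_charts i us(2) xr(2) e(1)] by blast
  \<comment> \<open>A projection to a cone chart is the product of a projection \<open>f\<close> of
    \<open>S\<close> with the identity on radii; on tangent vectors its derivative is a product too,
    hence onto.\<close>
  have f': "local_projection (riem_cone S) (Z \<times> {0<..}) H (lifted_action act) X' i (x, r) (W \<times> {0<..}) (map_prod f id)"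
    unfolding local_projection_cone_iff
    using f(1) xr i smooth_out_map_prod[OF S] unfolding local_projection_def by auto
  have d: "mfderiv (riem_cone S) vec_manifold (map_prod f id) (x, r) (v, a) = (mfderiv S vec_manifold f x v, a)"
    if "v \<in> tangent_set S Z x" for v a
    using slice_projection(2)[OF f' that] by simp
  have "mfderiv (riem_cone S) vec_manifold (map_prod f id) p ` tangent_set (riem_cone S) (Z \<times> {0<..}) p = UNIV"
  proof -
    have "\<exists>k\<in>tangent_set S Z x \<times> UNIV. w = mfderiv (riem_cone S) vec_manifold (map_prod f id) (x, r) k" for w
    proof -
      obtain v where "v \<in> tangent_set S Z x" "fst w = mfderiv S vec_manifold f x v"
        using f(3) by (metis UNIV_I imageE)
      then show ?thesis using d[of v "snd w"] by (intro bexI[of _ "(v, snd w)"]) (auto simp: prod_eq_iff)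
    qed
    then show ?thesis unfolding xr(1) tangent_set_cone[OF S xr(3)] by blast
  qed
  then show "\<exists>W f. local_projection (riem_cone S) (Z \<times> {0<..}) H (lifted_action act) X' i p W f \<and> f p = q \<and>
      mfderiv (riem_cone S) vec_manifold f p ` tangent_set (riem_cone S) (Z \<times> {0<..}) p = UNIV"
    using f' xr(1) us(1) e(2) f(2) by (intro exI[of _ "W \<times> {0<..}"] exI[of _ "map_prod f id"]) auto
qed

text \<open>The topological conditions are carried over by the homeomorphism
  \<open>cone_orbit_map\<close>. The transition maps come from \<open>lifts_everywhere_id\<close>
  applied to \<open>X'\<close> and itself, instead of from products of transition maps of
  \<open>X\<close>.\<close>

lemma cone_quotient_orbifold: "quotient_orbifold (riem_cone S) (Z \<times> {0<..}) H (lifted_action act) X'"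
proof -
  have X0: "orbifold_structure X" using X by (simp add: quotient_orbifold_def)
  have hs: "T homeomorphic_space otop (cone_orbifold X)"
    using cone_homeomorphic homeomorphic_map_imp_homeomorphic_space by blast
  have tX: "otop (cone_orbifold X) = prod_topology (otop X) (top_of_set {0<..})" by (simp add: cone_orbifold_def)
  have haus: "Hausdorff_space T"
    using homeomorphic_Hausdorff_space[OF hs] X0
    by (simp add: tX orbifold_structure_def Hausdorff_space_prod_topology Hausdorff_space_subtopology)
  have "second_countable (top_of_set {0::real<..})"
    using smooth_manifold_half_line by (simp add: smooth_manifold_def)
  then have sec: "second_countable T"
    using homeomorphic_space_second_countability[OF hs] X0
    by (simp add: tX orbifold_structure_def second_countable_prod_topology)
  define k where "k = inv_into (topspace T) cone_orbit_map"
  have hk: "homeomorphic_map (otop (cone_orbifold X)) T k"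
  proof -
    obtain k' where k': "homeomorphic_maps T (otop (cone_orbifold X)) cone_orbit_map k'"
      using cone_homeomorphic homeomorphic_map_maps by blast
    have "k' y = k y" if "y \<in> topspace (otop (cone_orbifold X))" for y
    proof -
      have "k' y \<in> topspace T" "cone_orbit_map (k' y) = y"
        using k' that unfolding homeomorphic_maps_def by (auto simp: continuous_map_def)
      then show ?thesis
        using inv_into_f_f[OF homeomorphic_imp_injective_map[OF cone_homeomorphic]] unfolding k_def by metis
    qed
    moreover have "homeomorphic_map (otop (cone_orbifold X)) T k'"
      using k' homeomorphic_maps_map by blast
    ultimately show ?thesis using homeomorphic_map_eq by metis
  qed
  have om: "omap X' i = k \<circ> map_prod (omap X i) id" for i
    by (auto simp: fun_eq_iff transport_simps k_def)
  have maps: "continuous_map (top_of_set (odom X i \<times> {0<..})) T (omap X' i)"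
    "open_map (top_of_set (odom X i \<times> {0<..})) T (omap X' i)"
    if i: "i \<in> oidx X" for i
  proof -
    have c: "continuous_map (top_of_set (odom X i)) (otop X) (omap X i)" "open_map (top_of_set (odom X i)) (otop X) (omap X i)"
      using X0 i by (auto simp: orbifold_structure_def)
    have id: "continuous_map (top_of_set {0::real<..}) (top_of_set {0<..}) id" by simp
    have "continuous_map (top_of_set (odom X i \<times> {0::real<..})) (otop (cone_orbifold X)) (map_prod (omap X i) id)"
      unfolding tX prod_topology_subtopology_eu[symmetric] map_prod_def continuous_map_prod_top using c(1) id by blast
    then show "continuous_map (top_of_set (odom X i \<times> {0<..})) T (omap X' i)"
      unfolding om using homeomorphic_imp_continuous_map[OF hk] by (rule continuous_map_compose)
    \<comment> \<open>Checked on boxes inside the open set, whose images are boxes again.\<close>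
    have "open_map (top_of_set (odom X i \<times> {0::real<..})) (otop (cone_orbifold X)) (map_prod (omap X i) id)"
      unfolding tX prod_topology_subtopology_eu[symmetric] open_map_def
    proof (intro allI impI)
      fix U assume U: "openin (prod_topology (top_of_set (odom X i)) (top_of_set {0::real<..})) U"
      show "openin (prod_topology (otop X) (top_of_set {0<..})) (map_prod (omap X i) id ` U)"
        unfolding openin_prod_topology_alt
      proof (intro allI impI)
        fix y r assume "(y, r) \<in> map_prod (omap X i) id ` U"
        then obtain u where u: "(u, r) \<in> U" "y = omap X i u" by auto
        obtain A B where AB: "openin (top_of_set (odom X i)) A" "openin (top_of_set {0<..}) B" "u \<in> A" "r \<in> B" "A \<times> B \<subseteq> U"
          using U[unfolded openin_prod_topology_alt, rule_format, OF u(1)] by blast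
        have "openin (otop X) (omap X i ` A)" using c(2) AB(1) by (simp add: open_map_def)
        moreover have "(omap X i ` A) \<times> B \<subseteq> map_prod (omap X i) id ` U"
          using AB(5) by (force simp: image_iff)
        ultimately show "\<exists>U' V. openin (otop X) U' \<and> openin (top_of_set {0<..}) V \<and> y \<in> U' \<and> r \<in> V \<and> U' \<times> V \<subseteq> map_prod (omap X i) id ` U"
          using AB u(2) by blast
      qed
    qed
    then show "open_map (top_of_set (odom X i \<times> {0<..})) T (omap X' i)"
      unfolding om using homeomorphic_imp_open_map[OF hk] by (rule open_map_compose)
  qed
  have cov: "(\<Union>i\<in>oidx X. omap X' i ` (odom X i \<times> {0<..})) = topspace T"
  proof (rule subset_antisym; rule subsetI)
    fix A assume "A \<in> (\<Union>i\<in>oidx X. omap X' i ` (odom X i \<times> {0<..}))"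
    then obtain i u s where i: "i \<in> oidx X" "u \<in> odom X i" "s > 0" "A = omap X' i (u, s)" by auto
    obtain z where z: "z \<in> Z" "omap X i u = orbit H act z" using quotient_chartsD(6)[OF reduced_charts i(1,2)] by blast
    show "A \<in> topspace T" using omap_transport[OF z(2,1) i(3)] i z by (auto simp: topspace_cone_orbit_space)
  next
    fix A assume "A \<in> topspace T"
    then obtain x r where x: "x \<in> Z" "r > 0" "A = orbit H (lifted_action act) (x, r)" by (auto simp: topspace_cone_orbit_space)
    have "topspace (otop X) = orbits H Z act"
      using X Z unfolding quotient_orbifold_def mcarrier_def by (auto simp: topspace_orbit_space inf_absorb2)
    then have "orbit H act x \<in> (\<Union>i\<in>oidx X. omap X i ` odom X i)"
      using X0 x(1) by (auto simp: orbifold_structure_def orbits_def)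
    then obtain i u where i: "i \<in> oidx X" "u \<in> odom X i" "orbit H act x = omap X i u" by auto
    have "A = omap X' i (u, r)" using omap_transport[OF i(3)[symmetric] x(1,2)] x(3) by simp
    then show "A \<in> (\<Union>i\<in>oidx X. omap X' i ` (odom X i \<times> {0<..}))" using i x(2) by blast
  qed
  have "connected (odom X i \<times> {0::real<..})" if "i \<in> oidx X" for i
    using X0 that by (auto simp: orbifold_structure_def connected_Times)
  moreover have "lifts_everywhere X' X' id"
    by (rule lifts_everywhere_id[OF cone_manifold cone_parametrized cone_charts cone_charts])
  ultimately have "orbifold_structure X'"
    using cone_charts haus sec maps cov
    unfolding orbifold_structure_def quotient_charts_def transport_simps(1-3) by simp
  then show ?thesis
    using cone_charts unfolding quotient_orbifold_def quotient_charts_def by (simp add: transport_simps(3) T)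
qed

section \<open>Projection of the symplectic form and of the metric\<close>

lemma tangent_coneE:
  assumes "local_projection (riem_cone S) (Z \<times> {0<..}) H (lifted_action act) X' i (x, r) W f"
    and "v \<in> tangent_set (riem_cone S) (Z \<times> {0<..}) (x, r)"
  obtains v1 a where "v = (v1, a)" "v1 \<in> tangent_set S Z x"
    "mfderiv (riem_cone S) vec_manifold f (x, r) v = (mfderiv S vec_manifold (\<lambda>x'. fst (f (x', r))) x v1, a)"
proof -
  have r: "r > 0" using assms(1) by (simp add: local_projection_cone_iff)
  obtain v1 a where v: "v = (v1, a)" by fastforce
  moreover have "v1 \<in> tangent_set S Z x" using assms(2) by (simp add: tangent_set_cone[OF S r] v)
  ultimately show thesis using that slice_projection(2)[OF assms(1)] by simp
qed

text \<open>On the cone of \<open>S\<close> and in the charts the form is given by one formula in a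
  one-form, its exterior derivative and the radius (\<open>ext_deriv_cone\<close>,
  \<open>ext_d_liouville\<close>). The contact form projects, and by \<open>projects2_ext_d\<close>
  so does its exterior derivative. Invariance under transition maps follows from projecting, by
  \<open>matches2_projects\<close>.\<close>

lemma cone_two_form:
  assumes \<eta>: "one_form S \<eta>" and \<eta>X: "orbi_one_form X \<eta>X" "projects1 S Z H act X \<eta> \<eta>X"
  shows "orbi_two_form X' (\<lambda>i. ext_d (liouville (\<eta>X i)))"
    and "projects2 (riem_cone S) (Z \<times> {0<..}) H (lifted_action act) X'
      (ext_deriv (riem_cone S) (liouville \<eta>)) (\<lambda>i. ext_d (liouville (\<eta>X i)))"
proof -
  have lin: "linear (\<eta>X i u)" if "i \<in> oidx X" "u \<in> odom X i" for i u
    using \<eta>X(1) that by (simp add: orbi_one_form_def)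
  have smo: "smooth_on (odom X i) (\<lambda>u. \<eta>X i u v)" if "i \<in> oidx X" for i v
    using \<eta>X(1) that by (simp add: orbi_one_form_def)
  note dom = quotient_chartsD(1)[OF reduced_charts]
  note d\<eta>X = projects2_ext_d[OF S \<eta> par Z dom lin smo \<eta>X(2)]
  show p: "projects2 (riem_cone S) (Z \<times> {0<..}) H (lifted_action act) X'
      (ext_deriv (riem_cone S) (liouville \<eta>)) (\<lambda>i. ext_d (liouville (\<eta>X i)))"
    unfolding projects2_def
  proof (intro allI impI ballI)
    fix i z W f v w
    assume f: "local_projection (riem_cone S) (Z \<times> {0<..}) H (lifted_action act) X' i z W f"
      and v: "v \<in> tangent_set (riem_cone S) (Z \<times> {0<..}) z" and w: "w \<in> tangent_set (riem_cone S) (Z \<times> {0<..}) z"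
    obtain x r where z: "z = (x, r)" by fastforce
    note f = f[unfolded z] and v = v[unfolded z] and w = w[unfolded z]
    have i: "i \<in> oidx X" and x: "x \<in> mcarrier S" and r: "r > 0"
      using f Z by (auto simp: local_projection_cone_iff)
    define f1 where "f1 = (\<lambda>x'. fst (f (x', r)))"
    note sl = slice_projection[OF f, folded f1_def]
    obtain v1 a where v: "v = (v1, a)" "v1 \<in> tangent_set S Z x"
      "mfderiv (riem_cone S) vec_manifold f (x, r) v = (mfderiv S vec_manifold f1 x v1, a)"
      unfolding f1_def by (rule tangent_coneE[OF f v])
    obtain w1 b where w: "w = (w1, b)" "w1 \<in> tangent_set S Z x"
      "mfderiv (riem_cone S) vec_manifold f (x, r) w = (mfderiv S vec_manifold f1 x w1, b)"
      unfolding f1_def by (rule tangent_coneE[OF f w])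
    have fx: "f (x, r) = (f1 x, r)" "f1 x \<in> odom X i" using sl(3,4) by (simp_all add: f1_def)
    have 1: "\<eta>X i (f1 x) (mfderiv S vec_manifold f1 x u) = \<eta> x u" if "u \<in> tangent_set S Z x" for u
      using \<eta>X(2) sl(1) that unfolding projects1_def by blast
    have 2: "ext_d (\<eta>X i) (f1 x) (mfderiv S vec_manifold f1 x v1) (mfderiv S vec_manifold f1 x w1) = ext_deriv S \<eta> x v1 w1"
      using d\<eta>X sl(1) v(2) w(2) unfolding projects2_def by blast
    show "ext_d (liouville (\<eta>X i)) (f z) (mfderiv (riem_cone S) vec_manifold f z v) (mfderiv (riem_cone S) vec_manifold f z w)
      = ext_deriv (riem_cone S) (liouville \<eta>) z v w"
      unfolding z v(3) w(3) fx(1) ext_d_liouville[OF dom[OF i] fx(2) smo[OF i]] 1[OF v(2)] 1[OF w(2)] 2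
      unfolding v(1) w(1) ext_deriv_cone[OF S \<eta> x r] ..
  qed
  show "orbi_two_form X' (\<lambda>i. ext_d (liouville (\<eta>X i)))"
    unfolding orbi_two_form_def transport_simps(1,2)
  proof (intro conjI ballI allI)
    fix i assume i: "i \<in> oidx X"
    note two_form = two_form_ext_d_liouville[OF dom[OF i] lin[OF i] smo[OF i]]
    show "bilinear (ext_d (liouville (\<eta>X i)) p)" if "p \<in> odom X i \<times> {0<..}" for p
      by (rule two_form(1)) (use that in auto)
    show "ext_d (liouville (\<eta>X i)) p v w = - ext_d (liouville (\<eta>X i)) p w v" for p v w
      by (rule ext_d_antisym)
    show "smooth_on (odom X i \<times> {0<..}) (\<lambda>p. ext_d (liouville (\<eta>X i)) p v w)" for v w
      by (rule two_form(2))
  next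
    show "matches2 X' X' id (\<lambda>i. ext_d (liouville (\<eta>X i))) (\<lambda>i. ext_d (liouville (\<eta>X i)))"
      by (rule matches2_projects[OF cone_manifold cone_parametrized cone_charts p p])
  qed
qed

lemma cone_riemannian:
  assumes g: "riemannian_metric S g" and gX: "orbi_metric X gX" "projects_metric S Z H act X g gX"
  shows "orbi_metric X' (\<lambda>i. cone_metric (gX i))"
    and "projects_metric (riem_cone S) (Z \<times> {0<..}) H (lifted_action act) X' (cone_metric g) (\<lambda>i. cone_metric (gX i))"
    and "p \<in> Z \<times> {0<..} \<Longrightarrow> bilinear (cone_metric g p)"
    and "p \<in> Z \<times> {0<..} \<Longrightarrow> v \<noteq> 0 \<Longrightarrow> cone_metric g p v v > 0"
proof -
  have gS: "bilinear (g x)" "\<And>v. v \<noteq> 0 \<Longrightarrow> g x v v > 0" if "x \<in> Z" for x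
    using g that Z by (auto simp: riemannian_metric_def)
  show bil: "bilinear (cone_metric g p)" if "p \<in> Z \<times> {0<..}" for p
    using that cone_metric_positive(1)[of g "fst p" "snd p"] gS[of "fst p"] by auto
  show pos: "cone_metric g p v v > 0" if "p \<in> Z \<times> {0<..}" "v \<noteq> 0" for p v
    using that cone_metric_positive(2)[of g "fst p" "snd p" v] gS[of "fst p"] by auto
  note dom = quotient_chartsD(1)[OF reduced_charts]
  show pr: "projects_metric (riem_cone S) (Z \<times> {0<..}) H (lifted_action act) X' (cone_metric g) (\<lambda>i. cone_metric (gX i))"
    unfolding projects_metric_def
  proof (intro allI impI ballI)
    fix i z W f v w
    assume f: "local_projection (riem_cone S) (Z \<times> {0<..}) H (lifted_action act) X' i z W f"
      and v: "v \<in> horizontal (riem_cone S) (Z \<times> {0<..}) (cone_metric g) f z"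
      and w: "w \<in> horizontal (riem_cone S) (Z \<times> {0<..}) (cone_metric g) f z"
    obtain x r where z: "z = (x, r)" by fastforce
    note f = f[unfolded z] and v = v[unfolded z] and w = w[unfolded z]
    have r: "r > 0" using f by (auto simp: local_projection_cone_iff)
    define f1 where "f1 = (\<lambda>x'. fst (f (x', r)))"
    note sl = slice_projection[OF f, folded f1_def]
    \<comment> \<open>A vertical vector \<open>k\<close> of the base gives the vertical vector
      \<open>(k, 0)\<close> of the cone. Testing \<open>u\<close> against it yields
      \<open>r\<^sup>2\<close> times the product of \<open>u1\<close> and \<open>k\<close>, so
      \<open>u1\<close> is horizontal while the radial part stays free.\<close>
    have hor: "\<exists>u1 a. u = (u1, a) \<and> u1 \<in> horizontal S Z g f1 x \<and>
        mfderiv (riem_cone S) vec_manifold f (x, r) u = (mfderiv S vec_manifold f1 x u1, a)"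
      if u: "u \<in> horizontal (riem_cone S) (Z \<times> {0<..}) (cone_metric g) f (x, r)" for u
    proof -
      have "u \<in> tangent_set (riem_cone S) (Z \<times> {0<..}) (x, r)" using u by (simp add: horizontal_def)
      from tangent_coneE[OF f this]
      obtain u1 a where u1: "u = (u1, a)" "u1 \<in> tangent_set S Z x"
        "mfderiv (riem_cone S) vec_manifold f (x, r) u = (mfderiv S vec_manifold f1 x u1, a)"
        unfolding f1_def by blast
      have "g x u1 k = 0" if k: "k \<in> tangent_set S Z x" "mfderiv S vec_manifold f1 x k = 0" for k
      proof -
        have "(k, 0) \<in> tangent_set (riem_cone S) (Z \<times> {0<..}) (x, r)"
          using k(1) by (simp add: tangent_set_cone[OF S r])
        moreover have "mfderiv (riem_cone S) vec_manifold f (x, r) (k, 0) = 0"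
          using sl(2)[OF k(1)] k(2) by (simp add: zero_prod_def)
        ultimately have "cone_metric g (x, r) u (k, 0) = 0" using u by (simp add: horizontal_def)
        then show ?thesis using r by (simp add: cone_metric_def u1(1))
      qed
      then show ?thesis using u1 by (auto simp: horizontal_def)
    qed
    obtain v1 a where v1: "v = (v1, a)" "v1 \<in> horizontal S Z g f1 x"
        "mfderiv (riem_cone S) vec_manifold f (x, r) v = (mfderiv S vec_manifold f1 x v1, a)"
      using hor[OF v] by blast
    obtain w1 b where w1: "w = (w1, b)" "w1 \<in> horizontal S Z g f1 x"
        "mfderiv (riem_cone S) vec_manifold f (x, r) w = (mfderiv S vec_manifold f1 x w1, b)"
      using hor[OF w] by blast
    have "gX i (f1 x) (mfderiv S vec_manifold f1 x v1) (mfderiv S vec_manifold f1 x w1) = g x v1 w1"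
      using gX(2) sl(1) v1(2) w1(2) unfolding projects_metric_def by blast
    moreover have "f (x, r) = (f1 x, r)" using sl(3) by (simp add: f1_def)
    ultimately show "cone_metric (gX i) (f z) (mfderiv (riem_cone S) vec_manifold f z v) (mfderiv (riem_cone S) vec_manifold f z w)
      = cone_metric g z v w"
      unfolding z v1(3) w1(3) by (simp add: v1(1) w1(1) cone_metric_def)
  qed
  show "orbi_metric X' (\<lambda>i. cone_metric (gX i))"
    unfolding orbi_metric_def transport_simps(1,2)
  proof (intro conjI ballI allI impI)
    fix i assume i: "i \<in> oidx X"
    have gi: "bilinear (gX i u)" "\<And>v w. gX i u v w = gX i u w v" "\<And>v. v \<noteq> 0 \<Longrightarrow> gX i u v v > 0"
      if "u \<in> odom X i" for u
      using gX(1) i that by (auto simp: orbi_metric_def)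
    have smo: "smooth_on (odom X i) (\<lambda>u. gX i u v w)" for v w
      using gX(1) i by (simp add: orbi_metric_def)
    show "smooth_on (odom X i \<times> {0<..}) (\<lambda>p. cone_metric (gX i) p v w)" for v w
      by (rule smooth_on_cone_metric[OF dom[OF i] smo])
    fix p assume p: "p \<in> odom X i \<times> {0::real<..}"
    obtain u r where ur: "p = (u, r)" "u \<in> odom X i" "r > 0" using p by auto
    show "bilinear (cone_metric (gX i) p)"
      unfolding ur(1) by (rule cone_metric_positive(1)[where g = "gX i" and x = u, OF gi(1,3)[OF ur(2)] ur(3)])
    show "cone_metric (gX i) p v w = cone_metric (gX i) p w v" for v w
      using gi(2)[OF ur(2), of "fst v" "fst w"] by (simp add: ur(1) cone_metric_def case_prod_unfold)
    show "0 < cone_metric (gX i) p v v" if "v \<noteq> 0" for v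
      unfolding ur(1) by (rule cone_metric_positive(2)[where g = "gX i" and x = u, OF gi(1,3)[OF ur(2)] ur(3) that])
  next
    show "matches2 X' X' id (\<lambda>i. cone_metric (gX i)) (\<lambda>i. cone_metric (gX i))"
      by (rule matches2_projects_metric[OF cone_manifold cone_parametrized cone_subset bil pos cone_charts pr pr])
  qed
qed

section \<open>Comparison with other ray reductions\<close>

text \<open>Trades \<open>cone_orbit_map\<close> for the identity of the orbit space, so that the
  comparison of two chart systems on one and the same quotient applies.\<close>

lemma local_lift_transport:
  fixes Y :: "('j, ('a \<times> real) set, 'p::euclidean_space) orbifold"
  assumes Y: "quotient_charts (riem_cone S) (Z \<times> {0<..}) H (lifted_action act) Y"
  shows "local_lift Y (cone_orbifold X) cone_orbit_map i j N h \<longleftrightarrow> local_lift Y X' id i j N h"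
proof -
  have "omap (cone_orbifold X) j (h y) = cone_orbit_map (omap Y i y) \<longleftrightarrow> omap X' j (h y) = id (omap Y i y)"
    if i: "i \<in> oidx Y" and j: "j \<in> oidx X" and N: "N \<subseteq> odom Y i" "h ` N \<subseteq> odom X j \<times> {0<..}" and y: "y \<in> N" for y
  proof -
    have "y \<in> odom Y i" using N(1) y by blast
    then obtain p where "p \<in> Z \<times> {0<..}" "omap Y i y = orbit H (lifted_action act) p"
      using quotient_chartsD(6)[OF Y i] by blast
    then obtain x r where p: "x \<in> Z" "r > 0" "omap Y i y = orbit H (lifted_action act) (x, r)" by auto
    have "h y \<in> odom X j \<times> {0<..}" using N(2) y by blast
    then obtain u s where u: "h y = (u, s)" "u \<in> odom X j" "s > 0" by auto
    show ?thesis
      using omap_transport_eq_iff[OF j u(2,3) p(1,2)]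
      by (simp add: cone_orbifold_def p(3) u(1) cone_orbit_map_orbit[OF H])
  qed
  then show ?thesis
    unfolding local_lift_def transport_simps(1,2) by (auto simp: cone_orbifold_def)
qed

lemma lifts_everywhere_transport:
  fixes Y :: "('j, ('a \<times> real) set, 'p::euclidean_space) orbifold"
  assumes Y: "quotient_charts (riem_cone S) (Z \<times> {0<..}) H (lifted_action act) Y"
  shows "lifts_everywhere Y (cone_orbifold X) cone_orbit_map"
  unfolding lifts_everywhere_def local_lift_transport[OF Y]
proof (intro ballI impI)
  fix i j y w assume i: "i \<in> oidx Y" and j: "j \<in> oidx (cone_orbifold X)" and y: "y \<in> odom Y i"
    and w: "w \<in> odom (cone_orbifold X) j" and eq: "cone_orbit_map (omap Y i y) = omap (cone_orbifold X) j w"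
  obtain p where "p \<in> Z \<times> {0<..}" "omap Y i y = orbit H (lifted_action act) p"
    using quotient_chartsD(6)[OF Y i y] by blast
  then obtain x r where p: "x \<in> Z" "r > 0" "omap Y i y = orbit H (lifted_action act) (x, r)" by auto
  obtain u s where u: "w = (u, s)" "u \<in> odom X j" "s > 0" using w by (auto simp: cone_orbifold_def)
  have j': "j \<in> oidx X" using j by (simp add: cone_orbifold_def)
  have "omap X j u = orbit H act x" "s = r"
    using eq by (auto simp: p(3) cone_orbit_map_orbit[OF H] cone_orbifold_def u(1))
  then have "omap Y i y = omap X' j w"
    using omap_transport_eq_iff[OF j' u(2,3) p(1,2)] p(3) u(1) by simp
  then show "\<exists>N h. local_lift Y X' id i j N h \<and> y \<in> N \<and> h y = w"
    using lifts_everywhere_id[OF cone_manifold cone_parametrized Y cone_charts, unfolded lifts_everywhere_def,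
        rule_format, of i j y w] i j' y u by (simp add: transport_simps(1,2))
qed

lemma matches2_transport:
  fixes Y :: "('j, ('a \<times> real) set, 'p::euclidean_space) orbifold"
  assumes "quotient_charts (riem_cone S) (Z \<times> {0<..}) H (lifted_action act) Y"
  shows "matches2 Y (cone_orbifold X) cone_orbit_map \<alpha> \<beta> \<longleftrightarrow> matches2 Y X' id \<alpha> \<beta>"
  unfolding matches2_def local_lift_transport[OF assms] ..

end

text \<open>Orbifold charts are a choice, so a reduced space is determined only up to
  diffeomorphism. To be the ray reduced space therefore means both to be one such structure and to
  be identified with any other; one map \<open>\<Theta>\<close>, prescribed on orbits, does
  both.\<close>

theorem lemma3p1:
  fixes S :: "('a, 's::euclidean_space) manifold"
    and \<eta> :: "'a \<Rightarrow> 's \<Rightarrow> real"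
    and g :: "'a \<Rightarrow> 's \<Rightarrow> 's \<Rightarrow> real"
    and G :: "'g monoid"
    and L :: "('g, 'l::{real_normed_vector, heine_borel}) manifold"
    and act :: "'g \<Rightarrow> 'a \<Rightarrow> 'a"
    and \<Phi> :: "'a \<Rightarrow> 'l \<Rightarrow>\<^sub>L real"
    and \<mu> :: "'l \<Rightarrow>\<^sub>L real"
    and K :: "('g, 'k::{real_normed_vector, heine_borel}) manifold"
    and X :: "('i, 'a set, 'q::euclidean_space) orbifold"
    and \<eta>X :: "'i \<Rightarrow> 'q \<Rightarrow> 'q \<Rightarrow> real"
    and gX :: "'i \<Rightarrow> 'q \<Rightarrow> 'q \<Rightarrow> 'q \<Rightarrow> real"
  assumes sasakian: "sasakian S \<eta> g"
    and lie_group: "lie_group L G"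
    and action: "smooth_action L G S act"
    and isometries: "\<forall>h\<in>carrier G. \<forall>x\<in>mcarrier S. \<forall>v w. pullback2 S S (act h) g x v w = g x v w"
    and contactomorphisms: "\<forall>h\<in>carrier G. \<forall>x\<in>mcarrier S. \<forall>v. pullback1 S S (act h) \<eta> x v = \<eta> x v"
    and momentum: "contact_momentum_map L G S \<eta> act \<Phi>"
    and kernel: "kernel_group L G \<mu> K"
    and proper: "proper_action_on (mtop K) (subtopology (mtop S) (ray_level S \<Phi> \<mu>)) act"
    and transverse: "transverse_to_ray S \<Phi> \<mu>"
    and spanning: "{\<xi> + \<zeta> | \<xi> \<zeta>. blinfun_apply \<mu> \<xi> = 0 \<and> \<zeta> \<in> isotropy_algebra L G \<mu>} = UNIV"
    and reduced: "contact_reduction S \<eta> g (G\<lparr>carrier := mcarrier K\<rparr>) act \<Phi> \<mu> X \<eta>X gX"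
  shows "\<exists>\<Theta>.
    (\<forall>(x, r)\<in>ray_level (riem_cone S) (cone_momentum \<Phi>) \<mu>.
       \<Theta> (orbit (G\<lparr>carrier := mcarrier K\<rparr>) (lifted_action act) (x, r))
         = (orbit (G\<lparr>carrier := mcarrier K\<rparr>) act x, r)) \<and>
    homeomorphic_map
      (orbit_space (subtopology (mtop (riem_cone S)) (ray_level (riem_cone S) (cone_momentum \<Phi>) \<mu>))
         (G\<lparr>carrier := mcarrier K\<rparr>) (lifted_action act))
      (otop (cone_orbifold X)) \<Theta> \<and>
    ray_reduction (riem_cone S) (ext_deriv (riem_cone S) (liouville \<eta>)) (cone_metric g)
      (G\<lparr>carrier := mcarrier K\<rparr>) (lifted_action act) (cone_momentum \<Phi>) \<mu>
      (transport_orbifold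
         (orbit_space (subtopology (mtop (riem_cone S)) (ray_level (riem_cone S) (cone_momentum \<Phi>) \<mu>))
            (G\<lparr>carrier := mcarrier K\<rparr>) (lifted_action act))
         \<Theta> (cone_orbifold X))
      (\<lambda>i. ext_d (liouville (\<eta>X i))) (\<lambda>i. cone_metric (gX i)) \<and>
    (\<forall>(Y :: ('j, ('a \<times> real) set, 'p::euclidean_space) orbifold) \<omega>Y gY.
       ray_reduction (riem_cone S) (ext_deriv (riem_cone S) (liouville \<eta>)) (cone_metric g)
         (G\<lparr>carrier := mcarrier K\<rparr>) (lifted_action act) (cone_momentum \<Phi>) \<mu> Y \<omega>Y gY \<longrightarrow>
       orbifold_diffeo Y (cone_orbifold X) \<Theta> \<and>
       matches2 Y (cone_orbifold X) \<Theta> \<omega>Y (\<lambda>i. ext_d (liouville (\<eta>X i))) \<and>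
       matches2 Y (cone_orbifold X) \<Theta> gY (\<lambda>i. cone_metric (gX i)))"
proof -
  define Z where "Z = ray_level S \<Phi> \<mu>"
  define H where "H = G\<lparr>carrier := mcarrier K\<rparr>"
  define T where "T = orbit_space (subtopology (mtop (riem_cone S)) (Z \<times> {0<..})) H (lifted_action act)"
  \<comment> \<open>The cone structure is moved to the orbit space itself, so that it shares its
    underlying points with every \<open>Y\<close>.\<close>
  define X' where "X' = transport_orbifold T cone_orbit_map (cone_orbifold X)"
  have S: "smooth_manifold S" and \<eta>: "one_form S \<eta>" and g: "riemannian_metric S g"
    using sasakian by (auto simp: sasakian_def contact_form_def)
  have "group H" using kernel by (simp add: H_def kernel_group_def lie_group_def)
  then have H: "carrier H \<noteq> {}" using monoid.one_closed[OF group.is_monoid] by blast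
  have Z: "Z \<subseteq> mcarrier S" by (auto simp: Z_def ray_level_def)
  have par: "parametrized_at S Z z" if "z \<in> Z" for z
    unfolding Z_def
    by (rule parametrized_at_ray_level[OF S smooth_momentum[OF S \<eta> lie_group action momentum] transverse])
      (use that in \<open>simp_all add: Z_def\<close>)
  have X: "quotient_orbifold S Z H act X" and \<eta>X: "orbi_one_form X \<eta>X" "projects1 S Z H act X \<eta> \<eta>X"
    and gX: "orbi_metric X gX" "projects_metric S Z H act X g gX"
    using reduced by (simp_all add: contact_reduction_def Z_def H_def)
  note cone = S Z H par X T_def X'_def
  note level = ray_level_cone[of S \<Phi> \<mu>, folded Z_def]
  note charts = cone_charts[OF cone]
  note \<omega> = cone_two_form[OF cone \<eta> \<eta>X] and m = cone_riemannian[OF cone g gX]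
  note M = cone_manifold[OF cone] and param = cone_parametrized[OF cone] and sub = cone_subset[OF cone]
  show ?thesis
    unfolding level H_def[symmetric] T_def[symmetric]
  proof (intro exI[of _ cone_orbit_map] conjI allI impI)
    show "\<forall>(x, r)\<in>Z \<times> {0<..}. cone_orbit_map (orbit H (lifted_action act) (x, r)) = (orbit H act x, r)"
      by (simp add: cone_orbit_map_orbit[OF H])
    show homeo: "homeomorphic_map T (otop (cone_orbifold X)) cone_orbit_map"
      by (rule cone_homeomorphic[OF cone])
    show "ray_reduction (riem_cone S) (ext_deriv (riem_cone S) (liouville \<eta>)) (cone_metric g) H (lifted_action act)
        (cone_momentum \<Phi>) \<mu> (transport_orbifold T cone_orbit_map (cone_orbifold X))
        (\<lambda>i. ext_d (liouville (\<eta>X i))) (\<lambda>i. cone_metric (gX i))"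
      unfolding X'_def[symmetric] ray_reduction_def level using cone_quotient_orbifold[OF cone] \<omega> m(1,2) by simp
    fix Y :: "('j, ('a \<times> real) set, 'p) orbifold" and \<omega>Y gY
    assume "ray_reduction (riem_cone S) (ext_deriv (riem_cone S) (liouville \<eta>)) (cone_metric g) H (lifted_action act)
        (cone_momentum \<Phi>) \<mu> Y \<omega>Y gY"
    then have Y: "quotient_orbifold (riem_cone S) (Z \<times> {0<..}) H (lifted_action act) Y"
      "projects2 (riem_cone S) (Z \<times> {0<..}) H (lifted_action act) Y (ext_deriv (riem_cone S) (liouville \<eta>)) \<omega>Y"
      "projects_metric (riem_cone S) (Z \<times> {0<..}) H (lifted_action act) Y (cone_metric g) gY"
      unfolding ray_reduction_def level by simp_all
    have Ych: "quotient_charts (riem_cone S) (Z \<times> {0<..}) H (lifted_action act) Y"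
      by (rule quotient_orbifold_imp_charts[OF Y(1) sub])
    have transport: "matches2 Y (cone_orbifold X) cone_orbit_map \<alpha> \<beta> \<longleftrightarrow> matches2 Y X' id \<alpha> \<beta>" for \<alpha> \<beta>
      by (rule matches2_transport[OF cone Ych])
    have "otop Y = T" using Y(1) by (simp add: quotient_orbifold_def T_def)
    then show "orbifold_diffeo Y (cone_orbifold X) cone_orbit_map"
      using homeo lifts_everywhere_transport[OF cone Ych] by (simp add: orbifold_diffeo_def)
    show "matches2 Y (cone_orbifold X) cone_orbit_map \<omega>Y (\<lambda>i. ext_d (liouville (\<eta>X i)))"
      unfolding transport by (rule matches2_projects[OF M param Ych Y(2) \<omega>(2)])
    show "matches2 Y (cone_orbifold X) cone_orbit_map gY (\<lambda>i. cone_metric (gX i))"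
      unfolding transport by (rule matches2_projects_metric[OF M param sub m(3,4) Ych Y(3) m(2)])
  qed
qed

end
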